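(* Let $A$ be a normal graded algebra over a field $k$ with a finite group $G$ acting on it by graded $k$-algebra automorphisms. Let $H$ and $K$ be subgroups of $G$ such that $K$ contains the reflection subgroup $W$ of $G$ acting on $A$. Suppose $A^G\subset A^H$ is a free graded extension. (i) The group $G$ is generated by $H$ and the reflections on $A$ contained in $G$, i.e., $G=WH$. (ii) Multiplication induces an isomorphism $$A^K\otimes_{A^G}A^H\simeq A^{K\cap H}.$$ In particular, $A^K\subset A^{K\cap H}$ is also a free graded extension, and $A^KA^H=A^{K\cap H}$, i.e., the ring of $K\cap H$-invariants is generated by the $K$-invariants and the $H$-invariants. (iii) Furthermore, $A^G\subset A^H$ is a graded Gorenstein extension (respectively, graded complete intersection extension) if and only if $A^K\subset A^{K\cap H}$ is a graded Gorenstein extension (respectively, graded complete intersection extension).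
   Context: $k$ is a field of arbitrary characteristic. A graded algebra is a finitely generated graded $k$-algebra $A=\bigoplus_{i\ge 0}A_i$ without zero-divisors with $A_0=k$; it is normal if it is integrally closed in its quotient field; $A_+=\bigoplus_{i>0}A_i$. $G$ is a finite group of graded $k$-algebra automorphisms of $A$ (so the action is faithful), and $A^H$ denotes the ring of $H$-invariants. The inertia subgroup of a prime ideal $\mathfrak P\subset A$ is $G_i(\mathfrak P)=\{\sigma\in G:\ \sigma(a)-a\in\mathfrak P \text{ for all } a\in A\}$. An element $\sigma \in G$ is a reflection on $A$ if it lies in the inertia subgroup of some prime ideal of height one; $W$ is the (normal) subgroup of $G$ generated by all reflections on $A$. For subgroups $L'\leq L\leq G$, the extension $A^{L}\subset A^{L'}$ is a free graded extension if $A^{L'}$ is a free graded $A^{L}$-module. It is a graded Gorenstein extension if it is a free graded extension and the fibre algebra $A^{L'}/A^{L}_+A^{L'}$ is a Gorenstein algebra (of Krull dimension zero). It is a graded complete intersection extension if it is a free graded extension and the fibre algebra is a graded complete intersection algebra. *)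

theory Defs
  imports "HOL-Algebra.Algebra" "HOL-Algebra.Free_Abelian_Groups" "HOL-Library.Extended_Nat"
begin

text \<open>
  Conventions. All rings are commutative rings with one. The base field is identified with the
  degree zero part of the graded algebra, so it is a subfield \<open>k\<close> of \<open>A\<close> with \<open>gr 0 = k\<close>.
  Rings of invariants are restrictions of \<open>A\<close> to a smaller carrier.
\<close>

section \<open>Quotient fields and normality\<close>

definition fraction :: "('a, 'm) ring_scheme \<Rightarrow> 'a \<Rightarrow> 'a \<Rightarrow> ('a \<times> 'a) set" where
  "fraction R a b =
     {(c, d). c \<in> carrier R \<and> d \<in> carrier R - {\<zero>\<^bsub>R\<^esub>} \<and> a \<otimes>\<^bsub>R\<^esub> d = c \<otimes>\<^bsub>R\<^esub> b}"

text \<open>As for quotient rings in the library, the operations are written as unions over all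
  representatives; over a domain all members of such a union coincide.\<close>

definition quotient_field :: "('a, 'm) ring_scheme \<Rightarrow> ('a \<times> 'a) set ring" where
  "quotient_field R =
     \<lparr>carrier = {fraction R a b | a b. a \<in> carrier R \<and> b \<in> carrier R - {\<zero>\<^bsub>R\<^esub>}},
      monoid.mult = (\<lambda>U V. \<Union>x\<in>U. \<Union>y\<in>V.
                fraction R (fst x \<otimes>\<^bsub>R\<^esub> fst y) (snd x \<otimes>\<^bsub>R\<^esub> snd y)),
      one = fraction R \<one>\<^bsub>R\<^esub> \<one>\<^bsub>R\<^esub>,
      ring.zero = fraction R \<zero>\<^bsub>R\<^esub> \<one>\<^bsub>R\<^esub>,
      add = (\<lambda>U V. \<Union>x\<in>U. \<Union>y\<in>V.
               fraction R (fst x \<otimes>\<^bsub>R\<^esub> snd y \<oplus>\<^bsub>R\<^esub> fst y \<otimes>\<^bsub>R\<^esub> snd x)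
                          (snd x \<otimes>\<^bsub>R\<^esub> snd y))\<rparr>"

definition integral_over :: "('a, 'm) ring_scheme \<Rightarrow> 'a set \<Rightarrow> 'a \<Rightarrow> bool" where
  "integral_over F S x \<longleftrightarrow>
     (\<exists>p. polynomial\<^bsub>F\<^esub> S p \<and> p \<noteq> [] \<and> lead_coeff p = \<one>\<^bsub>F\<^esub> \<and> ring.eval F p x = \<zero>\<^bsub>F\<^esub>)"

definition integrally_closed :: "('a, 'm) ring_scheme \<Rightarrow> bool" where
  "integrally_closed R \<longleftrightarrow>
     (let F = quotient_field R; R' = (\<lambda>a. fraction R a \<one>\<^bsub>R\<^esub>) ` carrier R
      in \<forall>x\<in>carrier F. integral_over F R' x \<longrightarrow> x \<in> R')"


section \<open>Graded algebras and their automorphisms\<close>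

locale graded_algebra = domain A for A (structure) +
  fixes k :: "'a set" and gr :: "nat \<Rightarrow> 'a set"
  assumes base_field: "subfield k A"
    and gr_subgroup: "\<And>i. subgroup (gr i) (add_monoid A)"
    and gr_mult: "\<And>i j a b. a \<in> gr i \<Longrightarrow> b \<in> gr j \<Longrightarrow> a \<otimes> b \<in> gr (i + j)"
    and gr_direct_sum: "\<And>a. a \<in> carrier A \<Longrightarrow>
          \<exists>!c. (\<forall>i. c i \<in> gr i) \<and> finite {i. c i \<noteq> \<zero>} \<and> a = (\<Oplus>i\<in>{i. c i \<noteq> \<zero>}. c i)"
    and gr_zero: "gr 0 = k"
    and finitely_generated:
          "\<exists>S. finite S \<and> S \<subseteq> carrier A \<and> carrier A = generate_ring A (k \<union> S)"

locale normal_graded_algebra = graded_algebra +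
  assumes normal: "integrally_closed A"

definition graded_aut_group ::
    "('a, 'm) ring_scheme \<Rightarrow> 'a set \<Rightarrow> (nat \<Rightarrow> 'a set) \<Rightarrow> ('a \<Rightarrow> 'a) monoid" where
  "graded_aut_group A k gr = BijGroup (carrier A)
     \<lparr>carrier := {\<sigma> \<in> ring_hom A A \<inter> Bij (carrier A).
                   (\<forall>i. \<sigma> ` gr i = gr i) \<and> (\<forall>c\<in>k. \<sigma> c = c)}\<rparr>"

definition ring_of_invariants :: "('a, 'm) ring_scheme \<Rightarrow> ('a \<Rightarrow> 'a) set \<Rightarrow> ('a, 'm) ring_scheme" where
  "ring_of_invariants A H = A\<lparr>carrier := {a \<in> carrier A. \<forall>\<sigma>\<in>H. \<sigma> a = a}\<rparr>"


section \<open>Inertia groups and reflections\<close>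

definition height :: "('a, 'm) ring_scheme \<Rightarrow> 'a set \<Rightarrow> enat" where
  "height R P = Sup {enat n | n. \<exists>Q :: nat \<Rightarrow> 'a set.
     (\<forall>i\<le>n. primeideal (Q i) R) \<and> (\<forall>i<n. Q i \<subset> Q (Suc i)) \<and> Q n = P}"

definition krull_dim :: "('a, 'm) ring_scheme \<Rightarrow> enat" where
  "krull_dim R = Sup {height R P | P. primeideal P R}"

definition inertia_group ::
    "('a, 'm) ring_scheme \<Rightarrow> ('a \<Rightarrow> 'a) set \<Rightarrow> 'a set \<Rightarrow> ('a \<Rightarrow> 'a) set" where
  "inertia_group A G P = {\<sigma> \<in> G. \<forall>a\<in>carrier A. \<sigma> a \<ominus>\<^bsub>A\<^esub> a \<in> P}"

definition reflections :: "('a, 'm) ring_scheme \<Rightarrow> ('a \<Rightarrow> 'a) set \<Rightarrow> ('a \<Rightarrow> 'a) set" where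
  "reflections A G =
     {\<sigma> \<in> G. \<exists>P. primeideal P A \<and> height A P = 1 \<and> \<sigma> \<in> inertia_group A G P}"

definition reflection_subgroup ::
    "('a, 'm) ring_scheme \<Rightarrow> ('a \<Rightarrow> 'a) set \<Rightarrow> ('a \<Rightarrow> 'a) set" where
  "reflection_subgroup A G = generate (BijGroup (carrier A)) (reflections A G)"


section \<open>Tensor products of ring extensions\<close>

text \<open>For subrings \<open>R \<subseteq> S\<close> and \<open>R \<subseteq> T\<close>, the tensor product is the free abelian group on
  \<open>S \<times> T\<close> modulo the subgroup generated by the usual relations, with the multiplication induced
  by \<open>(s, t) (s', t') = (s s', t t')\<close>. That subgroup is an ideal for this multiplication.\<close>

definition pair_ring ::
    "('a, 'm) ring_scheme \<Rightarrow> ('a, 'm) ring_scheme \<Rightarrow> (('a \<times> 'a) \<Rightarrow>\<^sub>0 int) ring" where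
  "pair_ring S T =
     \<lparr>carrier = carrier (free_Abelian_group (carrier S \<times> carrier T)),
      monoid.mult = (\<lambda>p q. frag_extend (\<lambda>(s, t). frag_extend (\<lambda>(s', t').
                frag_of (s \<otimes>\<^bsub>S\<^esub> s', t \<otimes>\<^bsub>T\<^esub> t')) q) p),
      one = frag_of (\<one>\<^bsub>S\<^esub>, \<one>\<^bsub>T\<^esub>), ring.zero = 0, add = (+)\<rparr>"

definition tensor_relations :: "('a, 'm) ring_scheme \<Rightarrow> ('a, 'm) ring_scheme \<Rightarrow>
    ('a, 'm) ring_scheme \<Rightarrow> (('a \<times> 'a) \<Rightarrow>\<^sub>0 int) set" where
  "tensor_relations R S T = generate (free_Abelian_group (carrier S \<times> carrier T))
     ({frag_of (s \<oplus>\<^bsub>S\<^esub> s', t) - frag_of (s, t) - frag_of (s', t) | s s' t.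
         s \<in> carrier S \<and> s' \<in> carrier S \<and> t \<in> carrier T} \<union>
      {frag_of (s, t \<oplus>\<^bsub>T\<^esub> t') - frag_of (s, t) - frag_of (s, t') | s t t'.
         s \<in> carrier S \<and> t \<in> carrier T \<and> t' \<in> carrier T} \<union>
      {frag_of (s \<otimes>\<^bsub>S\<^esub> r, t) - frag_of (s, r \<otimes>\<^bsub>T\<^esub> t) | r s t.
         r \<in> carrier R \<and> s \<in> carrier S \<and> t \<in> carrier T})"

definition tensor_product :: "('a, 'm) ring_scheme \<Rightarrow> ('a, 'm) ring_scheme \<Rightarrow>
    ('a, 'm) ring_scheme \<Rightarrow> (('a \<times> 'a) \<Rightarrow>\<^sub>0 int) set ring" where
  "tensor_product R S T = pair_ring S T Quot tensor_relations R S T"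

definition pure_tensor :: "('a, 'm) ring_scheme \<Rightarrow> ('a, 'm) ring_scheme \<Rightarrow>
    ('a, 'm) ring_scheme \<Rightarrow> 'a \<Rightarrow> 'a \<Rightarrow> (('a \<times> 'a) \<Rightarrow>\<^sub>0 int) set" where
  "pure_tensor R S T s t = tensor_relations R S T +>\<^bsub>pair_ring S T\<^esub> frag_of (s, t)"


section \<open>Gorenstein rings\<close>

definition module_hom ::
    "('r, 'm) ring_scheme \<Rightarrow> ('r, 'x, 'p) module_scheme \<Rightarrow> ('r, 'y, 'q) module_scheme \<Rightarrow>
     ('x \<Rightarrow> 'y) set" where
  "module_hom R M N = {f \<in> carrier M \<rightarrow> carrier N.
     (\<forall>x\<in>carrier M. \<forall>y\<in>carrier M. f (x \<oplus>\<^bsub>M\<^esub> y) = f x \<oplus>\<^bsub>N\<^esub> f y) \<and>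
     (\<forall>r\<in>carrier R. \<forall>x\<in>carrier M. f (r \<odot>\<^bsub>M\<^esub> x) = r \<odot>\<^bsub>N\<^esub> f x)}"

definition regular_module :: "('r, 'm) ring_scheme \<Rightarrow> ('r, 'r) module" where
  "regular_module R = \<lparr>carrier = carrier R, monoid.mult = monoid.mult R, one = one R,
     ring.zero = ring.zero R, add = add R, smult = monoid.mult R\<rparr>"

text \<open>All modules below live on the type \<open>'r\<close> of the elements of the ring. For injectivity this
  is no restriction, because the test modules include all ideals of the ring (Baer's criterion).
  Nor is it one for the existence of a finite injective resolution of a noetherian local ring:
  an infinite \<open>'r\<close> is large enough to carry the modules of the minimal injective resolution, and
  a finite local ring with a finite injective resolution is itself injective.\<close>

definition injective_module :: "('r, 'm) ring_scheme \<Rightarrow> ('r, 'r) module \<Rightarrow> bool" where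
  "injective_module R E \<longleftrightarrow> module R E \<and>
     (\<forall>(M :: ('r, 'r) module) (N :: ('r, 'r) module) i g.
        module R M \<and> module R N \<and> i \<in> module_hom R M N \<and> inj_on i (carrier M) \<and>
        g \<in> module_hom R M E \<longrightarrow> (\<exists>h\<in>module_hom R N E. \<forall>x\<in>carrier M. h (i x) = g x))"

definition injective_resolution ::
    "('r, 'm) ring_scheme \<Rightarrow> ('r, 'r) module \<Rightarrow> (nat \<Rightarrow> ('r, 'r) module) \<Rightarrow>
     ('r \<Rightarrow> 'r) \<Rightarrow> (nat \<Rightarrow> 'r \<Rightarrow> 'r) \<Rightarrow> bool" where
  "injective_resolution R M E \<epsilon> \<delta> \<longleftrightarrow>
     (\<forall>i. injective_module R (E i)) \<and>
     \<epsilon> \<in> module_hom R M (E 0) \<and> inj_on \<epsilon> (carrier M) \<and>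
     (\<forall>i. \<delta> i \<in> module_hom R (E i) (E (Suc i))) \<and>
     \<epsilon> ` carrier M = {x \<in> carrier (E 0). \<delta> 0 x = \<zero>\<^bsub>E 1\<^esub>} \<and>
     (\<forall>i. \<delta> i ` carrier (E i) =
        {x \<in> carrier (E (Suc i)). \<delta> (Suc i) x = \<zero>\<^bsub>E (Suc (Suc i))\<^esub>})"

definition finite_injective_dim :: "('r, 'm) ring_scheme \<Rightarrow> ('r, 'r) module \<Rightarrow> bool" where
  "finite_injective_dim R M \<longleftrightarrow> (\<exists>n E \<epsilon> \<delta>. injective_resolution R M E \<epsilon> \<delta> \<and>
     (\<forall>i>n. carrier (E i) = {\<zero>\<^bsub>E i\<^esub>}))"

definition gorenstein_local_ring :: "('r, 'm) ring_scheme \<Rightarrow> bool" where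
  "gorenstein_local_ring R \<longleftrightarrow> cring R \<and> noetherian_ring R \<and> (\<exists>!m. maximalideal m R) \<and>
     finite_injective_dim R (regular_module R)"


section \<open>Graded complete intersections\<close>

definition mpoly_ring :: "('a, 'm) ring_scheme \<Rightarrow> 'c set \<Rightarrow> ('c multiset \<Rightarrow> 'a) ring" where
  "mpoly_ring F I =
     \<lparr>carrier = ring.indexed_pset F I (carrier F),
      monoid.mult = (\<lambda>P Q m. \<Oplus>\<^bsub>F\<^esub>u\<in>{u. u \<subseteq># m}. P u \<otimes>\<^bsub>F\<^esub> Q (m - u)),
      one = ring.indexed_const F \<one>\<^bsub>F\<^esub>,
      ring.zero = ring.indexed_const F \<zero>\<^bsub>F\<^esub>,
      add = ring.indexed_padd F\<rparr>"

definition mpoly_homogeneous ::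
    "('a, 'm) ring_scheme \<Rightarrow> 'c set \<Rightarrow> ('c \<Rightarrow> nat) \<Rightarrow> nat \<Rightarrow> ('c multiset \<Rightarrow> 'a) set" where
  "mpoly_homogeneous F I d j =
     {P \<in> carrier (mpoly_ring F I). \<forall>u. P u \<noteq> \<zero>\<^bsub>F\<^esub> \<longrightarrow> sum_mset (image_mset d u) = j}"

definition regular_sequence :: "('a, 'm) ring_scheme \<Rightarrow> 'a list \<Rightarrow> bool" where
  "regular_sequence R fs \<longleftrightarrow> set fs \<subseteq> carrier R \<and>
     (\<forall>i<length fs. \<forall>a\<in>carrier R.
        a \<otimes>\<^bsub>R\<^esub> fs ! i \<in> Idl\<^bsub>R\<^esub> (set (take i fs)) \<longrightarrow> a \<in> Idl\<^bsub>R\<^esub> (set (take i fs))) \<and>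
     Idl\<^bsub>R\<^esub> (set fs) \<noteq> carrier R"

text \<open>A graded algebra over the field \<open>F\<close> is given here by a ring \<open>B\<close>, its homogeneous parts
  \<open>gr\<close>, and its structure map \<open>\<eta> : F \<rightarrow> B\<close>. It is a graded complete intersection if, as a graded
  \<open>F\<close>-algebra, it is isomorphic to a polynomial ring in finitely many variables of positive
  degrees modulo a regular sequence of homogeneous polynomials.\<close>

definition graded_complete_intersection ::
    "('a, 'm) ring_scheme \<Rightarrow> ('b, 'n) ring_scheme \<Rightarrow> (nat \<Rightarrow> 'b set) \<Rightarrow> ('a \<Rightarrow> 'b) \<Rightarrow> bool" where
  "graded_complete_intersection F B gr \<eta> \<longleftrightarrow>
     (\<exists>(n :: nat) (d :: nat \<Rightarrow> nat) fs.
        let P = mpoly_ring F {..<n}; J = Idl\<^bsub>P\<^esub> (set fs) in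
        (\<forall>i<n. d i > 0) \<and>
        (\<forall>f\<in>set fs. \<exists>j. f \<in> mpoly_homogeneous F {..<n} d j) \<and>
        regular_sequence P fs \<and>
        (\<exists>\<phi> \<in> ring_iso (P Quot J) B.
           (\<forall>c\<in>carrier F. \<phi> (J +>\<^bsub>P\<^esub> ring.indexed_const F c) = \<eta> c) \<and>
           (\<forall>j. (\<lambda>f. \<phi> (J +>\<^bsub>P\<^esub> f)) ` mpoly_homogeneous F {..<n} d j = gr j)))"


section \<open>Graded extensions\<close>

text \<open>Here \<open>R \<subseteq> S\<close> are subrings of a graded ring, generated as additive groups by homogeneous
  elements, and \<open>gr\<close> is the grading of the ambient ring.\<close>

definition free_graded_extension ::
    "(nat \<Rightarrow> 'a set) \<Rightarrow> ('a, 'm) ring_scheme \<Rightarrow> ('a, 'm) ring_scheme \<Rightarrow> bool" where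
  "free_graded_extension gr R S \<longleftrightarrow>
     (\<exists>B \<subseteq> carrier S. (\<forall>b\<in>B. \<exists>i. b \<in> gr i) \<and>
        (\<forall>x\<in>carrier S. \<exists>!c. c \<in> B \<rightarrow>\<^sub>E carrier R \<and> finite {b \<in> B. c b \<noteq> \<zero>\<^bsub>R\<^esub>} \<and>
           x = (\<Oplus>\<^bsub>S\<^esub>b\<in>{b \<in> B. c b \<noteq> \<zero>\<^bsub>R\<^esub>}. c b \<otimes>\<^bsub>S\<^esub> b)))"

definition positive_part :: "(nat \<Rightarrow> 'a set) \<Rightarrow> ('a, 'm) ring_scheme \<Rightarrow> 'a set" where
  "positive_part gr R = generate (add_monoid R) (\<Union>i\<in>{0<..}. gr i \<inter> carrier R)"

definition fibre_ideal ::
    "(nat \<Rightarrow> 'a set) \<Rightarrow> ('a, 'm) ring_scheme \<Rightarrow> ('a, 'm) ring_scheme \<Rightarrow> 'a set" where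
  "fibre_ideal gr R S = Idl\<^bsub>S\<^esub> (positive_part gr R)"

definition fibre_algebra ::
    "(nat \<Rightarrow> 'a set) \<Rightarrow> ('a, 'm) ring_scheme \<Rightarrow> ('a, 'm) ring_scheme \<Rightarrow> 'a set ring" where
  "fibre_algebra gr R S = S Quot fibre_ideal gr R S"

definition fibre_grading ::
    "(nat \<Rightarrow> 'a set) \<Rightarrow> ('a, 'm) ring_scheme \<Rightarrow> ('a, 'm) ring_scheme \<Rightarrow> nat \<Rightarrow> 'a set set" where
  "fibre_grading gr R S i = (\<lambda>a. fibre_ideal gr R S +>\<^bsub>S\<^esub> a) ` (gr i \<inter> carrier S)"

definition graded_gorenstein_extension ::
    "(nat \<Rightarrow> 'a set) \<Rightarrow> ('a, 'm) ring_scheme \<Rightarrow> ('a, 'm) ring_scheme \<Rightarrow> bool" where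
  "graded_gorenstein_extension gr R S \<longleftrightarrow> free_graded_extension gr R S \<and>
     krull_dim (fibre_algebra gr R S) = 0 \<and> gorenstein_local_ring (fibre_algebra gr R S)"

definition graded_ci_extension ::
    "'a set \<Rightarrow> (nat \<Rightarrow> 'a set) \<Rightarrow> ('a, 'm) ring_scheme \<Rightarrow> ('a, 'm) ring_scheme \<Rightarrow> bool" where
  "graded_ci_extension k gr R S \<longleftrightarrow> free_graded_extension gr R S \<and>
     graded_complete_intersection (R\<lparr>carrier := k\<rparr>) (fibre_algebra gr R S)
       (fibre_grading gr R S) (\<lambda>c. fibre_ideal gr R S +>\<^bsub>S\<^esub> c)"

end

theory Submission
  imports Defs
begin

text \<open>
  Let \<open>B\<close> be a homogeneous basis of \<open>A\<^sup>H\<close> over \<open>A\<^sup>G\<close>. The proof is about functions \<open>f\<close> from \<open>G\<close> to \<open>A\<close> with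
  \<open>f (g h) = f g\<close> for \<open>h\<close> in \<open>H\<close> and \<open>f (k g) = k (f g)\<close> for \<open>k\<close> in \<open>K\<close>. Everything follows from one
  assertion (\<open>equivariant_expansion\<close>): if \<open>K\<close> contains the reflections, then each such function has the
  form \<open>f g = \<Sum> c b \<cdot> g b\<close> with coefficients in \<open>A\<^sup>K\<close>. The coefficients are unique
  (\<open>basis_independent\<close>).

  Distinct automorphisms are separated by elements of \<open>A\<close>, so for some nonzero \<open>\<delta>\<close> in \<open>A\<^sup>G\<close> there is
  always an expansion \<open>\<delta> f g = \<Sum> c b \<cdot> g b\<close> (\<open>common_denominator\<close>), and uniqueness puts the \<open>c b\<close> into
  \<open>A\<^sup>K\<close>. It remains to show that \<open>\<delta>\<close> divides \<open>c b\<close>. The algebra \<open>A\<close> is noetherian by Hilbert's basis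
  theorem, and it is normal. Hence it is enough to find, for every prime ideal \<open>P\<close> of height one, some \<open>d\<close>
  outside \<open>P\<close> such that \<open>\<delta>\<close> divides \<open>d c b\<close> (\<open>denominators_in_height_one_prime\<close>). The inertia group \<open>I\<close> of
  \<open>P\<close> consists of reflections, so \<open>I \<subseteq> K\<close> and \<open>c b\<close> is \<open>I\<close>-invariant. For \<open>s\<close> in \<open>A\<^sup>I\<close> the sum of
  \<open>\<gamma> (s f(\<gamma>\<^sup>-\<^sup>1))\<close> over the cosets of \<open>I\<close> is an \<open>H\<close>-invariant, and freeness over \<open>A\<^sup>G\<close> shows that \<open>\<delta>\<close>
  divides the traces \<open>\<Sum> \<gamma> (s c b)\<close> (\<open>coset_sum_coefficients\<close>). In other words, \<open>c b / \<delta>\<close> lies in the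
  inverse different of \<open>A\<^sup>I\<close> over \<open>A\<^sup>G\<close>. That extension is unramified at \<open>P\<close>. Concretely, some combination
  \<open>\<Sum> t\<^sub>l \<cdot> g s\<^sub>l\<close> with \<open>s\<^sub>l\<close> in \<open>A\<^sup>I\<close>, as a function of \<open>g\<close>, vanishes outside \<open>I\<close> and has a value \<open>d\<close>
  outside \<open>P\<close> on \<open>I\<close> (\<open>inertia_separator\<close>). Combining the traces with the coefficients \<open>t\<^sub>l\<close> yields
  \<open>d c b\<close>. This argument is valid in every characteristic, because the separator is built from products
  and not from averages.

  For the indicator function of \<open>K H\<close>, one compares components of degree zero. There each \<open>g b\<close> is
  independent of \<open>g\<close>, so the function is constant and \<open>G = K H\<close>. With \<open>K = W\<close> this is the first
  assertion. An invariant \<open>x\<close> of \<open>K \<inter> H\<close> defines the function \<open>k h \<mapsto> k x\<close>; its expansion at the identity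
  shows that \<open>B\<close> is also a basis of \<open>A\<^sup>K\<^sup>\<inter>\<^sup>H\<close> over \<open>A\<^sup>K\<close> (\<open>free_basis_intersection\<close>). Since every tensor has the
  form \<open>\<Sum> c b \<otimes> b\<close>, the multiplication map is an isomorphism (\<open>tensor_product_iso\<close>). Finally, both fibre
  algebras have the classes of \<open>B\<close> as a basis over \<open>k\<close>, and the inclusion of \<open>A\<^sup>H\<close> in \<open>A\<^sup>K\<^sup>\<inter>\<^sup>H\<close> induces an
  isomorphism between them as graded algebras (\<open>fibre_algebra_iso\<close>). The Gorenstein and complete
  intersection properties are transported along it.
\<close>

section \<open>Hilbert's basis theorem\<close>

text \<open>Finite generation over a subring is expressed inside the ambient ring. In this way the basis theorem
  can be iterated along a tower of subrings without any change of ring structure.\<close>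

inductive_set (in ring) lin_span :: "'a set \<Rightarrow> 'a set \<Rightarrow> 'a set" for K F where
  zero: "\<zero> \<in> lin_span K F"
| step: "r \<in> K \<Longrightarrow> f \<in> F \<Longrightarrow> y \<in> lin_span K F \<Longrightarrow> r \<otimes> f \<oplus> y \<in> lin_span K F"

definition (in ring) ideal_in :: "'a set \<Rightarrow> 'a set \<Rightarrow> bool" where
  "ideal_in K J \<longleftrightarrow> J \<subseteq> K \<and> \<zero> \<in> J \<and> (\<forall>x\<in>J. \<forall>y\<in>J. x \<oplus> y \<in> J) \<and> (\<forall>r\<in>K. \<forall>x\<in>J. r \<otimes> x \<in> J)"

definition (in ring) noetherian_subring :: "'a set \<Rightarrow> bool" where
  "noetherian_subring K \<longleftrightarrow> subring K R \<and>
     (\<forall>J. ideal_in K J \<longrightarrow> (\<exists>F. finite F \<and> F \<subseteq> J \<and> J \<subseteq> lin_span K F))"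

lemma (in ring) lin_span_least:
  assumes "ideal_in K J" "F \<subseteq> J" shows "lin_span K F \<subseteq> J"
proof
  fix x assume "x \<in> lin_span K F"
  then show "x \<in> J"
    by induction (use assms in \<open>auto simp: ideal_in_def\<close>)
qed

lemma (in ring) lin_span_mono:
  assumes "F \<subseteq> F'" shows "lin_span K F \<subseteq> lin_span K F'"
proof
  fix x assume "x \<in> lin_span K F"
  then show "x \<in> lin_span K F'"
    by induction (use assms in \<open>auto intro: lin_span.intros\<close>)
qed

lemma (in ring) lin_span_incl:
  assumes "K \<subseteq> carrier R" "F \<subseteq> carrier R" shows "lin_span K F \<subseteq> carrier R"
proof
  fix x assume "x \<in> lin_span K F"
  then show "x \<in> carrier R"
    by induction (use assms in auto)
qed

lemma (in ring) lin_span_add: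
  assumes "K \<subseteq> carrier R" "F \<subseteq> carrier R" "x \<in> lin_span K F" "y \<in> lin_span K F"
  shows "x \<oplus> y \<in> lin_span K F"
  using assms(3)
proof induction
  case zero
  then show ?case using assms lin_span_incl[OF assms(1,2)] by (simp add: subset_iff)
next
  case (step r f z)
  have "r \<otimes> f \<oplus> z \<oplus> y = r \<otimes> f \<oplus> (z \<oplus> y)"
    using step assms lin_span_incl[OF assms(1,2)] by (intro a_assoc) auto
  then show ?case using step by (auto intro: lin_span.intros)
qed

lemma (in cring) ideal_if_ideal_in:
  assumes "ideal_in (carrier R) I" shows "ideal I R"
proof (rule idealI)
  have I: "I \<subseteq> carrier R" "\<zero> \<in> I" "\<And>x y. x \<in> I \<Longrightarrow> y \<in> I \<Longrightarrow> x \<oplus> y \<in> I"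
    "\<And>r x. r \<in> carrier R \<Longrightarrow> x \<in> I \<Longrightarrow> r \<otimes> x \<in> I" using assms by (auto simp: ideal_in_def)
  show "subgroup I (add_monoid R)"
  proof (rule group.subgroupI)
    fix a assume a: "a \<in> I"
    then have "inv\<^bsub>add_monoid R\<^esub> a = \<ominus> \<one> \<otimes> a" using I(1) by (auto simp: l_minus a_inv_def[symmetric])
    then show "inv\<^bsub>add_monoid R\<^esub> a \<in> I" using I(4)[OF _ a] by simp
  qed (use I add.group_axioms in auto)
  show "x \<otimes> a \<in> I" "a \<otimes> x \<in> I" if "a \<in> I" "x \<in> carrier R" for a x
    using I(4)[OF that(2,1)] I(1) that m_comm[of a x] by auto
qed (rule ring_axioms)

lemma (in cring) lin_span_smult:
  assumes "subring K R" "F \<subseteq> carrier R" "r \<in> K" "x \<in> lin_span K F"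
  shows "r \<otimes> x \<in> lin_span K F"
  using assms(4)
proof induction
  case zero
  have "r \<in> carrier R" using assms subringE(1)[OF assms(1)] by auto
  then show ?case by (simp add: lin_span.zero)
next
  case (step s f y)
  have K: "K \<subseteq> carrier R" using subringE(1)[OF assms(1)] .
  have "r \<otimes> (s \<otimes> f \<oplus> y) = (r \<otimes> s) \<otimes> f \<oplus> r \<otimes> y"
    using step assms K lin_span_incl[OF K assms(2)]
    by (simp add: subset_iff r_distr m_assoc)
  then show ?case using step assms subringE(6)[OF assms(1)] by (auto intro: lin_span.intros)
qed

context domain
begin

text \<open>The combinations of the first \<open>n\<close> members of a sequence. For the powers of \<open>x\<close> these are the
  values at \<open>x\<close> of the polynomials of degree less than \<open>n\<close>.\<close>

fun initial_span :: "'a set \<Rightarrow> (nat \<Rightarrow> 'a) \<Rightarrow> nat \<Rightarrow> 'a set" where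
  "initial_span K q 0 = {\<zero>}"
| "initial_span K q (Suc n) = {r \<otimes> q n \<oplus> y | r y. r \<in> K \<and> y \<in> initial_span K q n}"

context
  fixes K :: "'a set" and q :: "nat \<Rightarrow> 'a"
  assumes K: "subring K R" and q: "\<And>n. q n \<in> carrier R"
begin

lemma initial_span_incl: "initial_span K q n \<subseteq> carrier R"
  using subringE(1)[OF K] q by (induction n) (auto simp: subset_iff)

lemma initial_span_SucI:
  "r \<in> K \<Longrightarrow> y \<in> initial_span K q n \<Longrightarrow> r \<otimes> q n \<oplus> y \<in> initial_span K q (Suc n)"
  by auto

lemma initial_span_add:
  "y \<in> initial_span K q n \<Longrightarrow> z \<in> initial_span K q n \<Longrightarrow> y \<oplus> z \<in> initial_span K q n"
proof (induction n arbitrary: y z)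
  case (Suc n)
  obtain r y' where y: "y = r \<otimes> q n \<oplus> y'" "r \<in> K" "y' \<in> initial_span K q n" using Suc(2) by auto
  obtain s z' where z: "z = s \<otimes> q n \<oplus> z'" "s \<in> K" "z' \<in> initial_span K q n" using Suc(3) by auto
  have "r \<in> carrier R" "s \<in> carrier R" "y' \<in> carrier R" "z' \<in> carrier R" "q n \<in> carrier R"
    using y z subringE(1)[OF K] initial_span_incl q by auto
  then have eq: "y \<oplus> z = (r \<oplus> s) \<otimes> q n \<oplus> (y' \<oplus> z')"
    unfolding y z by algebra
  then show ?case using initial_span_SucI[OF _ Suc.IH[OF y(3) z(3)], of "r \<oplus> s"]
      subringE(7)[OF K y(2) z(2)] unfolding eq by blast
qed auto

lemma initial_span_smult:
  "r \<in> K \<Longrightarrow> y \<in> initial_span K q n \<Longrightarrow> r \<otimes> y \<in> initial_span K q n"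
proof (induction n arbitrary: y)
  case (Suc n)
  obtain s y' where y: "y = s \<otimes> q n \<oplus> y'" "s \<in> K" "y' \<in> initial_span K q n" using Suc(3) by auto
  have "r \<in> carrier R" "s \<in> carrier R" "y' \<in> carrier R" "q n \<in> carrier R"
    using y Suc(2) subringE(1)[OF K] initial_span_incl q by auto
  then have eq: "r \<otimes> y = (r \<otimes> s) \<otimes> q n \<oplus> (r \<otimes> y')"
    unfolding y by algebra
  then show ?case using initial_span_SucI[OF _ Suc.IH[OF Suc(2) y(3)], of "r \<otimes> s"]
      subringE(6)[OF K Suc(2) y(2)] unfolding eq by blast
qed (use subringE(1)[OF K] in auto)

lemma initial_span_Suc:
  assumes "y \<in> initial_span K q n" shows "y \<in> initial_span K q (Suc n)"
proof -
  have "y \<in> carrier R" using assms initial_span_incl by blast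
  then have "\<zero> \<otimes> q n \<oplus> y = y" using q by simp
  then show ?thesis using initial_span_SucI[OF subringE(2)[OF K] assms] by simp
qed

lemma initial_span_zero: "\<zero> \<in> initial_span K q n"
  by (induction n) (simp, rule initial_span_Suc)

lemma initial_span_mono: "n \<le> m \<Longrightarrow> y \<in> initial_span K q n \<Longrightarrow> y \<in> initial_span K q m"
  by (induction m rule: dec_induct) (auto simp del: initial_span.simps intro: initial_span_Suc)

end

context
  fixes K :: "'a set" and x :: 'a
  assumes K: "subring K R" and x: "x \<in> carrier R"
begin

abbreviation (input) deg_less :: "nat \<Rightarrow> 'a set" where
  "deg_less \<equiv> initial_span K (\<lambda>n. x [^] n)"

lemma coefficients_closed: "K \<subseteq> carrier R" using subringE(1)[OF K] .

lemma power_closed: "x [^] (n::nat) \<in> carrier R" using x by simp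

lemmas deg_less_incl = initial_span_incl[where q = "\<lambda>n. x [^] n", OF K power_closed]
lemmas deg_less_add = initial_span_add[where q = "\<lambda>n. x [^] n", OF K power_closed]
lemmas deg_less_smult = initial_span_smult[where q = "\<lambda>n. x [^] n", OF K power_closed]
lemmas deg_less_zero = initial_span_zero[where q = "\<lambda>n. x [^] n", OF K power_closed]
lemmas deg_less_mono = initial_span_mono[where q = "\<lambda>n. x [^] n", OF K power_closed]

lemma deg_less_shift: "y \<in> deg_less n \<Longrightarrow> x \<otimes> y \<in> deg_less (Suc n)"
proof (induction n arbitrary: y)
  case 0
  then show ?case using deg_less_zero[of 1] x by simp
next
  case (Suc n)
  obtain s y' where y: "y = s \<otimes> x [^] n \<oplus> y'" "s \<in> K" "y' \<in> deg_less n" using Suc(2) by auto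
  have "s \<in> carrier R" "y' \<in> carrier R" "x [^] n \<in> carrier R"
    using y coefficients_closed deg_less_incl x by auto
  then have "x \<otimes> y = s \<otimes> (x [^] n \<otimes> x) \<oplus> (x \<otimes> y')"
    unfolding y using x by algebra
  also have "x [^] n \<otimes> x = x [^] (Suc n)" by simp
  finally show ?case using y Suc.IH[OF y(3)] by (subst initial_span.simps) blast
qed

lemma deg_less_shift_pow: "y \<in> deg_less n \<Longrightarrow> x [^] (m::nat) \<otimes> y \<in> deg_less (n + m)"
proof (induction m)
  case 0
  then show ?case using deg_less_incl by (simp add: subset_iff)
next
  case (Suc m)
  have "x [^] m \<in> carrier R" "y \<in> carrier R" using x Suc(2) deg_less_incl by auto
  then have "x [^] Suc m \<otimes> y = x \<otimes> (x [^] m \<otimes> y)"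
    using x by (simp add: m_ac)
  then show ?case using deg_less_shift[OF Suc.IH[OF Suc(2)]] by simp
qed

lemma deg_less_const: "r \<in> K \<Longrightarrow> r \<in> deg_less (Suc n)"
proof (rule deg_less_mono[of 1])
  assume "r \<in> K"
  then show "r \<in> deg_less 1" using coefficients_closed by force
qed simp

lemma simple_extension_deg_less:
  assumes "y \<in> simple_extension K x" shows "\<exists>n. y \<in> deg_less n"
  using assms
proof induction
  case zero
  then show ?case using deg_less_zero by blast
next
  case (lin y r)
  then obtain n where n: "y \<in> deg_less n" by blast
  have "y \<otimes> x = x \<otimes> y" using n deg_less_incl x by (simp add: m_comm subset_iff)
  then have "y \<otimes> x \<oplus> r \<in> deg_less (Suc n)"
    using deg_less_add[OF deg_less_shift[OF n] deg_less_const[OF lin(2)]] by simp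
  then show ?case by blast
qed

text \<open>For an ideal \<open>J\<close> of \<open>K[x]\<close>, the leading coefficients in degree \<open>n\<close> form an increasing sequence of
  ideals of \<open>K\<close>, whose union is generated by finitely many elements, all of them already occurring in
  some degree \<open>N\<close>. Members of \<open>J\<close> that realise these generators, multiplied by powers of \<open>x\<close>, lower the
  degree of any member of \<open>J\<close> to below \<open>N\<close>; below \<open>N\<close> one proceeds degree by degree.\<close>

lemma noetherian_simple_extension:
  assumes noeth: "noetherian_subring K"
  shows "noetherian_subring (simple_extension K x)"
  unfolding noetherian_subring_def
proof (intro conjI allI impI)
  let ?E = "simple_extension K x"
  show E: "subring ?E R" by (rule simple_extension_is_subring[OF K x])
  note Ec = subringE(1)[OF E]
  have KE: "K \<subseteq> ?E" by (rule simple_extension_incl[OF coefficients_closed x])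
  have xE: "x \<in> ?E" by (rule simple_extension_mem[OF K x])
  have xpE: "x [^] (n::nat) \<in> ?E" for n
    by (induction n) (use subringE(3,6)[OF E] xE in auto)
  fix J assume J: "ideal_in ?E J"
  have Jc: "J \<subseteq> carrier R" using J Ec by (auto simp: ideal_in_def)
  have Jdiff: "y \<ominus> z \<in> J" if "y \<in> J" "z \<in> J" for y z
  proof -
    have "\<ominus> \<one> \<in> ?E" using subringE(3,5)[OF E] by auto
    then have "\<ominus> \<one> \<otimes> z \<in> J" using J that by (auto simp: ideal_in_def)
    moreover have "\<ominus> \<one> \<otimes> z = \<ominus> z" using that Jc by (simp add: subset_iff l_minus)
    ultimately show ?thesis using that J by (auto simp: ideal_in_def minus_eq)
  qed
  \<comment> \<open>leading coefficients at \<open>x\<^sup>n\<close> of the members of \<open>J\<close> of degree at most \<open>n\<close>\<close>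
  define L where "L n = {r \<in> K. \<exists>y\<in>deg_less n. r \<otimes> x [^] n \<oplus> y \<in> J}" for n
  have L_ideal: "ideal_in K (L n)" for n
    unfolding ideal_in_def
  proof (intro conjI ballI)
    show "L n \<subseteq> K" by (auto simp: L_def)
    show "\<zero> \<in> L n" using deg_less_zero[of n] subringE(2)[OF K] J x
      by (auto simp: L_def ideal_in_def intro!: bexI[of _ \<zero>])
  next
    fix r s assume "r \<in> L n" "s \<in> L n"
    then obtain y z where *: "r \<in> K" "s \<in> K" "y \<in> deg_less n" "z \<in> deg_less n"
      "r \<otimes> x [^] n \<oplus> y \<in> J" "s \<otimes> x [^] n \<oplus> z \<in> J" by (auto simp: L_def)
    then have "(r \<otimes> x [^] n \<oplus> y) \<oplus> (s \<otimes> x [^] n \<oplus> z) \<in> J" using J by (auto simp: ideal_in_def)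
    moreover have "r \<in> carrier R" "s \<in> carrier R" "y \<in> carrier R" "z \<in> carrier R" "x [^] n \<in> carrier R"
      using * coefficients_closed deg_less_incl x by auto
    then have "(r \<otimes> x [^] n \<oplus> y) \<oplus> (s \<otimes> x [^] n \<oplus> z) = (r \<oplus> s) \<otimes> x [^] n \<oplus> (y \<oplus> z)" by algebra
    ultimately show "r \<oplus> s \<in> L n" using * deg_less_add subringE(7)[OF K] by (auto simp: L_def)
  next
    fix r s assume rs: "r \<in> K" "s \<in> L n"
    then obtain z where *: "s \<in> K" "z \<in> deg_less n" "s \<otimes> x [^] n \<oplus> z \<in> J" by (auto simp: L_def)
    then have "r \<otimes> (s \<otimes> x [^] n \<oplus> z) \<in> J" using J rs KE by (auto simp: ideal_in_def)
    moreover have "r \<in> carrier R" "s \<in> carrier R" "z \<in> carrier R" "x [^] n \<in> carrier R"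
      using * rs coefficients_closed deg_less_incl x by auto
    then have "r \<otimes> (s \<otimes> x [^] n \<oplus> z) = (r \<otimes> s) \<otimes> x [^] n \<oplus> r \<otimes> z" by algebra
    ultimately show "r \<otimes> s \<in> L n" using * rs deg_less_smult subringE(6)[OF K] by (auto simp: L_def)
  qed
  have L_Suc: "L n \<subseteq> L (Suc n)" for n
  proof
    fix r assume "r \<in> L n"
    then obtain y where *: "r \<in> K" "y \<in> deg_less n" "r \<otimes> x [^] n \<oplus> y \<in> J" by (auto simp: L_def)
    then have "x \<otimes> (r \<otimes> x [^] n \<oplus> y) \<in> J" using J xE by (auto simp: ideal_in_def)
    moreover have "r \<in> carrier R" "y \<in> carrier R" "x [^] n \<in> carrier R"
      using * coefficients_closed deg_less_incl x by auto
    then have "x \<otimes> (r \<otimes> x [^] n \<oplus> y) = r \<otimes> (x [^] n \<otimes> x) \<oplus> x \<otimes> y" using x by algebra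
    ultimately have "r \<otimes> x [^] (Suc n) \<oplus> x \<otimes> y \<in> J" by simp
    then show "r \<in> L (Suc n)" using deg_less_shift[OF *(2)] * by (auto simp: L_def simp del: initial_span.simps)
  qed
  have L_mono: "n \<le> m \<Longrightarrow> L n \<subseteq> L m" for n m using lift_Suc_mono_le[of L] L_Suc by blast
  \<comment> \<open>combinations of members of \<open>J\<close> realise all combinations of leading coefficients\<close>
  have realise: "\<exists>F. finite F \<and> F \<subseteq> J \<and>
      (\<forall>s\<in>lin_span K T. \<exists>u\<in>lin_span ?E F. \<exists>y\<in>deg_less n. u = s \<otimes> x [^] n \<oplus> y)"
    if T: "finite T" "T \<subseteq> L n" for T n
  proof -
    have "\<forall>r\<in>T. \<exists>f\<in>J. \<exists>y\<in>deg_less n. f = r \<otimes> x [^] n \<oplus> y"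
      using T by (fastforce simp: L_def)
    then obtain f where f: "\<forall>r\<in>T. f r \<in> J \<and> (\<exists>y\<in>deg_less n. f r = r \<otimes> x [^] n \<oplus> y)" by metis
    have "\<exists>u\<in>lin_span ?E (f ` T). \<exists>y\<in>deg_less n. u = s \<otimes> x [^] n \<oplus> y" if "s \<in> lin_span K T" for s
      using that
    proof induction
      case zero
      then show ?case using deg_less_zero[of n] x lin_span.zero by (intro bexI[of _ \<zero>]) auto
    next
      case (step r t s)
      then obtain u y where u: "u \<in> lin_span ?E (f ` T)" "y \<in> deg_less n" "u = s \<otimes> x [^] n \<oplus> y" by blast
      obtain z where z: "z \<in> deg_less n" "f t = t \<otimes> x [^] n \<oplus> z" using f step by blast
      have "t \<in> K" using step T by (auto simp: L_def)
      moreover have "s \<in> carrier R"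
        using step T coefficients_closed lin_span_incl[OF coefficients_closed, of T] by (auto simp: L_def)
      ultimately have c: "r \<in> carrier R" "s \<in> carrier R" "t \<in> carrier R" "y \<in> carrier R" "z \<in> carrier R" "x [^] n \<in> carrier R"
        using step u z coefficients_closed deg_less_incl x by auto
      have "r \<otimes> f t \<oplus> u = (r \<otimes> t \<oplus> s) \<otimes> x [^] n \<oplus> (r \<otimes> z \<oplus> y)"
        unfolding u z using c by algebra
      moreover have "r \<otimes> f t \<oplus> u \<in> lin_span ?E (f ` T)"
        using step KE u by (auto intro: lin_span.intros)
      ultimately show ?case using deg_less_add[OF deg_less_smult[OF step(1) z(1)] u(2)] by blast
    qed
    then show ?thesis using T f by (intro exI[of _ "f ` T"]) auto
  qed
  have low: "\<exists>F. finite F \<and> F \<subseteq> J \<and> J \<inter> deg_less n \<subseteq> lin_span ?E F" for n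
  proof (induction n)
    case 0
    show ?case by (intro exI[of _ "{}"]) (auto intro: lin_span.intros)
  next
    case (Suc n)
    then obtain F where F: "finite F" "F \<subseteq> J" "J \<inter> deg_less n \<subseteq> lin_span ?E F" by blast
    obtain T where T: "finite T" "T \<subseteq> L n" "L n \<subseteq> lin_span K T"
      using noeth L_ideal[of n] by (auto simp: noetherian_subring_def)
    obtain F' where F': "finite F'" "F' \<subseteq> J"
      "\<forall>s\<in>lin_span K T. \<exists>u\<in>lin_span ?E F'. \<exists>y\<in>deg_less n. u = s \<otimes> x [^] n \<oplus> y"
      using realise[OF T(1,2)] by blast
    have "z \<in> lin_span ?E (F \<union> F')" if z: "z \<in> J" "z \<in> deg_less (Suc n)" for z
    proof -
      obtain s y where s: "s \<in> K" "y \<in> deg_less n" "z = s \<otimes> x [^] n \<oplus> y" using z by auto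
      then have "s \<in> L n" using z by (auto simp: L_def)
      then obtain u y' where u: "u \<in> lin_span ?E F'" "y' \<in> deg_less n" "u = s \<otimes> x [^] n \<oplus> y'"
        using F' T by blast
      have uJ: "u \<in> J" using lin_span_least[OF J F'(2)] u by blast
      have c: "s \<in> carrier R" "y \<in> carrier R" "y' \<in> carrier R" "x [^] n \<in> carrier R" "z \<in> carrier R" "u \<in> carrier R"
        using s u z uJ coefficients_closed deg_less_incl x Jc by auto
      have "z \<ominus> u = y \<oplus> \<ominus> \<one> \<otimes> y'" unfolding s(3) u(3) using c by algebra
      then have "z \<ominus> u \<in> deg_less n"
        using deg_less_add[OF s(2) deg_less_smult[OF _ u(2), of "\<ominus> \<one>"]] subringE(3,5)[OF K] by auto
      then have "z \<ominus> u \<in> lin_span ?E F" using F Jdiff[OF z(1) uJ] by blast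
      then have "u \<oplus> (z \<ominus> u) \<in> lin_span ?E (F \<union> F')"
        using u lin_span_mono[of F "F \<union> F'" ?E] lin_span_mono[of F' "F \<union> F'" ?E] F F' Jc Ec
        by (intro lin_span_add) auto
      moreover have "u \<oplus> (z \<ominus> u) = z" using c by algebra
      ultimately show ?thesis by simp
    qed
    then show ?case using F F' by (intro exI[of _ "F \<union> F'"]) auto
  qed
  have "ideal_in K (\<Union>n. L n)"
    unfolding ideal_in_def
  proof (intro conjI ballI)
    show "(\<Union>n. L n) \<subseteq> K" by (auto simp: L_def)
    show "\<zero> \<in> (\<Union>n. L n)" using L_ideal by (auto simp: ideal_in_def)
    show "r \<otimes> s \<in> (\<Union>n. L n)" if "r \<in> K" "s \<in> (\<Union>n. L n)" for r s
      using L_ideal that unfolding ideal_in_def by blast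
    show "r \<oplus> s \<in> (\<Union>n. L n)" if rs: "r \<in> (\<Union>n. L n)" "s \<in> (\<Union>n. L n)" for r s
    proof -
      obtain n m where "r \<in> L n" "s \<in> L m" using rs by blast
      then have "r \<in> L (max n m)" "s \<in> L (max n m)" using L_mono[of n "max n m"] L_mono[of m "max n m"] by auto
      then show ?thesis using L_ideal[of "max n m"] by (auto simp: ideal_in_def)
    qed
  qed
  then obtain T where T: "finite T" "T \<subseteq> (\<Union>n. L n)" "(\<Union>n. L n) \<subseteq> lin_span K T"
    using noeth by (auto simp: noetherian_subring_def)
  obtain N where N: "T \<subseteq> L N"
  proof -
    have "\<exists>N. T \<subseteq> L N" using T(1,2)
    proof (induction T)
      case (insert t T)
      then obtain N n where "T \<subseteq> L N" "t \<in> L n" by auto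
      then have "insert t T \<subseteq> L (max n N)" using L_mono[of n "max n N"] L_mono[of N "max n N"] by auto
      then show ?case by blast
    qed auto
    then show ?thesis using that by blast
  qed
  obtain F where F: "finite F" "F \<subseteq> J" "J \<inter> deg_less N \<subseteq> lin_span ?E F" using low by blast
  obtain F' where F': "finite F'" "F' \<subseteq> J"
      "\<forall>s\<in>lin_span K T. \<exists>u\<in>lin_span ?E F'. \<exists>y\<in>deg_less N. u = s \<otimes> x [^] N \<oplus> y"
      using realise[OF T(1) N] by blast
  have FF: "F \<union> F' \<subseteq> carrier R" using F F' Jc by auto
  have high: "z \<in> lin_span ?E (F \<union> F')" if "z \<in> J" "z \<in> deg_less n" for z n
    using that
  proof (induction n arbitrary: z)
    case 0
    then show ?case by (auto intro: lin_span.intros)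
  next
    case (Suc n)
    show ?case
    proof (cases "Suc n \<le> N")
      case True
      then have "z \<in> deg_less N" using Suc deg_less_mono by blast
      then show ?thesis using F Suc lin_span_mono[of F "F \<union> F'" ?E] by auto
    next
      case False
      then have nN: "N + (n - N) = n" by simp
      obtain s y where s: "s \<in> K" "y \<in> deg_less n" "z = s \<otimes> x [^] n \<oplus> y" using Suc by auto
      then have "s \<in> L n" using Suc by (auto simp: L_def)
      then obtain v y' where v: "v \<in> lin_span ?E F'" "y' \<in> deg_less N" "v = s \<otimes> x [^] N \<oplus> y'"
        using F' T by blast
      define u where "u = x [^] (n - N) \<otimes> v"
      define w where "w = x [^] (n - N) \<otimes> y'"
      have w: "w \<in> deg_less n" using deg_less_shift_pow[OF v(2), of "n - N"] nN by (simp add: w_def)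
      have uF: "u \<in> lin_span ?E F'" unfolding u_def using F' Jc v xpE by (intro lin_span_smult[OF E]) auto
      have uJ: "u \<in> J" using lin_span_least[OF J F'(2)] uF by blast
      have c: "s \<in> carrier R" "y \<in> carrier R" "y' \<in> carrier R" "x [^] n \<in> carrier R" "x [^] N \<in> carrier R"
          "x [^] (n - N) \<in> carrier R" "z \<in> carrier R" "u \<in> carrier R" "w \<in> carrier R"
        using s v w Suc uJ coefficients_closed deg_less_incl x Jc by auto
      have "u = s \<otimes> (x [^] N \<otimes> x [^] (n - N)) \<oplus> w" unfolding u_def v(3) w_def using c by algebra
      then have u: "u = s \<otimes> x [^] n \<oplus> w" using x nN by (simp add: nat_pow_mult)
      have "z \<ominus> u = y \<oplus> \<ominus> \<one> \<otimes> w" unfolding s(3) u using c by algebra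
      then have "z \<ominus> u \<in> deg_less n"
        using deg_less_add[OF s(2) deg_less_smult[OF _ w, of "\<ominus> \<one>"]] subringE(3,5)[OF K] by auto
      then have "z \<ominus> u \<in> lin_span ?E (F \<union> F')" using Suc.IH Jdiff[OF Suc.prems(1) uJ] by blast
      then have "u \<oplus> (z \<ominus> u) \<in> lin_span ?E (F \<union> F')"
        using uF lin_span_mono[of F' "F \<union> F'" ?E] FF Ec by (intro lin_span_add) auto
      moreover have "u \<oplus> (z \<ominus> u) = z" using c by algebra
      ultimately show ?thesis by simp
    qed
  qed
  show "\<exists>F. finite F \<and> F \<subseteq> J \<and> J \<subseteq> lin_span ?E F"
  proof (rule exI[of _ "F \<union> F'"], intro conjI subsetI[of J])
    show "finite (F \<union> F')" "F \<union> F' \<subseteq> J" using F F' by auto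
    fix z assume z: "z \<in> J"
    then have "z \<in> ?E" using J unfolding ideal_in_def by blast
    then obtain n where "z \<in> deg_less n" using simple_extension_deg_less by blast
    then show "z \<in> lin_span ?E (F \<union> F')" using high z by blast
  qed
qed

end

lemma noetherian_subfield:
  assumes "subfield K R" shows "noetherian_subring K"
  unfolding noetherian_subring_def
proof (intro conjI allI impI)
  show K: "subring K R" using subfieldE(1)[OF assms] .
  have coefficients_closed: "K \<subseteq> carrier R" using subringE(1)[OF K] .
  fix J assume J: "ideal_in K J"
  show "\<exists>F. finite F \<and> F \<subseteq> J \<and> J \<subseteq> lin_span K F"
  proof (cases "J \<subseteq> {\<zero>}")
    case True
    then show ?thesis by (intro exI[of _ "{}"]) (auto intro: lin_span.intros)
  next
    case False
    then obtain f where f: "f \<in> J" "f \<noteq> \<zero>" by blast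
    then have fK: "f \<in> K - {\<zero>}" using J by (auto simp: ideal_in_def)
    have inv: "inv f \<in> K" "f \<otimes> inv f = \<one>" using subfield_m_inv[OF assms fK] by auto
    have "y \<in> lin_span K {f}" if "y \<in> J" for y
    proof -
      have y: "y \<in> K" using J that by (auto simp: ideal_in_def)
      have "(y \<otimes> inv f) \<otimes> f \<oplus> \<zero> \<in> lin_span K {f}"
        using y inv subringE(6)[OF K] by (auto intro: lin_span.intros)
      moreover have "(y \<otimes> inv f) \<otimes> f \<oplus> \<zero> = y \<otimes> (f \<otimes> inv f)"
        using y inv(1) fK coefficients_closed by (simp add: subset_iff m_ac)
      ultimately show ?thesis using y inv coefficients_closed by (simp add: subset_iff)
    qed
    then show ?thesis using f by (intro exI[of _ "{f}"]) auto
  qed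
qed

lemma noetherian_generate_ring:
  assumes "subfield K R" "finite S" "S \<subseteq> carrier R"
  shows "noetherian_subring (generate_ring R (K \<union> S))"
  using assms(2,3)
proof (induction S)
  case empty
  have "generate_ring R K = K"
    using generate_ring_min_subring1[OF _ subfieldE(1)[OF assms(1)], of K]
      generate_ring_incl[of K] subfieldE(3)[OF assms(1)] generate_ring.incl by fastforce
  then show ?case using noetherian_subfield[OF assms(1)] by simp
next
  case (insert x S)
  let ?K = "generate_ring R (K \<union> S)"
  have coefficients_closed: "K \<union> insert x S \<subseteq> carrier R" using subfieldE(3)[OF assms(1)] insert by auto
  then have sub: "subring ?K R" by (intro generate_ring_is_subring) auto
  have x: "x \<in> carrier R" using insert by auto
  have "generate_ring R (K \<union> insert x S) = simple_extension ?K x"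
  proof
    show "generate_ring R (K \<union> insert x S) \<subseteq> simple_extension ?K x"
    proof (rule generate_ring_min_subring1)
      show "subring (simple_extension ?K x) R" by (rule simple_extension_is_subring[OF sub x])
      show "K \<union> insert x S \<subseteq> simple_extension ?K x"
        using simple_extension_incl[OF _ x, of ?K] simple_extension_mem[OF sub x]
          subringE(1)[OF sub] generate_ring.incl[of _ "K \<union> S" R] by auto
      show "K \<union> insert x S \<subseteq> carrier R" by fact
    qed
    have G: "subring (generate_ring R (K \<union> insert x S)) R" using generate_ring_is_subring[OF coefficients_closed] .
    have KG: "?K \<subseteq> generate_ring R (K \<union> insert x S)"
      using coefficients_closed by (intro mono_generate_ring) auto
    show "simple_extension ?K x \<subseteq> generate_ring R (K \<union> insert x S)"
    proof
      fix y assume "y \<in> simple_extension ?K x"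
      then show "y \<in> generate_ring R (K \<union> insert x S)"
        by induction (use KG generate_ring.incl[of x "K \<union> insert x S" R] subringE(2,6,7)[OF G] in auto)
    qed
  qed
  then show ?case using noetherian_simple_extension[OF sub x] insert by simp
qed

lemma noetherian_ring_if_finitely_generated:
  assumes "subfield K R" "finite S" "S \<subseteq> carrier R" "carrier R = generate_ring R (K \<union> S)"
  shows "noetherian_ring R"
proof (rule noetherian_ringI)
  fix I assume I: "ideal I R"
  have "noetherian_subring (carrier R)" using noetherian_generate_ring[OF assms(1-3)] assms(4) by simp
  moreover have "ideal_in (carrier R) I"
    using ideal.Icarr[OF I] additive_subgroup.zero_closed[OF ideal.axioms(1)[OF I]]
      additive_subgroup.a_closed[OF ideal.axioms(1)[OF I]] ideal.I_l_closed[OF I]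
    by (auto simp: ideal_in_def)
  ultimately obtain F where F: "finite F" "F \<subseteq> I" "I \<subseteq> lin_span (carrier R) F"
    by (auto simp: noetherian_subring_def)
  have Fc: "F \<subseteq> carrier R" using F ideal.Icarr[OF I] by auto
  interpret J: ideal "Idl F" R using genideal_ideal[OF Fc] .
  have "lin_span (carrier R) F \<subseteq> Idl F"
  proof (rule lin_span_least)
    show "ideal_in (carrier R) (Idl F)" using J.Icarr J.I_l_closed by (auto simp: ideal_in_def)
    show "F \<subseteq> Idl F" using genideal_self[OF Fc] .
  qed
  then have "I = Idl F" using F genideal_minimal[OF I F(2)] by auto
  then show "\<exists>A\<subseteq>carrier R. finite A \<and> I = Idl A" using F Fc by blast
qed

end

section \<open>Quotient fields\<close>

lemma (in noetherian_ring) ideal_sequence_stabilizes: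
  fixes I :: "nat \<Rightarrow> 'a set"
  assumes "\<And>n. ideal (I n) R" "\<And>n. I n \<subseteq> I (Suc n)"
  shows "\<exists>n. I (Suc n) \<subseteq> I n"
proof -
  have mono: "I n \<subseteq> I m" if "n \<le> m" for n m using lift_Suc_mono_le[of I] assms(2) that by blast
  have "subset.chain {J. ideal J R} (range I)"
    unfolding subset_chain_def
  proof (intro conjI ballI)
    fix S T assume "S \<in> range I" "T \<in> range I"
    then obtain n m where "S = I n" "T = I m" by blast
    then show "S \<subseteq> T \<or> T \<subseteq> S" using mono[of n m] mono[of m n] by (cases "n \<le> m") auto
  qed (use assms(1) in auto)
  then have "\<Union>(range I) \<in> range I" by (intro ideal_chain_is_trivial) auto
  then show ?thesis by blast
qed

context domain
begin

lemma fraction_iff: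
  "(c, d) \<in> fraction R a b \<longleftrightarrow> c \<in> carrier R \<and> d \<in> carrier R \<and> d \<noteq> \<zero> \<and> a \<otimes> d = c \<otimes> b"
  by (auto simp: fraction_def)

lemma fraction_eq:
  assumes "a \<in> carrier R" "b \<in> carrier R" "b \<noteq> \<zero>" "c \<in> carrier R" "d \<in> carrier R" "d \<noteq> \<zero>"
  shows "fraction R a b = fraction R c d \<longleftrightarrow> a \<otimes> d = c \<otimes> b"
proof
  assume "fraction R a b = fraction R c d"
  then have "(a, b) \<in> fraction R c d" using assms fraction_iff[of a b a b] by auto
  then show "a \<otimes> d = c \<otimes> b" by (simp add: fraction_iff)
next
  assume eq: "a \<otimes> d = c \<otimes> b"
  have "x \<in> fraction R c d \<longleftrightarrow> x \<in> fraction R a b" for x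
  proof (cases x)
    case (Pair e f)
    have "a \<otimes> f = e \<otimes> b \<longleftrightarrow> c \<otimes> f = e \<otimes> d" if "e \<in> carrier R" "f \<in> carrier R"
    proof -
      have "a \<otimes> f = e \<otimes> b \<longleftrightarrow> d \<otimes> (a \<otimes> f) = d \<otimes> (e \<otimes> b)"
        using assms that by (simp add: m_lcancel)
      also have "d \<otimes> (a \<otimes> f) = (a \<otimes> d) \<otimes> f" using assms that by algebra
      also have "\<dots> = b \<otimes> (c \<otimes> f)" unfolding eq using assms that by algebra
      also have "d \<otimes> (e \<otimes> b) = b \<otimes> (e \<otimes> d)" using assms that by algebra
      also have "b \<otimes> (c \<otimes> f) = b \<otimes> (e \<otimes> d) \<longleftrightarrow> c \<otimes> f = e \<otimes> d"
        using assms that by (simp add: m_lcancel)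
      finally show ?thesis .
    qed
    then show ?thesis using Pair by (auto simp: fraction_iff)
  qed
  then show "fraction R a b = fraction R c d" by blast
qed

lemma fractionE:
  assumes "x \<in> fraction R a b" "a \<in> carrier R" "b \<in> carrier R" "b \<noteq> \<zero>"
  shows "fst x \<in> carrier R" "snd x \<in> carrier R" "snd x \<noteq> \<zero>" "a \<otimes> snd x = fst x \<otimes> b"
  using assms fraction_iff[of "fst x" "snd x"] by auto

lemma quotient_field_mult:
  assumes "a \<in> carrier R" "b \<in> carrier R" "b \<noteq> \<zero>" "c \<in> carrier R" "d \<in> carrier R" "d \<noteq> \<zero>"
  shows "fraction R a b \<otimes>\<^bsub>quotient_field R\<^esub> fraction R c d = fraction R (a \<otimes> c) (b \<otimes> d)"
proof -
  have "fraction R (fst x \<otimes> fst y) (snd x \<otimes> snd y) = fraction R (a \<otimes> c) (b \<otimes> d)"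
    if "x \<in> fraction R a b" "y \<in> fraction R c d" for x y
  proof -
    note x = fractionE[OF that(1) assms(1-3)] and y = fractionE[OF that(2) assms(4-6)]
    have "fst x \<otimes> fst y \<otimes> (b \<otimes> d) = (fst x \<otimes> b) \<otimes> (fst y \<otimes> d)"
      using assms x(1-3) y(1-3) by algebra
    also have "\<dots> = (a \<otimes> snd x) \<otimes> (c \<otimes> snd y)" using x(4) y(4) by simp
    also have "\<dots> = a \<otimes> c \<otimes> (snd x \<otimes> snd y)" using assms x(1-3) y(1-3) by algebra
    finally show ?thesis
      using assms x y by (subst fraction_eq) (auto simp: integral_iff)
  qed
  moreover have "(a, b) \<in> fraction R a b" "(c, d) \<in> fraction R c d" using assms by (auto simp: fraction_iff)
  ultimately show ?thesis unfolding quotient_field_def by (auto; blast)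
qed

lemma quotient_field_add:
  assumes "a \<in> carrier R" "b \<in> carrier R" "b \<noteq> \<zero>" "c \<in> carrier R" "d \<in> carrier R" "d \<noteq> \<zero>"
  shows "fraction R a b \<oplus>\<^bsub>quotient_field R\<^esub> fraction R c d = fraction R (a \<otimes> d \<oplus> c \<otimes> b) (b \<otimes> d)"
proof -
  have "fraction R (fst x \<otimes> snd y \<oplus> fst y \<otimes> snd x) (snd x \<otimes> snd y)
      = fraction R (a \<otimes> d \<oplus> c \<otimes> b) (b \<otimes> d)"
    if "x \<in> fraction R a b" "y \<in> fraction R c d" for x y
  proof -
    note x = fractionE[OF that(1) assms(1-3)] and y = fractionE[OF that(2) assms(4-6)]
    have "(fst x \<otimes> snd y \<oplus> fst y \<otimes> snd x) \<otimes> (b \<otimes> d)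
        = (fst x \<otimes> b) \<otimes> (snd y \<otimes> d) \<oplus> (fst y \<otimes> d) \<otimes> (snd x \<otimes> b)"
      using assms x(1-3) y(1-3) by algebra
    also have "\<dots> = (a \<otimes> snd x) \<otimes> (snd y \<otimes> d) \<oplus> (c \<otimes> snd y) \<otimes> (snd x \<otimes> b)" using x(4) y(4) by simp
    also have "\<dots> = (a \<otimes> d \<oplus> c \<otimes> b) \<otimes> (snd x \<otimes> snd y)" using assms x(1-3) y(1-3) by algebra
    finally show ?thesis
      using assms x y by (subst fraction_eq) (auto simp: integral_iff)
  qed
  moreover have "(a, b) \<in> fraction R a b" "(c, d) \<in> fraction R c d" using assms by (auto simp: fraction_iff)
  ultimately show ?thesis unfolding quotient_field_def by (auto; blast)
qed

lemma quotient_field_carrier: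
  "carrier (quotient_field R) = {fraction R a b | a b. a \<in> carrier R \<and> b \<in> carrier R \<and> b \<noteq> \<zero>}"
  "\<one>\<^bsub>quotient_field R\<^esub> = fraction R \<one> \<one>" "\<zero>\<^bsub>quotient_field R\<^esub> = fraction R \<zero> \<one>"
  by (auto simp: quotient_field_def)

lemma fraction_in_quotient_field:
  "a \<in> carrier R \<Longrightarrow> b \<in> carrier R \<Longrightarrow> b \<noteq> \<zero> \<Longrightarrow> fraction R a b \<in> carrier (quotient_field R)"
  by (auto simp: quotient_field_carrier)

lemma quotient_field_cring: "cring (quotient_field R)"
proof -
  note simps = quotient_field_carrier quotient_field_mult quotient_field_add fraction_eq integral_iff
  show ?thesis
  proof (rule cringI)
    show "abelian_group (quotient_field R)"
    proof (rule abelian_groupI)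
      fix x y z assume "x \<in> carrier (quotient_field R)" "y \<in> carrier (quotient_field R)" "z \<in> carrier (quotient_field R)"
      then obtain a b c d e f where *: "x = fraction R a b" "y = fraction R c d" "z = fraction R e f"
        "a \<in> carrier R" "b \<in> carrier R" "b \<noteq> \<zero>" "c \<in> carrier R" "d \<in> carrier R" "d \<noteq> \<zero>"
        "e \<in> carrier R" "f \<in> carrier R" "f \<noteq> \<zero>" by (auto simp: quotient_field_carrier)
      show "x \<oplus>\<^bsub>quotient_field R\<^esub> y \<oplus>\<^bsub>quotient_field R\<^esub> z = x \<oplus>\<^bsub>quotient_field R\<^esub> (y \<oplus>\<^bsub>quotient_field R\<^esub> z)"
        using * apply (simp add: simps) by algebra
    next
      fix x y assume "x \<in> carrier (quotient_field R)" "y \<in> carrier (quotient_field R)"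
      then obtain a b c d where *: "x = fraction R a b" "y = fraction R c d"
        "a \<in> carrier R" "b \<in> carrier R" "b \<noteq> \<zero>" "c \<in> carrier R" "d \<in> carrier R" "d \<noteq> \<zero>"
        by (auto simp: quotient_field_carrier)
      show "x \<oplus>\<^bsub>quotient_field R\<^esub> y = y \<oplus>\<^bsub>quotient_field R\<^esub> x"
        using * apply (simp add: simps) by algebra
      show "x \<oplus>\<^bsub>quotient_field R\<^esub> y \<in> carrier (quotient_field R)"
        using * apply (simp add: quotient_field_add) unfolding quotient_field_carrier
        using integral_iff m_closed a_closed by blast
    next
      show "\<zero>\<^bsub>quotient_field R\<^esub> \<in> carrier (quotient_field R)"
        by (simp add: quotient_field_carrier(2,3) fraction_in_quotient_field)
      fix x assume "x \<in> carrier (quotient_field R)"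
      then obtain a b where *: "x = fraction R a b" "a \<in> carrier R" "b \<in> carrier R" "b \<noteq> \<zero>"
        by (auto simp: quotient_field_carrier)
      show "\<zero>\<^bsub>quotient_field R\<^esub> \<oplus>\<^bsub>quotient_field R\<^esub> x = x"
        using * by (simp add: simps)
      have "fraction R (\<ominus> a) b \<in> carrier (quotient_field R)" using * by (auto simp: quotient_field_carrier)
      moreover have "fraction R (\<ominus> a) b \<oplus>\<^bsub>quotient_field R\<^esub> x = \<zero>\<^bsub>quotient_field R\<^esub>"
        using * apply (simp add: simps) by algebra
      ultimately show "\<exists>y\<in>carrier (quotient_field R). y \<oplus>\<^bsub>quotient_field R\<^esub> x = \<zero>\<^bsub>quotient_field R\<^esub>" by blast
    qed
    show "comm_monoid (quotient_field R)"
    proof (rule comm_monoidI)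
      fix x y z assume "x \<in> carrier (quotient_field R)" "y \<in> carrier (quotient_field R)" "z \<in> carrier (quotient_field R)"
      then obtain a b c d e f where *: "x = fraction R a b" "y = fraction R c d" "z = fraction R e f"
        "a \<in> carrier R" "b \<in> carrier R" "b \<noteq> \<zero>" "c \<in> carrier R" "d \<in> carrier R" "d \<noteq> \<zero>"
        "e \<in> carrier R" "f \<in> carrier R" "f \<noteq> \<zero>" by (auto simp: quotient_field_carrier)
      show "x \<otimes>\<^bsub>quotient_field R\<^esub> y \<otimes>\<^bsub>quotient_field R\<^esub> z = x \<otimes>\<^bsub>quotient_field R\<^esub> (y \<otimes>\<^bsub>quotient_field R\<^esub> z)"
        using * apply (simp add: simps) by algebra
    next
      fix x y assume "x \<in> carrier (quotient_field R)" "y \<in> carrier (quotient_field R)"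
      then obtain a b c d where *: "x = fraction R a b" "y = fraction R c d"
        "a \<in> carrier R" "b \<in> carrier R" "b \<noteq> \<zero>" "c \<in> carrier R" "d \<in> carrier R" "d \<noteq> \<zero>"
        by (auto simp: quotient_field_carrier)
      show "x \<otimes>\<^bsub>quotient_field R\<^esub> y = y \<otimes>\<^bsub>quotient_field R\<^esub> x"
        using * apply (simp add: simps) by algebra
      show "x \<otimes>\<^bsub>quotient_field R\<^esub> y \<in> carrier (quotient_field R)"
        using * apply (simp add: quotient_field_mult) unfolding quotient_field_carrier
        using integral_iff m_closed a_closed by blast
    next
      show "\<one>\<^bsub>quotient_field R\<^esub> \<in> carrier (quotient_field R)"
        by (simp add: quotient_field_carrier(2,3) fraction_in_quotient_field)
      fix x assume "x \<in> carrier (quotient_field R)"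
      then obtain a b where *: "x = fraction R a b" "a \<in> carrier R" "b \<in> carrier R" "b \<noteq> \<zero>"
        by (auto simp: quotient_field_carrier)
      then show "\<one>\<^bsub>quotient_field R\<^esub> \<otimes>\<^bsub>quotient_field R\<^esub> x = x" by (simp add: simps)
    qed
    fix x y z assume "x \<in> carrier (quotient_field R)" "y \<in> carrier (quotient_field R)" "z \<in> carrier (quotient_field R)"
    then obtain a b c d e f where *: "x = fraction R a b" "y = fraction R c d" "z = fraction R e f"
        "a \<in> carrier R" "b \<in> carrier R" "b \<noteq> \<zero>" "c \<in> carrier R" "d \<in> carrier R" "d \<noteq> \<zero>"
        "e \<in> carrier R" "f \<in> carrier R" "f \<noteq> \<zero>" by (auto simp: quotient_field_carrier)
    show "(x \<oplus>\<^bsub>quotient_field R\<^esub> y) \<otimes>\<^bsub>quotient_field R\<^esub> z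
        = x \<otimes>\<^bsub>quotient_field R\<^esub> z \<oplus>\<^bsub>quotient_field R\<^esub> y \<otimes>\<^bsub>quotient_field R\<^esub> z"
      using * apply (simp add: simps) by algebra
  qed
qed

end

section \<open>Height one primes in normal noetherian domains\<close>

context noetherian_domain
begin

text \<open>If \<open>(b/a)\<^sup>n p\<close> lies in the ring for all \<open>n\<close>, then the ideals generated by \<open>p, (b/a) p, \<dots>, (b/a)\<^sup>n p\<close>
  become stationary, which after division by \<open>p\<close> is an equation of integral dependence for \<open>b/a\<close>.\<close>

lemma almost_integral_imp_mem:
  assumes ic: "integrally_closed R"
    and a: "a \<in> carrier R" "a \<noteq> \<zero>" and b: "b \<in> carrier R"
    and q: "\<And>n. q n \<in> carrier R" "q 0 \<noteq> \<zero>" "\<And>n. a \<otimes> q (Suc n) = b \<otimes> q n"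
  shows "\<exists>c\<in>carrier R. b = a \<otimes> c"
proof -
  let ?F = "quotient_field R"
  interpret F: cring ?F by (rule quotient_field_cring)
  define \<iota> where "\<iota> = (\<lambda>y. fraction R y \<one>)"
  define x where "x = fraction R b a"
  have \<iota>c: "y \<in> carrier R \<Longrightarrow> \<iota> y \<in> carrier ?F" for y by (simp add: \<iota>_def fraction_in_quotient_field)
  have xc: "x \<in> carrier ?F" using a b by (simp add: x_def fraction_in_quotient_field)
  have \<iota>a: "\<iota> (y \<oplus> z) = \<iota> y \<oplus>\<^bsub>?F\<^esub> \<iota> z" and \<iota>m: "\<iota> (y \<otimes> z) = \<iota> y \<otimes>\<^bsub>?F\<^esub> \<iota> z"
    if "y \<in> carrier R" "z \<in> carrier R" for y z
    using that by (simp_all add: \<iota>_def quotient_field_add quotient_field_mult)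
  have \<iota>1: "\<iota> \<one> = \<one>\<^bsub>?F\<^esub>" and \<iota>0: "\<iota> \<zero> = \<zero>\<^bsub>?F\<^esub>" by (simp_all add: \<iota>_def quotient_field_carrier)
  have \<iota>q: "\<iota> (q n) = \<iota> (q 0) \<otimes>\<^bsub>?F\<^esub> x [^]\<^bsub>?F\<^esub> n" for n
  proof (induction n)
    case 0
    then show ?case using \<iota>c q by simp
  next
    case (Suc n)
    have "\<iota> (q (Suc n)) = \<iota> (q n) \<otimes>\<^bsub>?F\<^esub> x"
      using a b q(1) q(3)[of n] by (simp add: \<iota>_def x_def quotient_field_mult fraction_eq integral_iff m_comm)
    then show ?case using Suc \<iota>c q(1) xc by (simp add: F.m_assoc)
  qed
  define I where "I = initial_span (carrier R) q"
  note sp = carrier_is_subring q(1)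
  have I: "ideal (I n) R" for n
    using initial_span_incl[of "carrier R" q, OF sp] initial_span_zero[of "carrier R" q, OF sp]
      initial_span_add[of "carrier R" q, OF sp] initial_span_smult[of "carrier R" q, OF sp]
    by (intro ideal_if_ideal_in) (simp add: ideal_in_def I_def)
  have "I n \<subseteq> I (Suc n)" for n using initial_span_Suc[of "carrier R" q, OF sp] by (auto simp: I_def simp del: initial_span.simps)
  then obtain N where N: "I (Suc N) \<subseteq> I N" using ideal_sequence_stabilizes[of I] I by blast
  have "\<one> \<otimes> q N \<oplus> \<zero> \<in> I (Suc N)"
    unfolding I_def by (rule initial_span_SucI[of "carrier R" q, OF sp]) (auto intro: initial_span_zero[of "carrier R" q, OF sp])
  then have "q N \<in> I N" using N q by auto
  then have "\<ominus> q N \<in> I N" by (rule additive_subgroup.a_inv_closed[OF ideal.axioms(1)[OF I]])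
  moreover have "\<exists>l. set l \<subseteq> \<iota> ` carrier R \<and> length l = n \<and> \<iota> y = \<iota> (q 0) \<otimes>\<^bsub>?F\<^esub> F.eval l x"
    if "y \<in> I n" for y n
    using that
  proof (induction n arbitrary: y)
    case 0
    then show ?case using \<iota>0 \<iota>c q(1) by (intro exI[of _ "[]"]) (auto simp: I_def)
  next
    case (Suc n)
    then obtain r z where rz: "y = r \<otimes> q n \<oplus> z" "r \<in> carrier R" "z \<in> I n" by (auto simp: I_def)
    obtain l where l: "set l \<subseteq> \<iota> ` carrier R" "length l = n" "\<iota> z = \<iota> (q 0) \<otimes>\<^bsub>?F\<^esub> F.eval l x"
      using Suc.IH rz by blast
    have zc: "z \<in> carrier R" using rz ideal.Icarr[OF I] by blast
    have lc: "set l \<subseteq> carrier ?F" using l \<iota>c by auto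
    have ec: "F.eval l x \<in> carrier ?F" using F.eval_in_carrier[OF lc xc] .
    have "\<iota> y = \<iota> r \<otimes>\<^bsub>?F\<^esub> (\<iota> (q 0) \<otimes>\<^bsub>?F\<^esub> x [^]\<^bsub>?F\<^esub> n) \<oplus>\<^bsub>?F\<^esub> \<iota> z"
      using rz q(1) zc \<iota>q[of n] by (simp add: \<iota>a \<iota>m)
    also have "\<dots> = \<iota> (q 0) \<otimes>\<^bsub>?F\<^esub> (\<iota> r \<otimes>\<^bsub>?F\<^esub> x [^]\<^bsub>?F\<^esub> n \<oplus>\<^bsub>?F\<^esub> F.eval l x)"
      unfolding l(3) using ec \<iota>c[OF rz(2)] \<iota>c[OF q(1)] xc by (simp add: F.r_distr F.m_ac)
    also have "\<iota> r \<otimes>\<^bsub>?F\<^esub> x [^]\<^bsub>?F\<^esub> n \<oplus>\<^bsub>?F\<^esub> F.eval l x = F.eval (\<iota> r # l) x" using l by simp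
    finally show ?case using l rz by (intro exI[of _ "\<iota> r # l"]) auto
  qed
  ultimately obtain l where l: "set l \<subseteq> \<iota> ` carrier R" "length l = N"
      "\<iota> (\<ominus> q N) = \<iota> (q 0) \<otimes>\<^bsub>?F\<^esub> F.eval l x" by blast
  have lc: "set l \<subseteq> carrier ?F" using l \<iota>c by auto
  have ec: "F.eval l x \<in> carrier ?F" using F.eval_in_carrier[OF lc xc] .
  let ?p = "\<one>\<^bsub>?F\<^esub> # l"
  define e where "e = F.eval ?p x"
  have e: "e = x [^]\<^bsub>?F\<^esub> N \<oplus>\<^bsub>?F\<^esub> F.eval l x" unfolding e_def using l xc by simp
  have "\<iota> (q 0) \<otimes>\<^bsub>?F\<^esub> e = \<iota> (q N) \<oplus>\<^bsub>?F\<^esub> \<iota> (\<ominus> q N)"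
    unfolding e l(3) \<iota>q[of N] using ec \<iota>c[OF q(1)] xc by (simp add: F.r_distr)
  also have "\<dots> = \<zero>\<^bsub>?F\<^esub>" using q(1) by (simp add: \<iota>a[symmetric] r_neg \<iota>0)
  finally have 0: "\<iota> (q 0) \<otimes>\<^bsub>?F\<^esub> e = \<zero>\<^bsub>?F\<^esub>" .
  define w where "w = fraction R \<one> (q 0)"
  have w: "w \<in> carrier ?F" "w \<otimes>\<^bsub>?F\<^esub> \<iota> (q 0) = \<one>\<^bsub>?F\<^esub>"
    using q by (auto simp: w_def \<iota>_def fraction_in_quotient_field quotient_field_carrier(2) quotient_field_mult fraction_eq)
  have "e = (w \<otimes>\<^bsub>?F\<^esub> \<iota> (q 0)) \<otimes>\<^bsub>?F\<^esub> e" using w ec xc e by simp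
  also have "\<dots> = w \<otimes>\<^bsub>?F\<^esub> (\<iota> (q 0) \<otimes>\<^bsub>?F\<^esub> e)" using w(1) ec xc e \<iota>c[OF q(1)] by (simp add: F.m_assoc)
  finally have "e = \<zero>\<^bsub>?F\<^esub>" using 0 w(1) by simp
  moreover have "\<one>\<^bsub>?F\<^esub> \<noteq> \<zero>\<^bsub>?F\<^esub>" by (simp add: quotient_field_carrier fraction_eq)
  then have "polynomial\<^bsub>?F\<^esub> (\<iota> ` carrier R) ?p"
    using l \<iota>1 by (auto simp: polynomial_def)
  ultimately have "integral_over ?F (\<iota> ` carrier R) x"
    unfolding integral_over_def e_def by (intro exI[of _ ?p]) auto
  then have "x \<in> \<iota> ` carrier R" using ic xc by (auto simp: integrally_closed_def Let_def \<iota>_def)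
  then obtain c where "c \<in> carrier R" "fraction R b a = fraction R c \<one>" by (auto simp: x_def \<iota>_def)
  then have "c \<in> carrier R" "b = a \<otimes> c" using a b m_comm[of a c] by (auto simp: fraction_eq)
  then show ?thesis by blast
qed

text \<open>Take for \<open>P\<close> an associated prime \<open>(a : b')\<close> of \<open>(a)\<close> with \<open>b'\<close> a multiple of \<open>b\<close>. The fraction \<open>b'/a\<close>
  does not map \<open>P\<close> into itself, since it would then be integral. Hence some product \<open>(b'/a) p\<close> with \<open>p\<close> in
  \<open>P\<close> lies outside \<open>P\<close>, and \<open>p\<close> generates \<open>P\<close> after localization. A prime ideal that is locally
  principal and nonzero has height one.\<close>

lemma denominators_in_height_one_prime:
  assumes ic: "integrally_closed R"
    and a: "a \<in> carrier R" "a \<noteq> \<zero>" and b: "b \<in> carrier R"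
    and ndvd: "\<not> (\<exists>c\<in>carrier R. b = a \<otimes> c)"
  shows "\<exists>P. primeideal P R \<and> height R P = 1 \<and>
    (\<forall>d\<in>carrier R. (\<exists>c\<in>carrier R. d \<otimes> b = a \<otimes> c) \<longrightarrow> d \<in> P)"
proof -
  define colon where "colon c = {d \<in> carrier R. \<exists>e\<in>carrier R. d \<otimes> c = a \<otimes> e}" for c
  have colon_ideal: "ideal (colon c) R" if c: "c \<in> carrier R" for c
  proof (rule ideal_if_ideal_in, unfold ideal_in_def, intro conjI ballI)
    show "colon c \<subseteq> carrier R" "\<zero> \<in> colon c" using a c by (auto simp: colon_def intro!: bexI[of _ \<zero>])
  next
    fix y z assume "y \<in> colon c" "z \<in> colon c"
    then obtain e f where e: "y \<in> carrier R" "e \<in> carrier R" "y \<otimes> c = a \<otimes> e"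
      "z \<in> carrier R" "f \<in> carrier R" "z \<otimes> c = a \<otimes> f" by (auto simp: colon_def)
    then have "(y \<oplus> z) \<otimes> c = a \<otimes> (e \<oplus> f)" using a c by (simp add: l_distr r_distr)
    then show "y \<oplus> z \<in> colon c" using e by (auto simp: colon_def)
  next
    fix r y assume y: "r \<in> carrier R" "y \<in> colon c"
    then obtain e where e: "y \<in> carrier R" "e \<in> carrier R" "y \<otimes> c = a \<otimes> e" by (auto simp: colon_def)
    have "r \<otimes> y \<otimes> c = r \<otimes> (y \<otimes> c)" using e(1) c y(1) by algebra
    also have "\<dots> = a \<otimes> (r \<otimes> e)" unfolding e(3) using e(1,2) a(1) y(1) by algebra
    finally show "r \<otimes> y \<in> colon c" using e y by (auto simp: colon_def)
  qed
  define C where "C = {colon (b \<otimes> c) | c. c \<in> carrier R \<and> \<one> \<notin> colon (b \<otimes> c)}"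
  have "\<one> \<notin> colon (b \<otimes> \<one>)" using ndvd b by (auto simp: colon_def)
  then have "C \<noteq> {}" by (auto simp: C_def)
  moreover have "\<Union>D \<in> C" if "D \<noteq> {}" "subset.chain C D" for D
  proof -
    have "subset.chain {J. ideal J R} D"
      using that(2) colon_ideal b by (auto simp: subset.chain_def C_def)
    then have "\<Union>D \<in> D" using ideal_chain_is_trivial that(1) by blast
    then show ?thesis using that(2) by (auto simp: subset.chain_def)
  qed
  ultimately obtain P where P: "P \<in> C" "\<forall>M\<in>C. P \<subseteq> M \<longrightarrow> M = P"
    using subset_Zorn_nonempty[of C] by blast
  then obtain c0 where c0: "c0 \<in> carrier R" "P = colon (b \<otimes> c0)" "\<one> \<notin> P" by (auto simp: C_def)
  define b' where "b' = b \<otimes> c0"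
  have b': "b' \<in> carrier R" "P = colon b'" using b c0 by (auto simp: b'_def)
  have Pid: "ideal P R" using colon_ideal b' by simp
  have prime: "primeideal P R"
  proof (rule primeidealI)
    show "ideal P R" "cring R" by (rule Pid) (rule cring_axioms)
    show "carrier R \<noteq> P" using c0 by auto
    fix x y assume xy: "x \<in> carrier R" "y \<in> carrier R" "x \<otimes> y \<in> P"
    show "x \<in> P \<or> y \<in> P"
    proof (cases "y \<in> P")
      case False
      have bc: "b \<otimes> (c0 \<otimes> y) = y \<otimes> b'" using b c0 xy unfolding b'_def by algebra
      have "\<one> \<notin> colon (b \<otimes> (c0 \<otimes> y))"
        using False xy b' by (auto simp: bc colon_def)
      then have "colon (b \<otimes> (c0 \<otimes> y)) \<in> C" using c0 xy by (auto simp: C_def)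
      moreover have "P \<subseteq> colon (b \<otimes> (c0 \<otimes> y))"
      proof
        fix d assume "d \<in> P"
        then obtain e where e: "d \<in> carrier R" "e \<in> carrier R" "d \<otimes> b' = a \<otimes> e" by (auto simp: b' colon_def)
        have "d \<otimes> (y \<otimes> b') = y \<otimes> (d \<otimes> b')" using e(1) b'(1) xy(2) by algebra
        also have "\<dots> = a \<otimes> (y \<otimes> e)" unfolding e(3) using e(1,2) a(1) xy(1,2) by algebra
        finally show "d \<in> colon (b \<otimes> (c0 \<otimes> y))" using e xy unfolding bc by (auto simp: colon_def)
      qed
      ultimately have eq: "colon (y \<otimes> b') = P" using P bc by auto
      obtain e where "e \<in> carrier R" "x \<otimes> y \<otimes> b' = a \<otimes> e" using xy by (auto simp: b' colon_def)
      then have "x \<in> colon (y \<otimes> b')" using xy b' by (auto simp: colon_def m_assoc)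
      then show ?thesis using eq by simp
    qed auto
  qed
  interpret P: primeideal P R by (rule prime)
  have "a \<in> colon b'" using a(1) b'(1) unfolding colon_def by blast
  then have aP: "a \<in> P" using b'(2) by simp
  have Pmul: "\<exists>e\<in>carrier R. b' \<otimes> p = a \<otimes> e" if "p \<in> P" for p
  proof -
    have "p \<in> colon b'" using that b'(2) by simp
    then obtain e where "p \<in> carrier R" "e \<in> carrier R" "p \<otimes> b' = a \<otimes> e" unfolding colon_def by blast
    then show ?thesis using m_comm[of p b'] b'(1) by auto
  qed
  obtain p u where pu: "p \<in> P" "u \<in> carrier R" "u \<notin> P" "b' \<otimes> p = a \<otimes> u"
  proof (rule ccontr)
    note witness = that
    assume no: "\<not> thesis"
    have "\<exists>e\<in>P. a \<otimes> e = b' \<otimes> p" if p: "p \<in> P" for p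
    proof -
      obtain e where e: "e \<in> carrier R" "b' \<otimes> p = a \<otimes> e" using Pmul[OF p] by blast
      then have "e \<in> P" using no witness[OF p] by blast
      then show ?thesis using e(2) by metis
    qed
    then obtain E where E: "\<And>p. p \<in> P \<Longrightarrow> E p \<in> P \<and> a \<otimes> E p = b' \<otimes> p" by metis
    \<comment> \<open>the elements \<open>(b'/a)\<^sup>n a\<close> all stay in \<open>P\<close>\<close>
    define q where "q n = (E ^^ n) a" for n
    have qP: "q n \<in> P" for n by (induction n) (auto simp: q_def aP E)
    have "\<exists>c\<in>carrier R. b' = a \<otimes> c"
    proof (rule almost_integral_imp_mem[OF ic a b'(1)])
      show "q n \<in> carrier R" for n using qP P.Icarr by blast
      show "q 0 \<noteq> \<zero>" using a by (simp add: q_def)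
      show "a \<otimes> q (Suc n) = b' \<otimes> q n" for n using E[OF qP[of n]] by (simp add: q_def)
    qed
    then have "\<one> \<in> colon b'" using b'(1) by (auto simp: colon_def)
    then show False using c0 b'(2) by simp
  qed
  have pc: "p \<in> carrier R" using pu P.Icarr by blast
  have div: "\<exists>e\<in>carrier R. x \<otimes> u = e \<otimes> p" if xP: "x \<in> P" for x
  proof -
    obtain e where e: "e \<in> carrier R" "b' \<otimes> x = a \<otimes> e" using Pmul[OF xP] by blast
    have xc: "x \<in> carrier R" using xP P.Icarr by blast
    have "a \<otimes> (x \<otimes> u) = x \<otimes> (a \<otimes> u)" using a xc pu by algebra
    also have "\<dots> = (b' \<otimes> x) \<otimes> p" unfolding pu(4)[symmetric] using xc b' pc by algebra
    also have "\<dots> = a \<otimes> (e \<otimes> p)" unfolding e(2) using e(1) a(1) pc by algebra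
    finally show ?thesis using a e xc pc pu by (auto simp: m_lcancel)
  qed
  \<comment> \<open>If \<open>Q\<close> lies strictly below \<open>P\<close>, then dividing a member of \<open>Q\<close> by the local generator \<open>p\<close> again
    gives a member of \<open>Q\<close>, and this can be repeated without end.\<close>
  have no_between: "Q = {\<zero>}" if Q: "primeideal Q R" "Q \<subset> P" for Q
  proof (rule ccontr)
    interpret Q: primeideal Q R by (rule Q(1))
    assume "Q \<noteq> {\<zero>}"
    then obtain x0 where x0: "x0 \<in> Q" "x0 \<noteq> \<zero>" using Q.zero_closed by auto
    have "u \<notin> Q" using pu Q by blast
    have pQ: "p \<notin> Q"
    proof
      assume "p \<in> Q"
      have "P \<subseteq> Q"
      proof
        fix y assume y: "y \<in> P"
        then obtain e where "e \<in> carrier R" "y \<otimes> u = e \<otimes> p" using div by blast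
        then have "y \<otimes> u \<in> Q" using \<open>p \<in> Q\<close> Q.I_l_closed by simp
        then show "y \<in> Q" using Q.I_prime[of y u] \<open>u \<notin> Q\<close> pu y P.Icarr by blast
      qed
      then show False using Q by blast
    qed
    have "\<exists>e\<in>Q. x \<otimes> u = e \<otimes> p" if xQ: "x \<in> Q" for x
    proof -
      obtain e where e: "e \<in> carrier R" "x \<otimes> u = e \<otimes> p" using div xQ Q by blast
      then have "e \<otimes> p \<in> Q" using Q.I_r_closed[OF xQ pu(2)] by simp
      then show ?thesis using e Q.I_prime[of e p] pQ pc by blast
    qed
    then obtain E where E: "\<And>x. x \<in> Q \<Longrightarrow> E x \<in> Q \<and> x \<otimes> u = E x \<otimes> p" by metis
    define x where "x n = (E ^^ n) x0" for n
    have xQ: "x n \<in> Q" for n by (induction n) (auto simp: x_def x0 E)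
    have xc: "x n \<in> carrier R" for n using xQ Q.Icarr by blast
    have xS: "x n \<otimes> u = x (Suc n) \<otimes> p" for n using E[OF xQ[of n]] by (simp add: x_def)
    have u0: "u \<noteq> \<zero>" using pu P.zero_closed by auto
    have xnz: "x n \<noteq> \<zero>" for n
    proof (induction n)
      case (Suc n)
      then have "x n \<otimes> u \<noteq> \<zero>" using u0 xc pu by (simp add: integral_iff)
      then show ?case using xS[of n] pc by auto
    qed (simp add: x_def x0)
    define J where "J n = {y \<in> carrier R. \<exists>(s::nat). \<exists>r\<in>carrier R. y \<otimes> u [^] s = r \<otimes> x n}" for n
    have upc: "u [^] (s::nat) \<in> carrier R" for s using pu by simp
    have J: "ideal (J n) R" for n
    proof (rule ideal_if_ideal_in, unfold ideal_in_def, intro conjI ballI)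
      show "J n \<subseteq> carrier R" "\<zero> \<in> J n" using xc upc by (auto simp: J_def intro!: bexI[of _ \<zero>])
    next
      fix y z assume "y \<in> J n" "z \<in> J n"
      then obtain s r s' r' where e: "y \<in> carrier R" "r \<in> carrier R" "y \<otimes> u [^] (s::nat) = r \<otimes> x n"
        "z \<in> carrier R" "r' \<in> carrier R" "z \<otimes> u [^] (s'::nat) = r' \<otimes> x n" by (auto simp: J_def)
      have "(y \<oplus> z) \<otimes> u [^] (s + s') = (y \<oplus> z) \<otimes> (u [^] s \<otimes> u [^] s')" using pu by (simp add: nat_pow_mult)
      also have "\<dots> = (y \<otimes> u [^] s) \<otimes> u [^] s' \<oplus> (z \<otimes> u [^] s') \<otimes> u [^] s" using e(1,2,4,5) upc[of s] upc[of s'] by algebra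
      also have "\<dots> = (r \<otimes> u [^] s' \<oplus> r' \<otimes> u [^] s) \<otimes> x n" unfolding e(3,6) using e(1,2,4,5) upc[of s] upc[of s'] xc[of n] by algebra
      finally have "(y \<oplus> z) \<otimes> u [^] (s + s') = (r \<otimes> u [^] s' \<oplus> r' \<otimes> u [^] s) \<otimes> x n" .
      moreover have "r \<otimes> u [^] s' \<oplus> r' \<otimes> u [^] s \<in> carrier R" "y \<oplus> z \<in> carrier R"
        using e(1,2,4,5) upc by auto
      ultimately show "y \<oplus> z \<in> J n" unfolding J_def by blast
    next
      fix t y assume y: "t \<in> carrier R" "y \<in> J n"
      then obtain s r where e: "y \<in> carrier R" "r \<in> carrier R" "y \<otimes> u [^] (s::nat) = r \<otimes> x n" by (auto simp: J_def)
      have "t \<otimes> y \<otimes> u [^] s = t \<otimes> (y \<otimes> u [^] s)" using e(1,2) upc y by (simp add: m_assoc)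
      also have "\<dots> = (t \<otimes> r) \<otimes> x n" unfolding e(3) using e(1,2) xc y by (simp add: m_assoc)
      finally show "t \<otimes> y \<in> J n" using e y by (auto simp: J_def)
    qed
    have "J n \<subseteq> J (Suc n)" for n
    proof
      fix y assume "y \<in> J n"
      then obtain s r where e: "y \<in> carrier R" "r \<in> carrier R" "y \<otimes> u [^] (s::nat) = r \<otimes> x n" by (auto simp: J_def)
      have "y \<otimes> u [^] Suc s = (y \<otimes> u [^] s) \<otimes> u" using e(1) pu by (simp add: m_assoc)
      also have "\<dots> = r \<otimes> (x n \<otimes> u)" unfolding e(3) using e(1,2) pu xc by (simp add: m_assoc)
      also have "\<dots> = (r \<otimes> p) \<otimes> x (Suc n)" unfolding xS using e(2) pc xc by (simp add: m_ac)
      finally show "y \<in> J (Suc n)" using e pc unfolding J_def by blast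
    qed
    then obtain n where n: "J (Suc n) \<subseteq> J n" using ideal_sequence_stabilizes[of J] J by blast
    have "x (Suc n) \<in> J (Suc n)" unfolding J_def using xc by (auto intro!: exI[of _ "0::nat"] bexI[of _ \<one>])
    then have "x (Suc n) \<in> J n" using n by blast
    then obtain s r where e: "r \<in> carrier R" "x (Suc n) \<otimes> u [^] (s::nat) = r \<otimes> x n"
      unfolding J_def by blast
    have "x (Suc n) \<otimes> u [^] Suc s = (x (Suc n) \<otimes> u [^] s) \<otimes> u" using xc pu by (simp add: m_assoc)
    also have "\<dots> = r \<otimes> (x n \<otimes> u)" unfolding e(2) using e(1) pu xc by (simp add: m_assoc)
    also have "\<dots> = x (Suc n) \<otimes> (r \<otimes> p)" unfolding xS using e(1) pc xc by (simp add: m_ac)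
    finally have "u [^] Suc s = r \<otimes> p" using m_lcancel[OF xnz xc, of "u [^] Suc s" "r \<otimes> p"] e(1) pc pu by simp
    then have "u [^] Suc s \<in> P" using P.I_l_closed[OF pu(1) e(1)] by simp
    moreover have "u [^] m \<notin> P" for m :: nat
    proof (induction m)
      case 0
      then show ?case using c0 by simp
    next
      case (Suc m)
      then show ?case using P.I_prime[of "u [^] m" u] pu by auto
    qed
    ultimately show False by blast
  qed
  have "height R P = 1"
    unfolding height_def
  proof (rule antisym)
    show "Sup {enat n | n. \<exists>Q. (\<forall>i\<le>n. primeideal (Q i) R) \<and> (\<forall>i<n. Q i \<subset> Q (Suc i)) \<and> Q n = P} \<le> 1"
    proof (rule Sup_least)
      fix l assume "l \<in> {enat n | n. \<exists>Q. (\<forall>i\<le>n. primeideal (Q i) R) \<and> (\<forall>i<n. Q i \<subset> Q (Suc i)) \<and> Q n = P}"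
      then obtain n Q where l: "l = enat n"
        and Q: "\<forall>i\<le>n. primeideal (Q i) R" "\<forall>i<n. Q i \<subset> Q (Suc i)" "Q n = P" by blast
      show "l \<le> 1"
      proof (rule ccontr)
        assume "\<not> l \<le> 1"
        then have "\<not> enat n \<le> 1" using l by simp
        then obtain m where m: "n = Suc (Suc m)"
          by (metis One_nat_def enat_ord_simps(1) le_SucI le_zero_eq not0_implies_Suc not_less_eq_eq one_enat_def zero_le)
        then have "Q (Suc m) = {\<zero>}" using Q no_between[of "Q (Suc m)"] by auto
        moreover have "Q m \<subset> Q (Suc m)" "primeideal (Q m) R" using Q m by auto
        moreover have "\<zero> \<in> Q m"
          using additive_subgroup.zero_closed[OF ideal.axioms(1)[OF primeideal.axioms(1)[OF \<open>primeideal (Q m) R\<close>]]] .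
        ultimately show False by auto
      qed
    qed
    have "\<exists>Q. (\<forall>i\<le>1::nat. primeideal (Q i) R) \<and> (\<forall>i<1. Q i \<subset> Q (Suc i)) \<and> Q 1 = P"
      using zeroprimeideal prime aP a P.zero_closed
      by (intro exI[of _ "\<lambda>i::nat. if i = 0 then {\<zero>} else P"]) auto
    then have "enat 1 \<in> {enat n | n. \<exists>Q. (\<forall>i\<le>n. primeideal (Q i) R) \<and> (\<forall>i<n. Q i \<subset> Q (Suc i)) \<and> Q n = P}"
      by blast
    then show "1 \<le> Sup {enat n | n. \<exists>Q. (\<forall>i\<le>n. primeideal (Q i) R) \<and> (\<forall>i<n. Q i \<subset> Q (Suc i)) \<and> Q n = P}"
      unfolding one_enat_def by (rule Sup_upper)
  qed
  moreover have "d \<in> P" if "d \<in> carrier R" "c \<in> carrier R" "d \<otimes> b = a \<otimes> c" for d c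
  proof -
    have "d \<otimes> b' = (d \<otimes> b) \<otimes> c0" using that(1) b c0 by (simp add: b'_def m_assoc)
    also have "\<dots> = a \<otimes> (c \<otimes> c0)" unfolding that(3) using that(2) a c0 by (simp add: m_assoc)
    finally have "d \<in> colon b'" using that(1,2) c0(1) unfolding colon_def by blast
    then show ?thesis using b'(2) by simp
  qed
  ultimately show ?thesis using prime by blast
qed

end

section \<open>Finite groups acting on a domain\<close>

text \<open>The members of the group are functions, but its multiplication is required to be composition on the
  carrier of \<open>A\<close> only, and equality of two members is decided there.\<close>

locale faithful_ring_action = domain A + G: group G
  for A :: "('a, 'm) ring_scheme" (structure) and G :: "('a \<Rightarrow> 'a) monoid" +
  assumes finite_group: "finite (carrier G)"
    and act_hom: "\<rho> \<in> carrier G \<Longrightarrow> \<rho> \<in> ring_hom A A"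
    and act_mult: "\<rho> \<in> carrier G \<Longrightarrow> \<tau> \<in> carrier G \<Longrightarrow> a \<in> carrier A \<Longrightarrow> (\<rho> \<otimes>\<^bsub>G\<^esub> \<tau>) a = \<rho> (\<tau> a)"
    and act_one: "a \<in> carrier A \<Longrightarrow> \<one>\<^bsub>G\<^esub> a = a"
    and faithful: "\<rho> \<in> carrier G \<Longrightarrow> (\<And>a. a \<in> carrier A \<Longrightarrow> \<rho> a = a) \<Longrightarrow> \<rho> = \<one>\<^bsub>G\<^esub>"
begin

abbreviation mult_G (infixl \<open>\<bullet>\<close> 70) where "\<rho> \<bullet> \<tau> \<equiv> \<rho> \<otimes>\<^bsub>G\<^esub> \<tau>"
abbreviation inv_G where "inv_G \<rho> \<equiv> inv\<^bsub>G\<^esub> \<rho>"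

lemma act_ring_hom: "\<rho> \<in> carrier G \<Longrightarrow> ring_hom_cring A A \<rho>"
  using act_hom by (intro UnivPoly.ring_hom_cringI) (auto intro: is_cring)

lemma act_closed [simp]: "\<rho> \<in> carrier G \<Longrightarrow> a \<in> carrier A \<Longrightarrow> \<rho> a \<in> carrier A"
  using ring_hom_closed[OF act_hom] by blast

lemma act_simps [simp]:
  assumes "\<rho> \<in> carrier G"
  shows "a \<in> carrier A \<Longrightarrow> b \<in> carrier A \<Longrightarrow> \<rho> (a \<oplus> b) = \<rho> a \<oplus> \<rho> b"
    "a \<in> carrier A \<Longrightarrow> b \<in> carrier A \<Longrightarrow> \<rho> (a \<otimes> b) = \<rho> a \<otimes> \<rho> b"
    "a \<in> carrier A \<Longrightarrow> b \<in> carrier A \<Longrightarrow> \<rho> (a \<ominus> b) = \<rho> a \<ominus> \<rho> b"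
    "a \<in> carrier A \<Longrightarrow> \<rho> (\<ominus> a) = \<ominus> \<rho> a"
    "\<rho> \<one> = \<one>" "\<rho> \<zero> = \<zero>"
proof -
  interpret ring_hom_cring A A \<rho> by (rule act_ring_hom[OF assms])
  show "a \<in> carrier A \<Longrightarrow> b \<in> carrier A \<Longrightarrow> \<rho> (a \<oplus> b) = \<rho> a \<oplus> \<rho> b"
    "a \<in> carrier A \<Longrightarrow> b \<in> carrier A \<Longrightarrow> \<rho> (a \<otimes> b) = \<rho> a \<otimes> \<rho> b"
    "a \<in> carrier A \<Longrightarrow> \<rho> (\<ominus> a) = \<ominus> \<rho> a"
    "\<rho> \<one> = \<one>" "\<rho> \<zero> = \<zero>" by simp_all
  then show "a \<in> carrier A \<Longrightarrow> b \<in> carrier A \<Longrightarrow> \<rho> (a \<ominus> b) = \<rho> a \<ominus> \<rho> b"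
    by (simp add: minus_eq)
qed

lemma act_finsum:
  "\<rho> \<in> carrier G \<Longrightarrow> f \<in> S \<rightarrow> carrier A \<Longrightarrow> \<rho> (\<Oplus>i\<in>S. f i) = (\<Oplus>i\<in>S. \<rho> (f i))"
  using ring_hom_cring.hom_finsum[OF act_ring_hom] by (simp add: comp_def)

lemma act_finprod:
  "\<rho> \<in> carrier G \<Longrightarrow> f \<in> S \<rightarrow> carrier A \<Longrightarrow> \<rho> (\<Otimes>i\<in>S. f i) = (\<Otimes>i\<in>S. \<rho> (f i))"
  using ring_hom_cring.hom_finprod[OF act_ring_hom] by (simp add: comp_def)

lemma act_inv [simp]:
  assumes "\<rho> \<in> carrier G" "a \<in> carrier A"
  shows "inv_G \<rho> (\<rho> a) = a" "\<rho> (inv_G \<rho> a) = a"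
  using act_mult[of "inv_G \<rho>" \<rho> a] act_mult[of \<rho> "inv_G \<rho>" a] assms by (simp_all add: act_one)

lemma act_inj: "\<rho> \<in> carrier G \<Longrightarrow> a \<in> carrier A \<Longrightarrow> b \<in> carrier A \<Longrightarrow> \<rho> a = \<rho> b \<Longrightarrow> a = b"
  using act_inv(1) by metis

definition Inv :: "('a \<Rightarrow> 'a) set \<Rightarrow> 'a set" where
  "Inv H = {a \<in> carrier A. \<forall>\<rho>\<in>H. \<rho> a = a}"

lemma Inv_closed: "a \<in> Inv H \<Longrightarrow> a \<in> carrier A" by (simp add: Inv_def)

lemma Inv_fixed: "a \<in> Inv H \<Longrightarrow> \<rho> \<in> H \<Longrightarrow> \<rho> a = a" by (simp add: Inv_def)

lemma Inv_antimono: "H \<subseteq> H' \<Longrightarrow> Inv H' \<subseteq> Inv H" by (auto simp: Inv_def)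

lemma Inv_subring:
  assumes H: "H \<subseteq> carrier G" shows "subring (Inv H) A"
proof (rule subringI)
  show "\<one> \<in> Inv H" using H by (auto simp: Inv_def)
next
  fix a assume a: "a \<in> Inv H"
  have "\<rho> (\<ominus> a) = \<ominus> a" if "\<rho> \<in> H" for \<rho>
    using that H Inv_fixed[OF a that] Inv_closed[OF a] by (simp add: subset_iff)
  then show "\<ominus> a \<in> Inv H" using Inv_closed[OF a] by (simp add: Inv_def)
next
  fix a b assume ab: "a \<in> Inv H" "b \<in> Inv H"
  have "\<rho> (a \<oplus> b) = a \<oplus> b \<and> \<rho> (a \<otimes> b) = a \<otimes> b" if "\<rho> \<in> H" for \<rho>
    using that H Inv_fixed[OF ab(1) that] Inv_fixed[OF ab(2) that] ab Inv_closed
    by (simp add: subset_iff)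
  then show "a \<oplus> b \<in> Inv H" "a \<otimes> b \<in> Inv H" using ab by (simp_all add: Inv_def)
qed (auto simp: Inv_def)

lemmas Inv_zero = subringE(2)[OF Inv_subring]
  and Inv_one = subringE(3)[OF Inv_subring]
  and Inv_mult = subringE(6)[OF Inv_subring]

lemma left_translation_image:
  assumes H: "subgroup H G" and k: "k \<in> H" shows "(\<lambda>h. k \<bullet> h) ` H = H"
proof
  have HG: "H \<subseteq> carrier G" by (rule subgroup.subset[OF H])
  show "(\<lambda>h. k \<bullet> h) ` H \<subseteq> H" using subgroup.m_closed[OF H k] by auto
  show "H \<subseteq> (\<lambda>h. k \<bullet> h) ` H"
  proof
    fix h assume h: "h \<in> H"
    then have "h = k \<bullet> (inv_G k \<bullet> h)" using HG k by (simp add: G.m_assoc[symmetric] subset_iff)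
    then show "h \<in> (\<lambda>h. k \<bullet> h) ` H"
      using subgroup.m_closed[OF H subgroup.m_inv_closed[OF H k] h] by blast
  qed
qed

lemma Inv_trivial: "Inv {\<one>\<^bsub>G\<^esub>} = carrier A"
  by (auto simp: Inv_def act_one)


section \<open>Sums over cosets\<close>

text \<open>One representative of each left coset is chosen. The sum is only of interest for functions that are
  constant on the cosets. A sum over the whole group will not do, because it introduces the factor
  \<open>|H|\<close>, which may be zero in \<open>A\<close>.\<close>

definition coset_sum :: "('a \<Rightarrow> 'a) set \<Rightarrow> (('a \<Rightarrow> 'a) \<Rightarrow> 'a) \<Rightarrow> 'a" where
  "coset_sum H \<phi> = (\<Oplus>C\<in>(\<lambda>g. g <#\<^bsub>G\<^esub> H) ` carrier G. \<phi> (SOME g. g \<in> C))"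

context
  fixes H assumes H: "subgroup H G"
begin

lemma H_sub: "H \<subseteq> carrier G" by (rule subgroup.subset[OF H])

lemma mem_coset: "g \<in> carrier G \<Longrightarrow> g \<in> g <#\<^bsub>G\<^esub> H"
  using subgroup.one_closed[OF H] by (force simp: l_coset_def)

lemma coset_rep:
  assumes "g \<in> carrier G" shows "\<exists>h\<in>H. (SOME x. x \<in> g <#\<^bsub>G\<^esub> H) = g \<bullet> h"
proof -
  have "(SOME x. x \<in> g <#\<^bsub>G\<^esub> H) \<in> g <#\<^bsub>G\<^esub> H" 
    using someI[of "\<lambda>x. x \<in> g <#\<^bsub>G\<^esub> H", OF mem_coset[OF assms]] .
  then show ?thesis by (auto simp: l_coset_def)
qed

lemma coset_rep_closed: "C \<in> (\<lambda>g. g <#\<^bsub>G\<^esub> H) ` carrier G \<Longrightarrow> (SOME x. x \<in> C) \<in> carrier G"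
  using coset_rep H_sub by fastforce

lemma coset_rep_coset:
  assumes "C \<in> (\<lambda>g. g <#\<^bsub>G\<^esub> H) ` carrier G" shows "(SOME x. x \<in> C) <#\<^bsub>G\<^esub> H = C"
proof -
  obtain g where g: "g \<in> carrier G" "C = g <#\<^bsub>G\<^esub> H" using assms by blast
  then have "(SOME x. x \<in> C) \<in> g <#\<^bsub>G\<^esub> H" using someI[of "\<lambda>x. x \<in> C", OF mem_coset[OF g(1), folded g(2)]] by simp
  then show ?thesis using G.l_repr_independence[OF _ g(1) H] g by metis
qed

lemma coset_eq_iff:
  assumes "g \<in> carrier G" "g' \<in> carrier G"
  shows "g <#\<^bsub>G\<^esub> H = g' <#\<^bsub>G\<^esub> H \<longleftrightarrow> inv_G g \<bullet> g' \<in> H"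
proof
  assume "g <#\<^bsub>G\<^esub> H = g' <#\<^bsub>G\<^esub> H"
  then obtain h where "h \<in> H" "g' = g \<bullet> h" using mem_coset[OF assms(2)] by (auto simp: l_coset_def)
  then show "inv_G g \<bullet> g' \<in> H" using assms H_sub by (simp add: G.m_assoc[symmetric] subset_iff)
next
  assume *: "inv_G g \<bullet> g' \<in> H"
  have "g' = g \<bullet> (inv_G g \<bullet> g')" using assms by (simp add: G.m_assoc[symmetric])
  then have "g' \<in> g <#\<^bsub>G\<^esub> H" using * unfolding l_coset_def by blast
  then show "g <#\<^bsub>G\<^esub> H = g' <#\<^bsub>G\<^esub> H" using G.l_repr_independence[OF _ assms(1) H] by simp
qed

lemma coset_sum_closed: "\<phi> \<in> carrier G \<rightarrow> carrier A \<Longrightarrow> coset_sum H \<phi> \<in> carrier A"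
  unfolding coset_sum_def using coset_rep_closed by (intro finsum_closed) auto

lemma coset_sum_cong:
  assumes "\<And>g. g \<in> carrier G \<Longrightarrow> \<phi> g = \<psi> g" "\<psi> \<in> carrier G \<rightarrow> carrier A"
  shows "coset_sum H \<phi> = coset_sum H \<psi>"
  unfolding coset_sum_def using assms coset_rep_closed by (intro finsum_cong') auto

lemma coset_sum_add:
  assumes "\<phi> \<in> carrier G \<rightarrow> carrier A" "\<psi> \<in> carrier G \<rightarrow> carrier A"
  shows "coset_sum H (\<lambda>g. \<phi> g \<oplus> \<psi> g) = coset_sum H \<phi> \<oplus> coset_sum H \<psi>"
  unfolding coset_sum_def using assms coset_rep_closed by (intro finsum_addf) auto

lemma coset_sum_smult:
  assumes "\<phi> \<in> carrier G \<rightarrow> carrier A" "a \<in> carrier A"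
  shows "coset_sum H (\<lambda>g. a \<otimes> \<phi> g) = a \<otimes> coset_sum H \<phi>"
  unfolding coset_sum_def using assms coset_rep_closed finite_group
  by (intro finsum_rdistr[symmetric]) auto

lemma coset_sum_act:
  assumes "\<phi> \<in> carrier G \<rightarrow> carrier A" "\<rho> \<in> carrier G"
  shows "\<rho> (coset_sum H \<phi>) = coset_sum H (\<lambda>g. \<rho> (\<phi> g))"
  unfolding coset_sum_def using assms coset_rep_closed by (intro act_finsum) auto

lemma coset_sum_eq_at_one:
  assumes "\<phi> \<in> carrier G \<rightarrow> carrier A" "\<And>g h. g \<in> carrier G \<Longrightarrow> h \<in> H \<Longrightarrow> \<phi> (g \<bullet> h) = \<phi> g"
    "\<And>g. g \<in> carrier G \<Longrightarrow> g \<notin> H \<Longrightarrow> \<phi> g = \<zero>"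
  shows "coset_sum H \<phi> = \<phi> \<one>\<^bsub>G\<^esub>"
proof -
  let ?C = "(\<lambda>g. g <#\<^bsub>G\<^esub> H) ` carrier G"
  have "\<phi> (SOME x. x \<in> C) = (if C = \<one>\<^bsub>G\<^esub> <#\<^bsub>G\<^esub> H then \<phi> \<one>\<^bsub>G\<^esub> else \<zero>)" if "C \<in> ?C" for C
  proof -
    define g where "g = (SOME x. x \<in> C)"
    have g: "g \<in> carrier G" "C = g <#\<^bsub>G\<^esub> H" using coset_rep_closed[OF that] coset_rep_coset[OF that] by (simp_all add: g_def)
    have "C = \<one>\<^bsub>G\<^esub> <#\<^bsub>G\<^esub> H \<longleftrightarrow> g \<in> H"
      using coset_eq_iff[of "\<one>\<^bsub>G\<^esub>" g] g by auto
    moreover have "g \<in> H \<Longrightarrow> \<phi> g = \<phi> \<one>\<^bsub>G\<^esub>" using assms(2)[of "\<one>\<^bsub>G\<^esub>" g] g by simp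
    ultimately show ?thesis using assms(3) g unfolding g_def[symmetric] by auto
  qed
  then have "coset_sum H \<phi> = (\<Oplus>C\<in>?C. if C = \<one>\<^bsub>G\<^esub> <#\<^bsub>G\<^esub> H then \<phi> \<one>\<^bsub>G\<^esub> else \<zero>)"
    unfolding coset_sum_def using assms(1) by (intro finsum_cong') auto
  also have "\<dots> = (\<Oplus>C\<in>?C. if \<one>\<^bsub>G\<^esub> <#\<^bsub>G\<^esub> H = C then (\<lambda>_. \<phi> \<one>\<^bsub>G\<^esub>) C else \<zero>)"
    using assms(1) by (intro finsum_cong') auto
  also have "\<dots> = \<phi> \<one>\<^bsub>G\<^esub>"
    using assms(1) finite_group by (intro finsum_singleton) auto
  finally show ?thesis .
qed

text \<open>Left translation permutes the cosets.\<close>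

lemma coset_sum_translate:
  assumes \<phi>: "\<phi> \<in> carrier G \<rightarrow> carrier A" "\<And>g h. g \<in> carrier G \<Longrightarrow> h \<in> H \<Longrightarrow> \<phi> (g \<bullet> h) = \<phi> g"
    and s: "\<rho> \<in> carrier G"
  shows "coset_sum H (\<lambda>g. \<phi> (\<rho> \<bullet> g)) = coset_sum H \<phi>"
proof -
  let ?C = "(\<lambda>g. g <#\<^bsub>G\<^esub> H) ` carrier G"
  let ?t = "\<lambda>C. \<rho> <#\<^bsub>G\<^esub> C"
  have t: "?t (g <#\<^bsub>G\<^esub> H) = (\<rho> \<bullet> g) <#\<^bsub>G\<^esub> H" if "g \<in> carrier G" for g
    using G.lcos_m_assoc[OF H_sub s that] .
  have img: "?t ` ?C = ?C"
  proof
    show "?t ` ?C \<subseteq> ?C" using t s by auto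
    show "?C \<subseteq> ?t ` ?C"
    proof
      fix C assume "C \<in> ?C"
      then obtain g where g: "g \<in> carrier G" "C = g <#\<^bsub>G\<^esub> H" by blast
      then have "C = ?t ((inv_G \<rho> \<bullet> g) <#\<^bsub>G\<^esub> H)" using t s by (simp add: G.m_assoc[symmetric])
      then show "C \<in> ?t ` ?C" using g s by blast
    qed
  qed
  then have inj: "inj_on ?t ?C" using finite_group by (intro eq_card_imp_inj_on) auto
  have "coset_sum H \<phi> = (\<Oplus>C\<in>?t ` ?C. \<phi> (SOME x. x \<in> C))" unfolding img coset_sum_def ..
  also have "\<dots> = (\<Oplus>C\<in>?C. \<phi> (SOME x. x \<in> ?t C))"
    using coset_rep_closed \<phi>(1) inj img by (intro finsum_reindex) auto
  also have "\<dots> = coset_sum H (\<lambda>g. \<phi> (\<rho> \<bullet> g))"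
    unfolding coset_sum_def
  proof (rule finsum_cong')
    show "(\<lambda>C. \<phi> (\<rho> \<bullet> (SOME g. g \<in> C))) \<in> ?C \<rightarrow> carrier A"
      using coset_rep_closed \<phi>(1) s by auto
    fix C assume C: "C \<in> ?C"
    define g where "g = (SOME x. x \<in> C)"
    have g: "g \<in> carrier G" "C = g <#\<^bsub>G\<^esub> H" using coset_rep_closed[OF C] coset_rep_coset[OF C] by (simp_all add: g_def)
    obtain h where h: "h \<in> H" "(SOME x. x \<in> (\<rho> \<bullet> g) <#\<^bsub>G\<^esub> H) = \<rho> \<bullet> g \<bullet> h"
      using coset_rep[of "\<rho> \<bullet> g"] g s by auto
    then have "\<phi> (SOME x. x \<in> ?t C) = \<phi> (\<rho> \<bullet> g)" using t g s \<phi>(2)[of "\<rho> \<bullet> g" h] by simp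
    then show "\<phi> (SOME x. x \<in> ?t C) = \<phi> (\<rho> \<bullet> (SOME g. g \<in> C))" by (simp add: g_def)
  qed simp
  finally show ?thesis by simp
qed

lemma coset_sum_invariant:
  assumes "a \<in> Inv H" shows "coset_sum H (\<lambda>\<gamma>. \<gamma> a) \<in> Inv (carrier G)"
proof -
  have a: "a \<in> carrier A" using assms Inv_closed by blast
  have f: "(\<lambda>\<gamma>. \<gamma> a) \<in> carrier G \<rightarrow> carrier A" using a by auto
  have "\<rho> (coset_sum H (\<lambda>\<gamma>. \<gamma> a)) = coset_sum H (\<lambda>\<gamma>. \<gamma> a)" if s: "\<rho> \<in> carrier G" for \<rho>
  proof -
    have "\<rho> (coset_sum H (\<lambda>\<gamma>. \<gamma> a)) = coset_sum H (\<lambda>\<gamma>. \<rho> (\<gamma> a))" by (rule coset_sum_act[OF f s])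
    also have "\<dots> = coset_sum H (\<lambda>\<gamma>. (\<rho> \<bullet> \<gamma>) a)" using act_mult s a by (intro coset_sum_cong) auto
    also have "\<dots> = coset_sum H (\<lambda>\<gamma>. \<gamma> a)"
    proof (rule coset_sum_translate[OF f _ s])
      fix g h assume gh: "g \<in> carrier G" "h \<in> H"
      then show "(g \<bullet> h) a = g a"
        using act_mult[of g h a] Inv_fixed[OF assms gh(2)] H_sub a by (auto simp: subset_iff)
    qed
    finally show ?thesis .
  qed
  then show ?thesis using coset_sum_closed[OF f] by (simp add: Inv_def)
qed

end


section \<open>Norm polynomials\<close>

text \<open>The coefficients \<open>c j\<close> are those of \<open>\<Prod>\<^sub>h (T - h a)\<close>. They are invariant because \<open>H\<close> permutes the
  factors, and applying \<open>g\<close> to them replaces the roots \<open>h a\<close> by \<open>g (h a)\<close>.\<close>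

lemma norm_polynomial:
  assumes H: "subgroup H G" and a: "a \<in> carrier A"
  shows "\<exists>c (n::nat). (\<forall>j. c j \<in> Inv H) \<and> (\<forall>g\<in>carrier G. \<forall>t\<in>carrier A.
    (\<Otimes>h\<in>H. t \<ominus> g (h a)) = (\<Oplus>j\<in>{..n}. g (c j) \<otimes> t [^] j))"
proof -
  have Hs: "H \<subseteq> carrier G" by (rule subgroup.subset[OF H])
  interpret U: UP_cring A "UP A" by (intro UP_cring.intro is_cring) simp
  let ?U = "UP A"
  define T where "T = up_ring.monom ?U \<one> 1"
  have T: "T \<in> carrier ?U" by (simp add: T_def)
  define p where "p = (\<Otimes>\<^bsub>?U\<^esub>h\<in>H. T \<ominus>\<^bsub>?U\<^esub> up_ring.monom ?U (h a) 0)"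
  have pf: "(\<lambda>h. T \<ominus>\<^bsub>?U\<^esub> up_ring.monom ?U (h a) 0) \<in> H \<rightarrow> carrier ?U" using T a Hs by auto
  have p: "p \<in> carrier ?U" unfolding p_def using pf by (rule U.P.finprod_closed)
  define c where "c = up_ring.coeff ?U p"
  have c: "c j \<in> carrier A" for j using p by (simp add: c_def)
  have inv: "\<tau> (c j) = c j" if \<tau>: "\<tau> \<in> H" for \<tau> j
  proof -
    have \<tau>G: "\<tau> \<in> carrier G" using \<tau> Hs by blast
    \<comment> \<open>the map \<open>?e\<close> below applies \<open>\<tau>\<close> to the coefficients of a polynomial\<close>
    define m where "m r = up_ring.monom ?U (\<tau> r) 0" for r
    have "m \<in> ring_hom A ?U"
    proof (rule ring_hom_memI)
      fix x y assume xy: "x \<in> carrier A" "y \<in> carrier A"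
      then show "m x \<in> carrier ?U" "m (x \<oplus> y) = m x \<oplus>\<^bsub>?U\<^esub> m y" using \<tau>G by (simp_all add: m_def)
      show "m (x \<otimes> y) = m x \<otimes>\<^bsub>?U\<^esub> m y"
        using U.monom_mult[of "\<tau> x" "\<tau> y" 0 0] xy \<tau>G by (simp add: m_def)
    next
      show "m \<one> = \<one>\<^bsub>?U\<^esub>" using \<tau>G by (simp add: m_def)
    qed
    then have "ring_hom_cring A ?U m" by (intro UnivPoly.ring_hom_cringI) (auto intro: is_cring U.UP_cring)
    then interpret E: UP_pre_univ_prop A "UP A" m "UP A" by (simp add: UP_pre_univ_prop_def U.UP_cring_axioms)
    let ?e = "UnivPoly.eval A ?U m T"
    interpret e: ring_hom_cring "UP A" "UP A" ?e
      using E.eval_ring_hom[OF T] by (intro UnivPoly.ring_hom_cringI) (auto intro: U.UP_cring)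
    have eT: "?e T = T" unfolding T_def using E.eval_monom1[OF T[unfolded T_def]] .
    have ec: "?e (up_ring.monom ?U r 0) = up_ring.monom ?U (\<tau> r) 0" if "r \<in> carrier A" for r
      using E.eval_const[OF T that] by (simp add: m_def)
    have "?e p = (\<Otimes>\<^bsub>?U\<^esub>h\<in>H. (?e \<circ> (\<lambda>h. T \<ominus>\<^bsub>?U\<^esub> up_ring.monom ?U (h a) 0)) h)"
      unfolding p_def by (rule e.hom_finprod[OF pf])
    also have "\<dots> = (\<Otimes>\<^bsub>?U\<^esub>h\<in>H. T \<ominus>\<^bsub>?U\<^esub> up_ring.monom ?U ((\<tau> \<bullet> h) a) 0)"
      using T a Hs \<tau>G by (intro U.P.finprod_cong') (auto simp: eT ec act_mult subset_iff a_minus_def)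
    also have "\<dots> = (\<Otimes>\<^bsub>?U\<^esub>h\<in>(\<lambda>h. \<tau> \<bullet> h) ` H. T \<ominus>\<^bsub>?U\<^esub> up_ring.monom ?U (h a) 0)"
      using T a Hs \<tau>G by (intro U.P.finprod_reindex[symmetric]) (auto simp: inj_on_def subset_iff)
    also have "(\<lambda>h. \<tau> \<bullet> h) ` H = H" by (rule left_translation_image[OF H \<tau>])
    finally have ep: "?e p = p" unfolding p_def .
    have mono: "m (c i) \<otimes>\<^bsub>?U\<^esub> T [^]\<^bsub>?U\<^esub> i = up_ring.monom ?U (\<tau> (c i)) i" for i
      using U.monom_mult[of "\<tau> (c i)" "\<one>" 0 i] U.monom_pow[of "\<one>" 1 i] c \<tau>G
      by (simp add: m_def T_def)
    have "?e p = (\<Oplus>\<^bsub>?U\<^esub>i\<in>{..deg A p}. m (c i) \<otimes>\<^bsub>?U\<^esub> T [^]\<^bsub>?U\<^esub> i)"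
      using U.eval_on_carrier[OF p] by (simp add: c_def)
    then have "up_ring.coeff ?U p j = up_ring.coeff ?U (\<Oplus>\<^bsub>?U\<^esub>i\<in>{..deg A p}. up_ring.monom ?U (\<tau> (c i)) i) j"
      unfolding ep mono by simp
    also have "\<dots> = (\<Oplus>i\<in>{..deg A p}. up_ring.coeff ?U (up_ring.monom ?U (\<tau> (c i)) i) j)"
      using c \<tau>G by (intro U.coeff_finsum) auto
    also have "\<dots> = (\<Oplus>i\<in>{..deg A p}. if j = i then \<tau> (c i) else \<zero>)"
      using c \<tau>G by (intro finsum_cong') auto
    also have "\<dots> = (if j \<le> UnivPoly.deg A p then \<tau> (c j) else \<zero>)"
    proof (cases "j \<le> UnivPoly.deg A p")
      case True
      then show ?thesis using finsum_singleton[of j "{..deg A p}" "\<lambda>i. \<tau> (c i)"] c \<tau>G by simp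
    next
      case False
      then have "(\<Oplus>i\<in>{..UnivPoly.deg A p}. if j = i then \<tau> (c i) else \<zero>) = (\<Oplus>i\<in>{..UnivPoly.deg A p}. \<zero>)"
        by (intro finsum_cong') auto
      then show ?thesis using False by simp
    qed
    finally have *: "c j = (if j \<le> UnivPoly.deg A p then \<tau> (c j) else \<zero>)"
      unfolding c_def .
    show "\<tau> (c j) = c j"
    proof (cases "j \<le> UnivPoly.deg A p")
      case False
      then have "c j = \<zero>" using * by argo
      then show ?thesis using \<tau>G by simp
    qed (use * in argo)
  qed
  have ev: "(\<Otimes>h\<in>H. t \<ominus> g (h a)) = (\<Oplus>j\<in>{..deg A p}. g (c j) \<otimes> t [^] j)"
    if g: "g \<in> carrier G" and t: "t \<in> carrier A" for g t
  proof -
    interpret E: UP_pre_univ_prop A A g "UP A"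
      by (simp add: UP_pre_univ_prop_def U.UP_cring_axioms act_ring_hom[OF g])
    let ?e = "UnivPoly.eval A A g t"
    interpret e: ring_hom_cring "UP A" A ?e
      using E.eval_ring_hom[OF t] by (intro UnivPoly.ring_hom_cringI) (auto intro: U.UP_cring is_cring)
    have eT: "?e T = t" unfolding T_def using E.eval_monom1[OF t] .
    have ec: "?e (up_ring.monom ?U r 0) = g r" if "r \<in> carrier A" for r
      using E.eval_const[OF t that] .
    have "?e p = (\<Otimes>h\<in>H. (?e \<circ> (\<lambda>h. T \<ominus>\<^bsub>?U\<^esub> up_ring.monom ?U (h a) 0)) h)"
      unfolding p_def by (rule e.hom_finprod[OF pf])
    also have "\<dots> = (\<Otimes>h\<in>H. t \<ominus> g (h a))"
      using T t a Hs g by (intro finprod_cong') (auto simp: eT ec subset_iff a_minus_def)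
    finally show ?thesis using U.eval_on_carrier[OF p, of A g t] by (simp add: c_def)
  qed
  show ?thesis
    by (rule exI[of _ c], rule exI[of _ "UnivPoly.deg A p"]) (use inv c ev in \<open>auto simp: Inv_def\<close>)
qed

end

lemma (in primeideal) finprod_mem:
  assumes "finite S" "f \<in> S \<rightarrow> carrier R" "i \<in> S" "f i \<in> I"
  shows "(\<Otimes>j\<in>S. f j) \<in> I"
proof -
  have "(\<Otimes>j\<in>insert i (S - {i}). f j) = f i \<otimes> (\<Otimes>j\<in>S - {i}. f j)"
    using assms by (intro finprod_insert) auto
  moreover have "insert i (S - {i}) = S" using assms by blast
  moreover have "(\<Otimes>j\<in>S - {i}. f j) \<in> carrier R" using assms by (intro finprod_closed) auto
  ultimately show ?thesis using I_r_closed assms by simp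
qed

lemma (in primeideal) finprod_not_mem:
  assumes "finite S" "f \<in> S \<rightarrow> carrier R" "\<And>i. i \<in> S \<Longrightarrow> f i \<notin> I"
  shows "(\<Otimes>j\<in>S. f j) \<notin> I"
  using assms
proof (induction S)
  case empty
  then show ?case using I_notcarr one_imp_carrier by auto
next
  case (insert i S)
  have "(\<Otimes>j\<in>insert i S. f j) = f i \<otimes> (\<Otimes>j\<in>S. f j)" using insert by (intro finprod_insert) auto
  moreover have "(\<Otimes>j\<in>S. f j) \<in> carrier R" using insert by (intro finprod_closed) auto
  ultimately show ?case using I_prime[of "f i" "\<Otimes>j\<in>S. f j"] insert by auto
qed

context faithful_ring_action
begin

section \<open>Separating the inertia group\<close>

text \<open>Members are restricted to the group, so that functions with the same values on the group are equal.\<close>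

inductive_set orbit_span :: "('a \<Rightarrow> 'a) set \<Rightarrow> (('a \<Rightarrow> 'a) \<Rightarrow> 'a) set" for I where
  base: "t \<in> carrier A \<Longrightarrow> s \<in> Inv I \<Longrightarrow> (\<lambda>g\<in>carrier G. t \<otimes> g s) \<in> orbit_span I"
| add: "\<phi> \<in> orbit_span I \<Longrightarrow> \<psi> \<in> orbit_span I \<Longrightarrow> (\<lambda>g\<in>carrier G. \<phi> g \<oplus> \<psi> g) \<in> orbit_span I"

lemma orbit_span_closed: "\<psi> \<in> orbit_span I \<Longrightarrow> g \<in> carrier G \<Longrightarrow> \<psi> g \<in> carrier A"
  by (induction rule: orbit_span.induct) (auto dest: Inv_closed)

lemma orbit_span_one:
  assumes "I \<subseteq> carrier G" shows "(\<lambda>g\<in>carrier G. \<one>) \<in> orbit_span I"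
proof -
  have "(\<lambda>g\<in>carrier G. \<one>) = (\<lambda>g\<in>carrier G. \<one> \<otimes> g \<one>)" by (auto simp: fun_eq_iff)
  then show ?thesis using orbit_span.base[of \<one> \<one> I] Inv_one[OF assms] by simp
qed

text \<open>For \<open>y = \<gamma> x\<close> the additional factor vanishes at \<open>\<gamma>\<close>; this is how functions with small support are
  produced.\<close>

lemma orbit_span_mult_diff:
  assumes I: "I \<subseteq> carrier G" and x: "x \<in> Inv I" and y: "y \<in> carrier A" and \<psi>: "\<psi> \<in> orbit_span I"
  shows "(\<lambda>g\<in>carrier G. \<psi> g \<otimes> (g x \<ominus> y)) \<in> orbit_span I"
  using \<psi>
proof induction
  case (base t s)
  have sc: "s \<in> carrier A" "x \<in> carrier A" using base x Inv_closed by auto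
  have eq: "(\<lambda>g\<in>carrier G. (\<lambda>g\<in>carrier G. t \<otimes> g s) g \<otimes> (g x \<ominus> y))
      = (\<lambda>g\<in>carrier G. (\<lambda>g\<in>carrier G. t \<otimes> g (s \<otimes> x)) g \<oplus> (\<lambda>g\<in>carrier G. \<ominus> (t \<otimes> y) \<otimes> g s) g)"
  proof (rule restrict_ext)
    fix g assume g: "g \<in> carrier G"
    have c: "g s \<in> carrier A" "g x \<in> carrier A" using g sc by auto
    have "t \<otimes> g s \<otimes> (g x \<ominus> y) = t \<otimes> (g s \<otimes> g x) \<oplus> \<ominus> (t \<otimes> y) \<otimes> g s"
      using c base(1) y by algebra
    then show "(\<lambda>g\<in>carrier G. t \<otimes> g s) g \<otimes> (g x \<ominus> y)
        = (\<lambda>g\<in>carrier G. t \<otimes> g (s \<otimes> x)) g \<oplus> (\<lambda>g\<in>carrier G. \<ominus> (t \<otimes> y) \<otimes> g s) g"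
      using g sc by simp
  qed
  have 1: "(\<lambda>g\<in>carrier G. t \<otimes> g (s \<otimes> x)) \<in> orbit_span I"
    using base Inv_mult[OF I _ x] by (intro orbit_span.base) auto
  have 2: "(\<lambda>g\<in>carrier G. \<ominus> (t \<otimes> y) \<otimes> g s) \<in> orbit_span I"
    using base y by (intro orbit_span.base) auto
  show ?case unfolding eq by (rule orbit_span.add[OF 1 2])
next
  case (add \<phi> \<psi>)
  have eq: "(\<lambda>g\<in>carrier G. (\<lambda>g\<in>carrier G. \<phi> g \<oplus> \<psi> g) g \<otimes> (g x \<ominus> y))
      = (\<lambda>g\<in>carrier G. (\<lambda>g\<in>carrier G. \<phi> g \<otimes> (g x \<ominus> y)) g \<oplus> (\<lambda>g\<in>carrier G. \<psi> g \<otimes> (g x \<ominus> y)) g)"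
    using orbit_span_closed[OF add(1)] orbit_span_closed[OF add(2)] Inv_closed[OF x] y
    by (intro restrict_ext) (simp add: l_distr)
  show ?case unfolding eq by (rule orbit_span.add[OF add.IH])
qed

lemma orbit_span_invariant:
  assumes I: "subgroup I G" and \<psi>: "\<psi> \<in> orbit_span I" and g: "g \<in> carrier G" and h: "h \<in> I"
  shows "\<psi> (g \<bullet> h) = \<psi> g"
  using \<psi>
proof induction
  case (base t s)
  have "h \<in> carrier G" using h subgroup.subset[OF I] by blast
  moreover have "h s = s" using Inv_fixed base h by blast
  ultimately show ?case using g act_mult[of g h s] Inv_closed[OF base(2)] by simp
next
  case (add \<phi> \<psi>)
  have "h \<in> carrier G" using h subgroup.subset[OF I] by blast
  then show ?case using g add by simp
qed

lemma inertia_subgroup: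
  assumes P: "ideal P A" shows "subgroup (inertia_group A (carrier G) P) G"
proof (rule G.subgroupI)
  interpret P: ideal P A by (rule P)
  let ?I = "inertia_group A (carrier G) P"
  show "?I \<subseteq> carrier G" by (auto simp: inertia_group_def)
  have "\<one>\<^bsub>G\<^esub> \<in> ?I" using P.zero_closed by (auto simp: inertia_group_def act_one a_minus_def r_neg)
  then show "?I \<noteq> {}" by blast
  fix \<rho> assume r: "\<rho> \<in> ?I"
  then have rG: "\<rho> \<in> carrier G" by (auto simp: inertia_group_def)
  have "inv_G \<rho> a \<ominus> a \<in> P" if a: "a \<in> carrier A" for a
  proof -
    have "inv_G \<rho> a \<in> carrier A" using a rG by simp
    then have "\<rho> (inv_G \<rho> a) \<ominus> inv_G \<rho> a \<in> P" using r unfolding inertia_group_def by blast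
    then have "\<ominus> (a \<ominus> inv_G \<rho> a) \<in> P" using a rG by (simp add: P.a_inv_closed)
    moreover have "\<ominus> (a \<ominus> inv_G \<rho> a) = inv_G \<rho> a \<ominus> a"
      using a act_closed[of "inv_G \<rho>" a] rG by (simp add: a_minus_def minus_add a_comm)
    ultimately show ?thesis by simp
  qed
  then show "inv_G \<rho> \<in> ?I" using rG by (auto simp: inertia_group_def)
  fix \<tau> assume t: "\<tau> \<in> ?I"
  then have tG: "\<tau> \<in> carrier G" by (auto simp: inertia_group_def)
  have "(\<rho> \<bullet> \<tau>) a \<ominus> a \<in> P" if a: "a \<in> carrier A" for a
  proof -
    have "\<rho> (\<tau> a) \<ominus> \<tau> a \<in> P" "\<tau> a \<ominus> a \<in> P" using r t a tG by (auto simp: inertia_group_def)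
    then have "(\<rho> (\<tau> a) \<ominus> \<tau> a) \<oplus> (\<tau> a \<ominus> a) \<in> P" by simp
    moreover have "\<rho> (\<tau> a) \<in> carrier A" "\<tau> a \<in> carrier A" using a rG tG by auto
    then have "(\<rho> (\<tau> a) \<ominus> \<tau> a) \<oplus> (\<tau> a \<ominus> a) = \<rho> (\<tau> a) \<ominus> a" using a by algebra
    ultimately show ?thesis using act_mult[OF rG tG a] by simp
  qed
  then show "\<rho> \<bullet> \<tau> \<in> ?I" using rG tG by (auto simp: inertia_group_def)
qed

text \<open>If \<open>\<gamma>\<close> fixes all inertia invariants modulo \<open>P\<close>, then the norm polynomial of \<open>a\<close> over the inertia group
  and its image under \<open>\<gamma>\<close> agree modulo \<open>P\<close>. Evaluation at \<open>0\<close> shows that \<open>\<gamma>\<close> stabilizes \<open>P\<close>. Evaluation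
  at \<open>a\<close> then shows that \<open>\<gamma> a - a\<close> lies in \<open>P\<close>, because all factors are congruent to \<open>a - \<gamma> a\<close>.\<close>

lemma inertia_invariant_moved:
  assumes P: "primeideal P A" and \<gamma>: "\<gamma> \<in> carrier G" "\<gamma> \<notin> inertia_group A (carrier G) P"
  shows "\<exists>s\<in>Inv (inertia_group A (carrier G) P). \<gamma> s \<ominus> s \<notin> P"
proof (rule ccontr)
  interpret P: primeideal P A by (rule P)
  define I where "I = inertia_group A (carrier G) P"
  assume "\<not> ?thesis"
  then have fixed: "\<And>s. s \<in> Inv I \<Longrightarrow> \<gamma> s \<ominus> s \<in> P" by (auto simp: I_def)
  have I: "subgroup I G" unfolding I_def by (rule inertia_subgroup) (rule P.is_ideal)
  have IG: "I \<subseteq> carrier G" by (rule subgroup.subset[OF I])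
  have finI: "finite I" using IG finite_group finite_subset by blast
  have oneI: "\<one>\<^bsub>G\<^esub> \<in> I" by (rule subgroup.one_closed[OF I])
  have I_act: "h a \<ominus> a \<in> P" if "h \<in> I" "a \<in> carrier A" for h a using that by (auto simp: I_def inertia_group_def)
  have sub_mem: "x \<in> P \<longleftrightarrow> y \<in> P" if "x \<in> carrier A" "y \<in> carrier A" "x \<ominus> y \<in> P" for x y
  proof
    assume "y \<in> P"
    then have "(x \<ominus> y) \<oplus> y \<in> P" using that by simp
    moreover have "(x \<ominus> y) \<oplus> y = x" using that(1,2) by algebra
    ultimately show "x \<in> P" by simp
  next
    assume "x \<in> P"
    then have "x \<oplus> \<ominus> (x \<ominus> y) \<in> P" using that by simp
    moreover have "x \<oplus> \<ominus> (x \<ominus> y) = y" using that(1,2) by algebra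
    ultimately show "y \<in> P" by simp
  qed
  \<comment> \<open>the two products are values of polynomials whose coefficients are \<open>\<gamma> (c j)\<close> and \<open>c j\<close>\<close>
  have norm_iff: "(\<Otimes>h\<in>I. t \<ominus> \<gamma> (h a)) \<in> P \<longleftrightarrow> (\<Otimes>h\<in>I. t \<ominus> h a) \<in> P"
    if a: "a \<in> carrier A" and t: "t \<in> carrier A" for a t
  proof -
    obtain c and n :: nat where c: "\<And>j. c j \<in> Inv I"
      and ev: "\<And>g t. g \<in> carrier G \<Longrightarrow> t \<in> carrier A \<Longrightarrow> (\<Otimes>h\<in>I. t \<ominus> g (h a)) = (\<Oplus>j\<in>{..n}. g (c j) \<otimes> t [^] j)"
      using norm_polynomial[OF I a] by blast
    have cc: "c j \<in> carrier A" for j using c Inv_closed by blast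
    have 1: "(\<Otimes>h\<in>I. t \<ominus> h a) = (\<Oplus>j\<in>{..n}. c j \<otimes> t [^] j)"
    proof -
      have "(\<Otimes>h\<in>I. t \<ominus> h a) = (\<Otimes>h\<in>I. t \<ominus> \<one>\<^bsub>G\<^esub> (h a))"
        using a t IG by (intro finprod_cong') (auto simp: act_one subset_iff)
      also have "\<dots> = (\<Oplus>j\<in>{..n}. \<one>\<^bsub>G\<^esub> (c j) \<otimes> t [^] j)" using ev t by simp
      also have "\<dots> = (\<Oplus>j\<in>{..n}. c j \<otimes> t [^] j)" using cc t by (intro finsum_cong') (auto simp: act_one)
      finally show ?thesis .
    qed
    have diff: "(\<Oplus>j\<in>S. \<gamma> (c j) \<otimes> t [^] j) \<ominus> (\<Oplus>j\<in>S. c j \<otimes> t [^] j) \<in> P" if "finite S" for S :: "nat set"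
      using that
    proof (induction S)
      case empty
      then show ?case by (simp add: a_minus_def r_neg)
    next
      case (insert j S)
      let ?x = "\<Oplus>j\<in>S. \<gamma> (c j) \<otimes> t [^] j" and ?y = "\<Oplus>j\<in>S. c j \<otimes> t [^] j"
      have x: "?x \<in> carrier A" "?y \<in> carrier A" using cc t \<gamma>(1) by (auto intro!: finsum_closed)
      have z: "\<gamma> (c j) \<in> carrier A" "c j \<in> carrier A" "t [^] j \<in> carrier A" using cc t \<gamma>(1) by auto
      have "(\<Oplus>j\<in>insert j S. \<gamma> (c j) \<otimes> t [^] j) \<ominus> (\<Oplus>j\<in>insert j S. c j \<otimes> t [^] j)
          = (\<gamma> (c j) \<otimes> t [^] j \<oplus> ?x) \<ominus> (c j \<otimes> t [^] j \<oplus> ?y)"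
        using insert cc t \<gamma>(1) by (simp add: Pi_def)
      also have "\<dots> = (\<gamma> (c j) \<ominus> c j) \<otimes> t [^] j \<oplus> (?x \<ominus> ?y)"
      proof -
        have "(u \<otimes> w \<oplus> x) \<ominus> (v \<otimes> w \<oplus> y) = (u \<ominus> v) \<otimes> w \<oplus> (x \<ominus> y)"
          if "u \<in> carrier A" "v \<in> carrier A" "w \<in> carrier A" "x \<in> carrier A" "y \<in> carrier A" for u v w x y
          using that by algebra
        from this[OF z x] show ?thesis .
      qed
      finally show ?case using insert.IH fixed[OF c[of j]] P.I_r_closed z by simp
    qed
    have "(\<Otimes>h\<in>I. t \<ominus> \<gamma> (h a)) \<ominus> (\<Otimes>h\<in>I. t \<ominus> h a) \<in> P"
      unfolding 1 ev[OF \<gamma>(1) t] using diff[of "{..n}"] by simp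
    then show ?thesis using a t \<gamma>(1) IG by (intro sub_mem finprod_closed) auto
  qed
  have pull: "a \<in> P" if a: "a \<in> carrier A" "\<gamma> a \<in> P" for a
  proof (rule ccontr)
    assume no: "a \<notin> P"
    have "\<zero> \<ominus> \<gamma> (\<one>\<^bsub>G\<^esub> a) \<in> P" using a \<gamma>(1) by (simp add: act_one a_minus_def)
    then have "(\<Otimes>h\<in>I. \<zero> \<ominus> \<gamma> (h a)) \<in> P" using finI oneI a \<gamma>(1) IG by (intro P.finprod_mem[of I _ "\<one>\<^bsub>G\<^esub>"]) auto
    then have "(\<Otimes>h\<in>I. \<zero> \<ominus> h a) \<in> P" using norm_iff a by simp
    moreover have "\<zero> \<ominus> h a \<notin> P" if h: "h \<in> I" for h
    proof
      assume m: "\<zero> \<ominus> h a \<in> P"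
      have ha: "h a \<in> carrier A" using h IG a by auto
      have "\<ominus> (\<zero> \<ominus> h a) \<in> P" using m by (rule P.a_inv_closed)
      moreover have "\<ominus> (\<zero> \<ominus> h a) = h a" using ha by algebra
      ultimately have "h a \<in> P" by simp
      then show False using sub_mem[OF ha a(1) I_act[OF h a(1)]] no by simp
    qed
    then have "(\<Otimes>h\<in>I. \<zero> \<ominus> h a) \<notin> P" using finI a IG by (intro P.finprod_not_mem) auto
    ultimately show False by simp
  qed
  have pull_pow: "a \<in> P" if "a \<in> carrier A" "(\<gamma> [^]\<^bsub>G\<^esub> (n::nat)) a \<in> P" for a n
    using that
  proof (induction n arbitrary: a)
    case 0
    then show ?case by (simp add: act_one)
  next
    case (Suc n)
    have "(\<gamma> [^]\<^bsub>G\<^esub> n) (\<gamma> a) \<in> P"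
      using \<gamma>(1) act_mult[of "\<gamma> [^]\<^bsub>G\<^esub> n" \<gamma> a] Suc.prems by simp
    then have "\<gamma> a \<in> P" using Suc.IH[OF act_closed[OF \<gamma>(1) Suc.prems(1)]] by blast
    then show ?case using pull Suc.prems(1) by blast
  qed
  have push: "\<gamma> a \<in> P" if a: "a \<in> P" for a
  proof -
    have ac: "a \<in> carrier A" using a P.Icarr by blast
    obtain m where m: "order G = Suc m" using G.order_gt_0_iff_finite finite_group gr0_implies_Suc by blast
    have "a = (\<gamma> [^]\<^bsub>G\<^esub> Suc m) a" using G.pow_order_eq_1[OF \<gamma>(1)] ac unfolding m by (simp add: act_one)
    also have "\<dots> = (\<gamma> [^]\<^bsub>G\<^esub> m) (\<gamma> a)" using \<gamma>(1) ac by (simp add: act_mult)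
    finally show ?thesis using pull_pow[of "\<gamma> a" m] a ac \<gamma>(1) by simp
  qed
  obtain a where a: "a \<in> carrier A" "\<gamma> a \<ominus> a \<notin> P" using \<gamma> by (auto simp: inertia_group_def)
  have "a \<ominus> \<one>\<^bsub>G\<^esub> a \<in> P" using a by (simp add: act_one a_minus_def r_neg)
  then have "(\<Otimes>h\<in>I. a \<ominus> h a) \<in> P" using finI oneI a IG by (intro P.finprod_mem[of I _ "\<one>\<^bsub>G\<^esub>"]) auto
  then have "(\<Otimes>h\<in>I. a \<ominus> \<gamma> (h a)) \<in> P" using norm_iff a by simp
  moreover have "a \<ominus> \<gamma> (h a) \<notin> P" if h: "h \<in> I" for h
  proof
    assume m: "a \<ominus> \<gamma> (h a) \<in> P"
    have c: "h a \<in> carrier A" "\<gamma> (h a) \<in> carrier A" "\<gamma> a \<in> carrier A" using h IG a \<gamma>(1) by auto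
    have "\<gamma> (h a \<ominus> a) \<in> P" by (rule push[OF I_act[OF h a(1)]])
    then have "\<gamma> (h a) \<ominus> \<gamma> a \<in> P" using c a \<gamma>(1) by simp
    then have "\<ominus> ((a \<ominus> \<gamma> (h a)) \<oplus> (\<gamma> (h a) \<ominus> \<gamma> a)) \<in> P" using m by simp
    moreover have "\<ominus> ((a \<ominus> \<gamma> (h a)) \<oplus> (\<gamma> (h a) \<ominus> \<gamma> a)) = \<gamma> a \<ominus> a" using c a(1) by algebra
    ultimately show False using a by simp
  qed
  then have "(\<Otimes>h\<in>I. a \<ominus> \<gamma> (h a)) \<notin> P" using finI a IG \<gamma>(1) by (intro P.finprod_not_mem) auto
  ultimately show False by simp
qed

text \<open>The expression of the fact that \<open>A\<^sup>I\<close> is unramified over \<open>A\<^sup>G\<close> at \<open>P\<close>: multiply one factor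
  \<open>g s - \<gamma> s\<close> for each \<open>\<gamma>\<close> outside \<open>I\<close>, with \<open>s\<close> moved by \<open>\<gamma>\<close> modulo \<open>P\<close>.\<close>

lemma inertia_separator:
  assumes P: "primeideal P A"
  defines "I \<equiv> inertia_group A (carrier G) P"
  shows "\<exists>\<psi>\<in>orbit_span I. \<psi> \<one>\<^bsub>G\<^esub> \<notin> P \<and> (\<forall>g\<in>carrier G - I. \<psi> g = \<zero>)"
proof -
  interpret P: primeideal P A by (rule P)
  have I: "subgroup I G" unfolding I_def by (rule inertia_subgroup) (rule P.is_ideal)
  have IG: "I \<subseteq> carrier G" by (rule subgroup.subset[OF I])
  have "\<exists>\<psi>\<in>orbit_span I. \<psi> \<one>\<^bsub>G\<^esub> \<notin> P \<and> (\<forall>g\<in>S. \<psi> g = \<zero>)"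
    if "finite S" "S \<subseteq> carrier G - I" for S
    using that
  proof (induction S)
    case empty
    have "\<one> \<notin> P" using P.I_notcarr P.one_imp_carrier by auto
    then show ?case using orbit_span_one[OF IG] by (intro bexI[of _ "\<lambda>g\<in>carrier G. \<one>"]) auto
  next
    case (insert \<gamma> S)
    then obtain \<psi> where \<psi>: "\<psi> \<in> orbit_span I" "\<psi> \<one>\<^bsub>G\<^esub> \<notin> P" "\<forall>g\<in>S. \<psi> g = \<zero>" by blast
    have \<gamma>: "\<gamma> \<in> carrier G" "\<gamma> \<notin> I" using insert by auto
    obtain s where s: "s \<in> Inv I" "\<gamma> s \<ominus> s \<notin> P"
      using inertia_invariant_moved[OF P \<gamma>(1)] \<gamma>(2) unfolding I_def by blast
    have sc: "s \<in> carrier A" "\<gamma> s \<in> carrier A" using s \<gamma> Inv_closed by auto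
    define \<phi> where "\<phi> = (\<lambda>g\<in>carrier G. \<psi> g \<otimes> (g s \<ominus> \<gamma> s))"
    have "\<phi> \<in> orbit_span I" unfolding \<phi>_def by (rule orbit_span_mult_diff[OF IG s(1) sc(2) \<psi>(1)])
    moreover have "\<phi> g = \<zero>" if "g \<in> insert \<gamma> S" for g
      using that \<psi>(3) insert.prems sc orbit_span_closed[OF \<psi>(1)] by (auto simp: \<phi>_def a_minus_def r_neg)
    moreover have "\<phi> \<one>\<^bsub>G\<^esub> \<notin> P"
    proof
      assume "\<phi> \<one>\<^bsub>G\<^esub> \<in> P"
      then have "\<psi> \<one>\<^bsub>G\<^esub> \<otimes> (s \<ominus> \<gamma> s) \<in> P" using sc by (simp add: \<phi>_def act_one)
      then have "s \<ominus> \<gamma> s \<in> P" using P.I_prime[of "\<psi> \<one>\<^bsub>G\<^esub>" "s \<ominus> \<gamma> s"] \<psi> sc orbit_span_closed[OF \<psi>(1)] by auto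
      then have "\<ominus> (s \<ominus> \<gamma> s) \<in> P" by (rule P.a_inv_closed)
      moreover have "\<ominus> (s \<ominus> \<gamma> s) = \<gamma> s \<ominus> s" using sc by algebra
      ultimately show False using s by simp
    qed
    ultimately show ?case by blast
  qed
  then show ?thesis using finite_group by blast
qed

lemma inertia_zero_ideal: "inertia_group A (carrier G) {\<zero>} = {\<one>\<^bsub>G\<^esub>}"
proof
  show "{\<one>\<^bsub>G\<^esub>} \<subseteq> inertia_group A (carrier G) {\<zero>}"
    by (auto simp: inertia_group_def act_one a_minus_def r_neg)
  show "inertia_group A (carrier G) {\<zero>} \<subseteq> {\<one>\<^bsub>G\<^esub>}"
  proof
    fix \<rho> assume "\<rho> \<in> inertia_group A (carrier G) {\<zero>}"
    then have r: "\<rho> \<in> carrier G" "\<And>a. a \<in> carrier A \<Longrightarrow> \<rho> a \<ominus> a = \<zero>" by (auto simp: inertia_group_def)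
    then have "\<rho> a = a" if "a \<in> carrier A" for a using that r_right_minus_eq[of "\<rho> a" a] by simp
    then show "\<rho> \<in> {\<one>\<^bsub>G\<^esub>}" using faithful r by blast
  qed
qed

text \<open>For nonzero \<open>\<delta>\<close> the hypothesis says that \<open>c/\<delta>\<close> has integral traces against \<open>A\<^sup>I\<close>. It extends from the functions
  \<open>g \<mapsto> g s\<close> to their span.\<close>

lemma coset_sum_orbit_span_dvd:
  assumes I: "subgroup I G" and c: "c \<in> Inv I" and \<delta>: "\<delta> \<in> carrier A" and \<psi>: "\<psi> \<in> orbit_span I"
    and dvd: "\<And>s. s \<in> Inv I \<Longrightarrow> \<exists>r\<in>carrier A. coset_sum I (\<lambda>\<gamma>. \<gamma> (s \<otimes> c)) = \<delta> \<otimes> r"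
  shows "\<exists>r\<in>carrier A. coset_sum I (\<lambda>\<gamma>. \<psi> \<gamma> \<otimes> \<gamma> c) = \<delta> \<otimes> r"
  using \<psi>
proof induction
  case (base t s)
  have cc: "c \<in> carrier A" "s \<in> carrier A" using c base Inv_closed by auto
  obtain r where r: "r \<in> carrier A" "coset_sum I (\<lambda>\<gamma>. \<gamma> (s \<otimes> c)) = \<delta> \<otimes> r" using dvd base by blast
  have "coset_sum I (\<lambda>\<gamma>. (\<lambda>g\<in>carrier G. t \<otimes> g s) \<gamma> \<otimes> \<gamma> c) = coset_sum I (\<lambda>\<gamma>. t \<otimes> \<gamma> (s \<otimes> c))"
    using base cc by (intro coset_sum_cong[OF I]) (auto simp: m_assoc)
  also have "\<dots> = t \<otimes> (\<delta> \<otimes> r)" unfolding r(2)[symmetric] using base cc by (intro coset_sum_smult[OF I]) auto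
  also have "\<dots> = \<delta> \<otimes> (t \<otimes> r)" using base(1) r(1) \<delta> by algebra
  finally show ?case using base r by blast
next
  case (add \<phi> \<psi>)
  then obtain r r' where r: "r \<in> carrier A" "coset_sum I (\<lambda>\<gamma>. \<phi> \<gamma> \<otimes> \<gamma> c) = \<delta> \<otimes> r"
    "r' \<in> carrier A" "coset_sum I (\<lambda>\<gamma>. \<psi> \<gamma> \<otimes> \<gamma> c) = \<delta> \<otimes> r'" by blast
  have cc: "c \<in> carrier A" using c Inv_closed by auto
  note cl = orbit_span_closed[OF add(1)] orbit_span_closed[OF add(2)]
  have "coset_sum I (\<lambda>\<gamma>. (\<lambda>g\<in>carrier G. \<phi> g \<oplus> \<psi> g) \<gamma> \<otimes> \<gamma> c)
      = coset_sum I (\<lambda>\<gamma>. \<phi> \<gamma> \<otimes> \<gamma> c \<oplus> \<psi> \<gamma> \<otimes> \<gamma> c)"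
    using cc cl by (intro coset_sum_cong[OF I]) (auto simp: l_distr)
  also have "\<dots> = \<delta> \<otimes> r \<oplus> \<delta> \<otimes> r'" unfolding r(2,4)[symmetric]
    using cc cl by (intro coset_sum_add[OF I]) auto
  also have "\<dots> = \<delta> \<otimes> (r \<oplus> r')" using r \<delta> by (simp add: r_distr)
  finally show ?case using r by blast
qed

text \<open>For nonzero \<open>\<delta>\<close>, pairing \<open>c/\<delta>\<close> with a function supported on \<open>I\<close> leaves the single term \<open>d (c/\<delta>)\<close>. Thus an element of
  the inverse different of \<open>A\<^sup>I\<close> over \<open>A\<^sup>G\<close> is integral at \<open>P\<close>. For \<open>P = 0\<close> and \<open>\<delta> = 0\<close> the lemma says that
  the trace form is nondegenerate.\<close>

lemma separator_dvd:
  assumes P: "primeideal P A" and c: "c \<in> Inv (inertia_group A (carrier G) P)" and \<delta>: "\<delta> \<in> carrier A"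
    and dvd: "\<And>s. s \<in> Inv (inertia_group A (carrier G) P) \<Longrightarrow>
      \<exists>r\<in>carrier A. coset_sum (inertia_group A (carrier G) P) (\<lambda>\<gamma>. \<gamma> (s \<otimes> c)) = \<delta> \<otimes> r"
  shows "\<exists>d\<in>carrier A - P. \<exists>r\<in>carrier A. d \<otimes> c = \<delta> \<otimes> r"
proof -
  define I where "I = inertia_group A (carrier G) P"
  have I: "subgroup I G" unfolding I_def using P by (intro inertia_subgroup primeideal.axioms)
  have IG: "I \<subseteq> carrier G" by (rule subgroup.subset[OF I])
  obtain \<psi> where \<psi>: "\<psi> \<in> orbit_span I" "\<psi> \<one>\<^bsub>G\<^esub> \<notin> P" "\<forall>g\<in>carrier G - I. \<psi> g = \<zero>"
    using inertia_separator[OF P] unfolding I_def by blast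
  note cl = orbit_span_closed[OF \<psi>(1)]
  have cc: "c \<in> carrier A" using c Inv_closed by auto
  obtain r where r: "r \<in> carrier A" "coset_sum I (\<lambda>\<gamma>. \<psi> \<gamma> \<otimes> \<gamma> c) = \<delta> \<otimes> r"
    using coset_sum_orbit_span_dvd[OF I c[folded I_def] \<delta> \<psi>(1) dvd[folded I_def]] by blast
  have "coset_sum I (\<lambda>\<gamma>. \<psi> \<gamma> \<otimes> \<gamma> c) = \<psi> \<one>\<^bsub>G\<^esub> \<otimes> \<one>\<^bsub>G\<^esub> c"
  proof (rule coset_sum_eq_at_one[OF I])
    fix g h assume g: "g \<in> carrier G" and h: "h \<in> I"
    have "(g \<bullet> h) c = g c" using act_mult[of g h c] g h IG cc Inv_fixed[OF c[folded I_def] h] by auto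
    then show "\<psi> (g \<bullet> h) \<otimes> (g \<bullet> h) c = \<psi> g \<otimes> g c" using orbit_span_invariant[OF I \<psi>(1) g h] by simp
  qed (use cl cc \<psi> in auto)
  then have "\<psi> \<one>\<^bsub>G\<^esub> \<otimes> c = \<delta> \<otimes> r" using r cc by (simp add: act_one)
  then show ?thesis using \<psi>(2) cl r by blast
qed

end

section \<open>Linear combinations\<close>

context cring
begin

definition coeffs :: "'a set \<Rightarrow> 'a set \<Rightarrow> ('a \<Rightarrow> 'a) set" where
  "coeffs B M = {c \<in> B \<rightarrow> M. finite {b \<in> B. c b \<noteq> \<zero>}}"

text \<open>A basis of a free graded extension is not assumed to be finite, so sums run over the support of the
  coefficients; the sum over an infinite index set would be zero by convention.\<close>

definition lincomb :: "'a set \<Rightarrow> ('a \<Rightarrow> 'a) \<Rightarrow> ('a \<Rightarrow> 'a) \<Rightarrow> 'a" where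
  "lincomb B c v = (\<Oplus>b\<in>{b \<in> B. c b \<noteq> \<zero>}. c b \<otimes> v b)"

lemma coeffs_mem: "c \<in> coeffs B M \<Longrightarrow> b \<in> B \<Longrightarrow> c b \<in> M"
  by (auto simp: coeffs_def)

lemma coeffs_mono: "M \<subseteq> N \<Longrightarrow> c \<in> coeffs B M \<Longrightarrow> c \<in> coeffs B N"
  by (auto simp: coeffs_def)

lemma coeffs_map:
  assumes "c \<in> coeffs B M" "\<And>b. b \<in> B \<Longrightarrow> d b \<in> N" "\<And>b. b \<in> B \<Longrightarrow> c b = \<zero> \<Longrightarrow> d b = \<zero>"
  shows "d \<in> coeffs B N"
proof -
  have "{b \<in> B. d b \<noteq> \<zero>} \<subseteq> {b \<in> B. c b \<noteq> \<zero>}" using assms(3) by auto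
  then show ?thesis using assms finite_subset unfolding coeffs_def by blast
qed

lemma coeffs_add:
  assumes "c \<in> coeffs B (carrier R)" "d \<in> coeffs B (carrier R)" "\<And>b. b \<in> B \<Longrightarrow> c b \<oplus> d b \<in> M"
  shows "(\<lambda>b. c b \<oplus> d b) \<in> coeffs B M"
proof -
  have "{b \<in> B. c b \<oplus> d b \<noteq> \<zero>} \<subseteq> {b \<in> B. c b \<noteq> \<zero>} \<union> {b \<in> B. d b \<noteq> \<zero>}" by auto
  moreover have "finite ({b \<in> B. c b \<noteq> \<zero>} \<union> {b \<in> B. d b \<noteq> \<zero>})" using assms by (auto simp: coeffs_def)
  ultimately have "finite {b \<in> B. c b \<oplus> d b \<noteq> \<zero>}" by (rule finite_subset)
  then show ?thesis using assms(3) by (auto simp: coeffs_def)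
qed

lemma lincomb_eq:
  assumes "finite F" "{b \<in> B. c b \<noteq> \<zero>} \<subseteq> F" "F \<subseteq> B" "c \<in> B \<rightarrow> carrier R" "v \<in> B \<rightarrow> carrier R"
  shows "lincomb B c v = (\<Oplus>b\<in>F. c b \<otimes> v b)"
proof -
  have "(\<Oplus>b\<in>F. c b \<otimes> v b) = (\<Oplus>b\<in>{b \<in> B. c b \<noteq> \<zero>}. c b \<otimes> v b)"
  proof (rule add.finprod_mono_neutral_cong_right)
    show "c b \<otimes> v b = \<zero>" if b: "b \<in> F - {b \<in> B. c b \<noteq> \<zero>}" for b
    proof -
      have "c b = \<zero>" "v b \<in> carrier R" using b assms(3,5) by auto
      then show ?thesis by simp
    qed
  qed (use assms in \<open>auto simp: Pi_iff subset_iff\<close>)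
  then show ?thesis by (simp add: lincomb_def)
qed

lemma lincomb_closed:
  "c \<in> B \<rightarrow> carrier R \<Longrightarrow> v \<in> B \<rightarrow> carrier R \<Longrightarrow> lincomb B c v \<in> carrier R"
  unfolding lincomb_def by (intro finsum_closed) auto

lemma lincomb_cong:
  assumes "\<And>b. b \<in> B \<Longrightarrow> c b = d b" "\<And>b. b \<in> B \<Longrightarrow> v b = w b"
    "d \<in> B \<rightarrow> carrier R" "w \<in> B \<rightarrow> carrier R"
  shows "lincomb B c v = lincomb B d w"
proof -
  have "{b \<in> B. c b \<noteq> \<zero>} = {b \<in> B. d b \<noteq> \<zero>}" using assms by auto
  then show ?thesis unfolding lincomb_def using assms by (auto intro!: finsum_cong')
qed

lemma lincomb_zero: "lincomb B (\<lambda>b. \<zero>) v = \<zero>"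
  by (simp add: lincomb_def)

lemma lincomb_add:
  assumes "c \<in> coeffs B (carrier R)" "d \<in> coeffs B (carrier R)" "v \<in> B \<rightarrow> carrier R"
  shows "lincomb B (\<lambda>b. c b \<oplus> d b) v = lincomb B c v \<oplus> lincomb B d v"
proof -
  let ?F = "{b \<in> B. c b \<noteq> \<zero>} \<union> {b \<in> B. d b \<noteq> \<zero>}"
  have F: "finite ?F" "?F \<subseteq> B" using assms by (auto simp: coeffs_def)
  have cd: "c \<in> B \<rightarrow> carrier R" "d \<in> B \<rightarrow> carrier R" using assms by (auto simp: coeffs_def)
  have "lincomb B (\<lambda>b. c b \<oplus> d b) v = (\<Oplus>b\<in>?F. (c b \<oplus> d b) \<otimes> v b)"
    using F cd assms by (intro lincomb_eq) auto
  also have "\<dots> = (\<Oplus>b\<in>?F. c b \<otimes> v b \<oplus> d b \<otimes> v b)"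
    using cd assms by (intro finsum_cong') (auto simp: l_distr Pi_iff)
  also have "\<dots> = (\<Oplus>b\<in>?F. c b \<otimes> v b) \<oplus> (\<Oplus>b\<in>?F. d b \<otimes> v b)"
    using cd assms by (intro finsum_addf) auto
  also have "(\<Oplus>b\<in>?F. c b \<otimes> v b) = lincomb B c v" using F cd assms by (intro lincomb_eq[symmetric]) auto
  also have "(\<Oplus>b\<in>?F. d b \<otimes> v b) = lincomb B d v" using F cd assms by (intro lincomb_eq[symmetric]) auto
  finally show ?thesis .
qed

lemma lincomb_smult:
  assumes "c \<in> coeffs B (carrier R)" "a \<in> carrier R" "v \<in> B \<rightarrow> carrier R"
  shows "lincomb B (\<lambda>b. a \<otimes> c b) v = a \<otimes> lincomb B c v"
proof -
  let ?F = "{b \<in> B. c b \<noteq> \<zero>}"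
  have F: "finite ?F" "?F \<subseteq> B" using assms by (auto simp: coeffs_def)
  have c: "c \<in> B \<rightarrow> carrier R" using assms by (auto simp: coeffs_def)
  have "lincomb B (\<lambda>b. a \<otimes> c b) v = (\<Oplus>b\<in>?F. (a \<otimes> c b) \<otimes> v b)"
    using F c assms by (intro lincomb_eq) (auto simp: Pi_iff)
  also have "\<dots> = (\<Oplus>b\<in>?F. a \<otimes> (c b \<otimes> v b))"
    using c assms by (intro finsum_cong') (auto simp: m_assoc Pi_iff)
  also have "\<dots> = a \<otimes> lincomb B c v"
    unfolding lincomb_def using c F assms by (intro finsum_rdistr[symmetric]) auto
  finally show ?thesis .
qed

lemma lincomb_finsum:
  assumes "finite S" "\<And>i. i \<in> S \<Longrightarrow> c i \<in> coeffs B (carrier R)" "v \<in> B \<rightarrow> carrier R"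
  shows "(\<lambda>b. \<Oplus>i\<in>S. c i b) \<in> coeffs B (carrier R) \<and>
    lincomb B (\<lambda>b. \<Oplus>i\<in>S. c i b) v = (\<Oplus>i\<in>S. lincomb B (c i) v)"
  using assms(1,2)
proof (induction S)
  case empty
  then show ?case using lincomb_zero by (simp add: coeffs_def)
next
  case (insert i S)
  have m: "c j b \<in> carrier R" if "j \<in> insert i S" "b \<in> B" for j b
    using insert.prems that coeffs_mem by blast
  have eq: "(\<Oplus>j\<in>insert i S. c j b) = c i b \<oplus> (\<Oplus>j\<in>S. c j b)" if "b \<in> B" for b
    using insert.hyps m that by (intro finsum_insert) auto
  have IH: "(\<lambda>b. \<Oplus>i\<in>S. c i b) \<in> coeffs B (carrier R)"
    "lincomb B (\<lambda>b. \<Oplus>i\<in>S. c i b) v = (\<Oplus>i\<in>S. lincomb B (c i) v)"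
    using insert by auto
  have ci: "c i \<in> coeffs B (carrier R)" using insert by blast
  have 1: "(\<lambda>b. c i b \<oplus> (\<Oplus>j\<in>S. c j b)) \<in> coeffs B (carrier R)"
    using coeffs_add[OF ci IH(1)] coeffs_mem[OF ci] coeffs_mem[OF IH(1)] by blast
  have cl: "lincomb B (c j) v \<in> carrier R" if "j \<in> insert i S" for j
    using that m assms(3) by (intro lincomb_closed) auto
  have "(\<lambda>b. \<Oplus>j\<in>insert i S. c j b) \<in> coeffs B (carrier R)"
    by (rule coeffs_map[OF 1]) (use eq m coeffs_mem[OF 1] in \<open>auto simp: eq\<close>)
  moreover have "lincomb B (\<lambda>b. \<Oplus>j\<in>insert i S. c j b) v = lincomb B (\<lambda>b. c i b \<oplus> (\<Oplus>j\<in>S. c j b)) v"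
    using eq coeffs_mem[OF 1] assms(3) by (intro lincomb_cong) auto
  moreover have "\<dots> = lincomb B (c i) v \<oplus> (\<Oplus>i\<in>S. lincomb B (c i) v)"
    using lincomb_add[OF ci IH(1) assms(3)] IH(2) by simp
  moreover have "\<dots> = (\<Oplus>i\<in>insert i S. lincomb B (c i) v)"
    using insert.hyps cl by (intro finsum_insert[symmetric]) auto
  ultimately show ?case by simp
qed

lemma lincomb_in_subring:
  assumes T: "subring T R" and c: "c \<in> coeffs B T" and B: "B \<subseteq> T"
  shows "lincomb B c (\<lambda>b. b) \<in> T"
proof -
  have *: "(\<Oplus>b\<in>F. c b \<otimes> b) \<in> T" if "finite F" "F \<subseteq> B" for F
    using that
  proof (induction F rule: finite_induct)
    case empty
    then show ?case using subringE(2)[OF T] by simp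
  next
    case (insert b F)
    have "c x \<otimes> x \<in> T" if "x \<in> B" for x
      using subringE(6)[OF T, of "c x" x] coeffs_mem[OF c that] that B by blast
    then have "(\<Oplus>b\<in>insert b F. c b \<otimes> b) = c b \<otimes> b \<oplus> (\<Oplus>b\<in>F. c b \<otimes> b)" "c b \<otimes> b \<in> T"
      using insert subringE(1)[OF T] by (auto intro!: finsum_insert)
    then show ?case using insert subringE(7)[OF T] by simp
  qed
  then show ?thesis using c by (simp add: lincomb_def coeffs_def)
qed

definition free_basis :: "'a set \<Rightarrow> 'a set \<Rightarrow> 'a set \<Rightarrow> bool" where
  "free_basis M N B \<longleftrightarrow> B \<subseteq> N \<and>
     (\<forall>x\<in>N. \<exists>c\<in>coeffs B M. x = lincomb B c (\<lambda>b. b)) \<and>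
     (\<forall>c\<in>coeffs B M. lincomb B c (\<lambda>b. b) = \<zero> \<longrightarrow> (\<forall>b\<in>B. c b = \<zero>))"

text \<open>Independence may be tested on several vectors \<open>v\<close> at once. Two instances matter: the single vector
  given by the basis itself, and the vectors \<open>b \<mapsto> g b\<close> for all \<open>g\<close> in a group.\<close>

lemma lincomb_unique:
  assumes indep: "\<And>c. c \<in> coeffs B M \<Longrightarrow> (\<And>v. v \<in> V \<Longrightarrow> lincomb B c v = \<zero>) \<Longrightarrow> \<forall>b\<in>B. c b = \<zero>"
    and M: "subring M R" and c: "c \<in> coeffs B M" "d \<in> coeffs B M" and V: "\<And>v. v \<in> V \<Longrightarrow> v \<in> B \<rightarrow> carrier R"
    and eq: "\<And>v. v \<in> V \<Longrightarrow> lincomb B c v = lincomb B d v" and b: "b \<in> B"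
  shows "c b = d b"
proof -
  have Mc: "M \<subseteq> carrier R" by (rule subringE(1)[OF M])
  have cd: "c \<in> coeffs B (carrier R)" "d \<in> coeffs B (carrier R)" using c Mc coeffs_mono by auto
  have n1: "\<ominus> \<one> \<in> M" using subringE(3,5)[OF M] by blast
  then have n1c: "\<ominus> \<one> \<in> carrier R" using Mc by blast
  have nd: "(\<lambda>b. \<ominus> \<one> \<otimes> d b) \<in> coeffs B (carrier R)"
    using coeffs_mem[OF cd(2)] n1c by (intro coeffs_map[OF cd(2)]) auto
  have e: "(\<lambda>b. c b \<oplus> \<ominus> \<one> \<otimes> d b) \<in> coeffs B M"
  proof (rule coeffs_add[OF cd(1) nd])
    fix b assume "b \<in> B"
    then show "c b \<oplus> \<ominus> \<one> \<otimes> d b \<in> M"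
      using coeffs_mem[OF c(1)] coeffs_mem[OF c(2)] subringE(6,7)[OF M] n1 by blast
  qed
  have "lincomb B (\<lambda>b. c b \<oplus> \<ominus> \<one> \<otimes> d b) v = \<zero>" if v: "v \<in> V" for v
  proof -
    have "lincomb B (\<lambda>b. c b \<oplus> \<ominus> \<one> \<otimes> d b) v = lincomb B c v \<oplus> \<ominus> \<one> \<otimes> lincomb B d v"
      using lincomb_add[OF cd(1) nd V[OF v]] lincomb_smult[OF cd(2) n1c V[OF v]] by simp
    also have "\<dots> = \<zero>"
      using eq[OF v] lincomb_closed[OF _ V[OF v], of d] cd(2) by (auto simp: coeffs_def l_minus r_neg)
    finally show ?thesis .
  qed
  then have "c b \<oplus> \<ominus> \<one> \<otimes> d b = \<zero>" using indep[OF e] b by blast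
  moreover have cb: "c b \<in> carrier R" "d b \<in> carrier R" using cd b coeffs_mem by auto
  ultimately have "c b \<ominus> d b = \<zero>" by (simp add: l_minus a_minus_def)
  then show ?thesis using cb r_right_minus_eq by simp
qed

lemma free_basis_unique:
  assumes "free_basis M N B" "subring M R" "N \<subseteq> carrier R" "c \<in> coeffs B M" "d \<in> coeffs B M"
    "lincomb B c (\<lambda>b. b) = lincomb B d (\<lambda>b. b)" "b \<in> B"
  shows "c b = d b"
  by (rule lincomb_unique[where V = "{\<lambda>b. b}" and M = M])
    (use assms in \<open>auto simp: free_basis_def\<close>)

end

context faithful_ring_action
begin

lemma act_lincomb:
  assumes "\<rho> \<in> carrier G" "c \<in> coeffs B (carrier A)" "v \<in> B \<rightarrow> carrier A"
  shows "\<rho> (lincomb B c v) = lincomb B (\<lambda>b. \<rho> (c b)) (\<lambda>b. \<rho> (v b))"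
proof -
  let ?F = "{b \<in> B. c b \<noteq> \<zero>}"
  have F: "finite ?F" "?F \<subseteq> B" using assms by (auto simp: coeffs_def)
  have c: "c \<in> B \<rightarrow> carrier A" using assms by (auto simp: coeffs_def)
  have "\<rho> (lincomb B c v) = (\<Oplus>b\<in>?F. \<rho> (c b \<otimes> v b))"
    unfolding lincomb_def using assms c by (intro act_finsum) auto
  also have "\<dots> = (\<Oplus>b\<in>?F. \<rho> (c b) \<otimes> \<rho> (v b))"
    using assms c by (intro finsum_cong') (auto simp: Pi_iff)
  also have "\<dots> = lincomb B (\<lambda>b. \<rho> (c b)) (\<lambda>b. \<rho> (v b))"
    using F assms c by (intro lincomb_eq[symmetric]) (auto simp: Pi_iff)
  finally show ?thesis .
qed

lemma coeffs_act:
  "\<rho> \<in> carrier G \<Longrightarrow> c \<in> coeffs B (carrier A) \<Longrightarrow> (\<lambda>b. \<rho> (c b)) \<in> coeffs B (carrier A)"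
  by (rule coeffs_map[of c B "carrier A"]) (auto simp: coeffs_mem)

end

section \<open>Bases of rings of invariants\<close>

locale free_invariants = faithful_ring_action +
  fixes H and B
  assumes H: "subgroup H G" and basis: "free_basis (Inv (carrier G)) (Inv H) B"
begin

lemma HG: "H \<subseteq> carrier G" by (rule subgroup.subset[OF H])

lemma B_Inv: "B \<subseteq> Inv H" using basis by (simp add: free_basis_def)

lemma B_closed: "b \<in> B \<Longrightarrow> b \<in> carrier A" using B_Inv Inv_closed by blast

lemma id_B: "(\<lambda>b. b) \<in> B \<rightarrow> carrier A" using B_closed by auto

lemma act_B: "g \<in> carrier G \<Longrightarrow> g \<in> B \<rightarrow> carrier A" using B_closed by auto

lemma InvG_closed: "Inv (carrier G) \<subseteq> carrier A" using Inv_closed by blast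

lemma InvG_coeffs: "c \<in> coeffs B (Inv (carrier G)) \<Longrightarrow> c \<in> coeffs B (carrier A)"
  using coeffs_mono InvG_closed by blast

lemma Inv_coeffs: "c \<in> coeffs B (Inv I) \<Longrightarrow> c \<in> coeffs B (carrier A)"
  using coeffs_mono[of "Inv I" "carrier A"] Inv_closed by blast

lemma expand: "x \<in> Inv H \<Longrightarrow> \<exists>c\<in>coeffs B (Inv (carrier G)). x = lincomb B c (\<lambda>b. b)"
  using basis by (simp add: free_basis_def)

lemma act_expansion:
  assumes "c \<in> coeffs B (Inv (carrier G))" "g \<in> carrier G"
  shows "g (lincomb B c (\<lambda>b. b)) = lincomb B c g"
proof -
  have "g (lincomb B c (\<lambda>b. b)) = lincomb B (\<lambda>b. g (c b)) (\<lambda>b. g b)"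
    by (rule act_lincomb[OF assms(2) InvG_coeffs[OF assms(1)] id_B])
  also have "\<dots> = lincomb B c g"
    using coeffs_mem[OF assms(1)] Inv_fixed assms(2) InvG_closed act_B
    by (intro lincomb_cong) auto
  finally show ?thesis .
qed

text \<open>The sums \<open>\<Sum>\<^sub>\<gamma> \<gamma>(s f(\<gamma>\<^sup>-\<^sup>1))\<close> over the cosets of \<open>I\<close> are \<open>H\<close>-invariants, hence combinations of the
  basis over \<open>A\<^sup>G\<close>. This puts the coefficients of \<open>f\<close> into the inverse different of \<open>A\<^sup>I\<close> over \<open>A\<^sup>G\<close>.\<close>

lemma coset_sum_coefficients:
  assumes I: "subgroup I G"
    and f: "f \<in> carrier G \<rightarrow> carrier A"
      "\<And>i g. i \<in> I \<Longrightarrow> g \<in> carrier G \<Longrightarrow> f (i \<bullet> g) = i (f g)"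
      "\<And>g h. g \<in> carrier G \<Longrightarrow> h \<in> H \<Longrightarrow> f (g \<bullet> h) = f g"
    and \<delta>: "\<delta> \<in> Inv (carrier G)"
    and c: "c \<in> coeffs B (Inv I)" "\<And>g. g \<in> carrier G \<Longrightarrow> \<delta> \<otimes> f g = lincomb B c g"
    and s: "s \<in> Inv I" and b: "b \<in> B"
  shows "\<exists>r\<in>carrier A. coset_sum I (\<lambda>\<gamma>. \<gamma> (s \<otimes> c b)) = \<delta> \<otimes> r"
proof -
  have IG: "I \<subseteq> carrier G" by (rule subgroup.subset[OF I])
  have sc: "s \<in> carrier A" and \<delta>c: "\<delta> \<in> carrier A" using s \<delta> Inv_closed by auto
  have cc: "c \<in> coeffs B (carrier A)" using c(1) by (rule Inv_coeffs)
  have fc: "g \<in> carrier G \<Longrightarrow> f g \<in> carrier A" for g using f(1) by auto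
  define \<phi> where "\<phi> = (\<lambda>\<gamma>. \<gamma> (s \<otimes> f (inv_G \<gamma>)))"
  define y where "y = coset_sum I \<phi>"
  have \<phi>c: "\<phi> \<in> carrier G \<rightarrow> carrier A" using sc fc by (auto simp: \<phi>_def)
  have \<phi>I: "\<phi> (g \<bullet> h) = \<phi> g" if g: "g \<in> carrier G" and h: "h \<in> I" for g h
  proof -
    have hG: "h \<in> carrier G" using h IG by blast
    have "f (inv_G (g \<bullet> h)) = inv_G h (f (inv_G g))"
      using f(2)[OF subgroup.m_inv_closed[OF I h], of "inv_G g"] g hG by (simp add: G.inv_mult_group)
    then have "\<phi> (g \<bullet> h) = g (h (s \<otimes> inv_G h (f (inv_G g))))"
      using g hG sc fc act_mult[OF g hG] by (simp add: \<phi>_def)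
    also have "h (s \<otimes> inv_G h (f (inv_G g))) = s \<otimes> f (inv_G g)"
      using g hG sc fc[of "inv_G g"] Inv_fixed[OF s h] by simp
    finally show ?thesis by (simp add: \<phi>_def)
  qed
  have "h y = y" if h: "h \<in> H" for h
  proof -
    have hG: "h \<in> carrier G" using h HG by blast
    have "h y = coset_sum I (\<lambda>\<gamma>. h (\<phi> \<gamma>))" unfolding y_def by (rule coset_sum_act[OF I \<phi>c hG])
    also have "\<dots> = coset_sum I (\<lambda>\<gamma>. \<phi> (h \<bullet> \<gamma>))"
    proof (rule coset_sum_cong[OF I])
      fix g assume g: "g \<in> carrier G"
      have "f (inv_G (h \<bullet> g)) = f (inv_G g)"
        using f(3)[OF _ subgroup.m_inv_closed[OF H h], of "inv_G g"] g hG by (simp add: G.inv_mult_group)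
      then show "h (\<phi> g) = \<phi> (h \<bullet> g)"
        using act_mult[OF hG g] sc fc[of "inv_G g"] g by (simp add: \<phi>_def)
    qed (use \<phi>c hG in auto)
    also have "\<dots> = y" unfolding y_def by (rule coset_sum_translate[OF I \<phi>c \<phi>I hG])
    finally show ?thesis .
  qed
  then have "y \<in> Inv H" using coset_sum_closed[OF I \<phi>c] by (auto simp: Inv_def y_def)
  then obtain r where r: "r \<in> coeffs B (Inv (carrier G))" "y = lincomb B r (\<lambda>b. b)" using expand by blast
  define C where "C = (\<lambda>g. g <#\<^bsub>G\<^esub> I) ` carrier G"
  define rep where "rep C = (SOME g :: 'a \<Rightarrow> 'a. g \<in> C)" for C
  have rep: "rep x \<in> carrier G" if "x \<in> C" for x
    using coset_rep_closed[OF I] that unfolding C_def rep_def by blast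
  have finC: "finite C" using finite_group by (simp add: C_def)
  let ?d = "\<lambda>g b. g (s \<otimes> c b)"
  have dco: "?d g \<in> coeffs B (carrier A)" if "g \<in> carrier G" for g
    using that sc coeffs_mem[OF cc] by (intro coeffs_map[OF cc]) auto
  have "\<delta> \<otimes> y = coset_sum I (\<lambda>\<gamma>. \<delta> \<otimes> \<phi> \<gamma>)"
    unfolding y_def by (rule coset_sum_smult[OF I \<phi>c \<delta>c, symmetric])
  also have "\<dots> = coset_sum I (\<lambda>\<gamma>. lincomb B (?d \<gamma>) (\<lambda>b. b))"
  proof (rule coset_sum_cong[OF I])
    fix g assume g: "g \<in> carrier G"
    have ig: "inv_G g \<in> carrier G" using g by simp
    have "\<delta> \<otimes> \<phi> g = g (s \<otimes> (\<delta> \<otimes> f (inv_G g)))"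
      using g sc \<delta>c fc[OF ig] Inv_fixed[OF \<delta> g] by (simp add: \<phi>_def m_lcomm)
    also have "\<dots> = g (lincomb B (\<lambda>b. s \<otimes> c b) (inv_G g))"
      using c(2)[OF ig] lincomb_smult[OF cc sc act_B[OF ig]] by simp
    also have "\<dots> = lincomb B (?d g) (\<lambda>b. g (inv_G g b))"
      using sc coeffs_mem[OF cc] by (intro act_lincomb[OF g] coeffs_map[OF cc] act_B[OF ig]) auto
    also have "\<dots> = lincomb B (?d g) (\<lambda>b. b)"
      using g B_closed coeffs_mem[OF dco[OF g]] by (intro lincomb_cong) auto
    finally show "\<delta> \<otimes> \<phi> g = lincomb B (?d g) (\<lambda>b. b)" .
  qed (use dco id_B lincomb_closed in \<open>auto simp: coeffs_def\<close>)
  also have "\<dots> = (\<Oplus>x\<in>C. lincomb B (?d (rep x)) (\<lambda>b. b))" by (simp add: coset_sum_def C_def rep_def)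
  also have "\<dots> = lincomb B (\<lambda>b. \<Oplus>x\<in>C. ?d (rep x) b) (\<lambda>b. b)"
    using lincomb_finsum[OF finC dco[OF rep] id_B] by simp
  finally have 1: "\<delta> \<otimes> y = lincomb B (\<lambda>b. \<Oplus>x\<in>C. ?d (rep x) b) (\<lambda>b. b)" .
  have cs: "(\<Oplus>x\<in>C. ?d (rep x) b) = coset_sum I (\<lambda>\<gamma>. ?d \<gamma> b)" for b
    by (simp add: coset_sum_def C_def rep_def)
  have 2: "(\<lambda>b. \<Oplus>x\<in>C. ?d (rep x) b) \<in> coeffs B (Inv (carrier G))"
  proof (rule coeffs_map[OF conjunct1[OF lincomb_finsum[OF finC dco[OF rep] id_B]]])
    fix b assume "b \<in> B"
    then have "s \<otimes> c b \<in> Inv I" using Inv_mult[OF IG s] coeffs_mem[OF c(1)] by blast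
    then show "(\<Oplus>x\<in>C. ?d (rep x) b) \<in> Inv (carrier G)" unfolding cs by (rule coset_sum_invariant[OF I])
  qed auto
  have rc: "r \<in> coeffs B (carrier A)" by (rule InvG_coeffs[OF r(1)])
  have 3: "(\<lambda>b. \<delta> \<otimes> r b) \<in> coeffs B (Inv (carrier G))"
    using coeffs_mem[OF r(1)] Inv_mult[OF subset_refl \<delta>] \<delta>c by (intro coeffs_map[OF r(1)]) auto
  have "lincomb B (\<lambda>b. \<Oplus>x\<in>C. ?d (rep x) b) (\<lambda>b. b) = lincomb B (\<lambda>b. \<delta> \<otimes> r b) (\<lambda>b. b)"
    using 1 r(2) lincomb_smult[OF rc \<delta>c id_B] by simp
  then have "(\<Oplus>x\<in>C. ?d (rep x) b) = \<delta> \<otimes> r b"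
    using Inv_closed by (intro free_basis_unique[OF basis Inv_subring[OF subset_refl] _ 2 3 _ b]) auto
  then show ?thesis using cs[of b] coeffs_mem[OF rc b] by auto
qed

text \<open>All traces of the coefficients vanish, by freeness over \<open>A\<^sup>G\<close> alone; now the trace form is
  nondegenerate because distinct automorphisms are separated modulo the prime ideal \<open>0\<close>.\<close>

lemma basis_independent:
  assumes c: "c \<in> coeffs B (carrier A)" and 0: "\<And>g. g \<in> carrier G \<Longrightarrow> lincomb B c g = \<zero>"
  shows "\<forall>b\<in>B. c b = \<zero>"
proof
  fix b assume b: "b \<in> B"
  have P: "primeideal {\<zero>} A" by (rule zeroprimeideal)
  have "\<exists>d\<in>carrier A - {\<zero>}. \<exists>r\<in>carrier A. d \<otimes> c b = \<zero> \<otimes> r"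
  proof (rule separator_dvd[OF P])
    show "c b \<in> Inv (inertia_group A (carrier G) {\<zero>})"
      using coeffs_mem[OF c b] by (simp add: inertia_zero_ideal Inv_trivial)
    fix s assume s: "s \<in> Inv (inertia_group A (carrier G) {\<zero>})"
    show "\<exists>r\<in>carrier A. coset_sum (inertia_group A (carrier G) {\<zero>}) (\<lambda>\<gamma>. \<gamma> (s \<otimes> c b)) = \<zero> \<otimes> r"
    proof (rule coset_sum_coefficients[where f = "\<lambda>_. \<zero>" and c = c and b = b])
      show "subgroup (inertia_group A (carrier G) {\<zero>}) G"
        by (rule inertia_subgroup) (rule primeideal.axioms(1)[OF P])
      show "\<zero> = i \<zero>" if "i \<in> inertia_group A (carrier G) {\<zero>}" for i
        using that by (simp add: inertia_group_def)
      show "c \<in> coeffs B (Inv (inertia_group A (carrier G) {\<zero>}))"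
        using c by (simp add: inertia_zero_ideal Inv_trivial)
      show "\<zero> \<otimes> \<zero> = lincomb B c g" if "g \<in> carrier G" for g using 0[OF that] by simp
    qed (use s b in \<open>auto simp: Inv_zero\<close>)
  qed auto
  then show "c b = \<zero>" using coeffs_mem[OF c b] integral_iff by auto
qed

lemma basis_unique:
  assumes "c \<in> coeffs B (carrier A)" "d \<in> coeffs B (carrier A)"
    "\<And>g. g \<in> carrier G \<Longrightarrow> lincomb B c g = lincomb B d g" "b \<in> B"
  shows "c b = d b"
proof (rule lincomb_unique[where V = "carrier G" and M = "carrier A" and c = c and d = d and B = B])
  show "\<forall>b\<in>B. c b = \<zero>" if "c \<in> coeffs B (carrier A)" "\<And>v. v \<in> carrier G \<Longrightarrow> lincomb B c v = \<zero>" for c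
    using basis_independent that by blast
qed (use assms act_B carrier_is_subring in auto)

text \<open>Both \<open>c\<close> and its translates by \<open>K\<close> are coefficients of the same function, so they agree.\<close>

lemma equivariant_coefficients:
  assumes K: "K \<subseteq> carrier G" and f: "f \<in> carrier G \<rightarrow> carrier A"
      "\<And>i g. i \<in> K \<Longrightarrow> g \<in> carrier G \<Longrightarrow> f (i \<bullet> g) = i (f g)"
    and \<delta>: "\<delta> \<in> Inv (carrier G)"
    and c: "c \<in> coeffs B (carrier A)" "\<And>g. g \<in> carrier G \<Longrightarrow> \<delta> \<otimes> f g = lincomb B c g"
  shows "c \<in> coeffs B (Inv K)"
proof (rule coeffs_map[OF c(1)])
  fix b assume b: "b \<in> B"
  have "k (c b) = c b" if k: "k \<in> K" for k
  proof (rule basis_unique[where c = "\<lambda>b. k (c b)" and d = c])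
    have kG: "k \<in> carrier G" using k K by blast
    show "(\<lambda>b. k (c b)) \<in> coeffs B (carrier A)" by (rule coeffs_act[OF kG c(1)])
    fix g assume g: "g \<in> carrier G"
    define h where "h = inv_G k \<bullet> g"
    have h: "h \<in> carrier G" "k \<bullet> h = g" using kG g by (simp_all add: h_def G.m_assoc[symmetric])
    have fh: "f h \<in> carrier A" using f(1) h(1) by auto
    have "lincomb B c g = k (\<delta> \<otimes> f h)"
      using c(2)[OF g] f(2)[OF k h(1)] fh Inv_fixed[OF \<delta> kG] Inv_closed[OF \<delta>] kG h by simp
    also have "\<dots> = lincomb B (\<lambda>b. k (c b)) (\<lambda>b. k (h b))"
      unfolding c(2)[OF h(1)] by (rule act_lincomb[OF kG c(1) act_B[OF h(1)]])
    also have "\<dots> = lincomb B (\<lambda>b. k (c b)) g"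
      using act_mult[OF kG h(1)] h B_closed coeffs_mem[OF c(1)] kG g by (intro lincomb_cong) auto
    finally show "lincomb B (\<lambda>b. k (c b)) g = lincomb B c g" by simp
  qed (use c b in auto)
  then show "c b \<in> Inv K" using coeffs_mem[OF c(1) b] by (auto simp: Inv_def)
qed auto

text \<open>Summation over \<open>H\<close> turns a function that separates the identity from the other automorphisms into a
  multiple of the indicator function of \<open>H\<close>. Its translates generate all functions on the cosets of \<open>H\<close>,
  up to the factor \<open>\<delta>\<close>.\<close>

lemma common_denominator:
  "\<exists>\<delta>\<in>Inv (carrier G). \<delta> \<noteq> \<zero> \<and> (\<forall>f\<in>carrier G \<rightarrow> carrier A.
    (\<forall>g\<in>carrier G. \<forall>h\<in>H. f (g \<bullet> h) = f g) \<longrightarrow>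
    (\<exists>c\<in>coeffs B (carrier A). \<forall>g\<in>carrier G. \<delta> \<otimes> f g = lincomb B c g))"
proof -
  have fH: "finite H" using HG finite_group finite_subset by blast
  have span: "\<exists>c\<in>coeffs B (carrier A). \<forall>g\<in>carrier G. (\<Oplus>h\<in>H. \<psi> (g \<bullet> h)) = lincomb B c g"
    if "\<psi> \<in> orbit_span {\<one>\<^bsub>G\<^esub>}" for \<psi>
    using that
  proof induction
    case (base t s)
    have sc: "s \<in> carrier A" using base Inv_closed by blast
    define x where "x = (\<Oplus>h\<in>H. h s)"
    have xc: "x \<in> carrier A" unfolding x_def using sc HG by (intro finsum_closed) auto
    have "k x = x" if k: "k \<in> H" for k
    proof -
      have kG: "k \<in> carrier G" using k HG by blast
      have "k x = (\<Oplus>h\<in>H. k (h s))" unfolding x_def using sc HG kG by (intro act_finsum) auto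
      also have "\<dots> = (\<Oplus>h\<in>H. (k \<bullet> h) s)" using sc HG kG act_mult[OF kG] by (intro finsum_cong') auto
      also have "\<dots> = (\<Oplus>h\<in>(\<lambda>h. k \<bullet> h) ` H. h s)"
        using sc HG kG by (intro finsum_reindex[symmetric]) (auto simp: inj_on_def subset_iff)
      also have "(\<lambda>h. k \<bullet> h) ` H = H" by (rule left_translation_image[OF H k])
      finally show ?thesis unfolding x_def .
    qed
    then have "x \<in> Inv H" using xc by (auto simp: Inv_def)
    then obtain r where r: "r \<in> coeffs B (Inv (carrier G))" "x = lincomb B r (\<lambda>b. b)" using expand by blast
    have rc: "r \<in> coeffs B (carrier A)" by (rule InvG_coeffs[OF r(1)])
    have "(\<Oplus>h\<in>H. (\<lambda>g\<in>carrier G. t \<otimes> g s) (g \<bullet> h)) = lincomb B (\<lambda>b. t \<otimes> r b) g" if g: "g \<in> carrier G" for g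
    proof -
      have "(\<Oplus>h\<in>H. (\<lambda>g\<in>carrier G. t \<otimes> g s) (g \<bullet> h)) = (\<Oplus>h\<in>H. t \<otimes> g (h s))"
        using g HG act_mult[OF g] sc base(1) by (intro finsum_cong') (auto simp: subset_iff)
      also have "\<dots> = t \<otimes> (\<Oplus>h\<in>H. g (h s))"
        using fH base(1) g HG sc by (intro finsum_rdistr[symmetric]) auto
      also have "(\<Oplus>h\<in>H. g (h s)) = g x" unfolding x_def using sc HG g by (intro act_finsum[symmetric]) auto
      also have "g x = lincomb B r g" unfolding r(2) by (rule act_expansion[OF r(1) g])
      also have "t \<otimes> lincomb B r g = lincomb B (\<lambda>b. t \<otimes> r b) g"
        by (rule lincomb_smult[OF rc base(1) act_B[OF g], symmetric])
      finally show ?thesis .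
    qed
    moreover have "(\<lambda>b. t \<otimes> r b) \<in> coeffs B (carrier A)"
      using base(1) coeffs_mem[OF rc] by (intro coeffs_map[OF rc]) auto
    ultimately show ?case by blast
  next
    case (add \<phi> \<psi>)
    then obtain c d where cd: "c \<in> coeffs B (carrier A)" "d \<in> coeffs B (carrier A)"
      "\<And>g. g \<in> carrier G \<Longrightarrow> (\<Oplus>h\<in>H. \<phi> (g \<bullet> h)) = lincomb B c g"
      "\<And>g. g \<in> carrier G \<Longrightarrow> (\<Oplus>h\<in>H. \<psi> (g \<bullet> h)) = lincomb B d g" by blast
    note cl = orbit_span_closed[OF add(1)] orbit_span_closed[OF add(2)]
    have "(\<Oplus>h\<in>H. (\<lambda>g\<in>carrier G. \<phi> g \<oplus> \<psi> g) (g \<bullet> h)) = lincomb B (\<lambda>b. c b \<oplus> d b) g"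
      if g: "g \<in> carrier G" for g
    proof -
      have "(\<Oplus>h\<in>H. (\<lambda>g\<in>carrier G. \<phi> g \<oplus> \<psi> g) (g \<bullet> h)) = (\<Oplus>h\<in>H. \<phi> (g \<bullet> h) \<oplus> \<psi> (g \<bullet> h))"
        using g HG cl by (intro finsum_cong') (auto simp: subset_iff)
      also have "\<dots> = (\<Oplus>h\<in>H. \<phi> (g \<bullet> h)) \<oplus> (\<Oplus>h\<in>H. \<psi> (g \<bullet> h))"
        using g HG cl by (intro finsum_addf) auto
      finally show ?thesis using cd(3,4)[OF g] lincomb_add[OF cd(1,2) act_B[OF g]] by simp
    qed
    moreover have "(\<lambda>b. c b \<oplus> d b) \<in> coeffs B (carrier A)"
      using coeffs_mem[OF cd(1)] coeffs_mem[OF cd(2)] by (intro coeffs_add[OF cd(1,2)]) auto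
    ultimately show ?case by blast
  qed
  \<comment> \<open>summed over \<open>H\<close>, this function becomes \<open>d\<close> times the indicator function of \<open>H\<close>\<close>
  obtain \<psi> where \<psi>: "\<psi> \<in> orbit_span {\<one>\<^bsub>G\<^esub>}" "\<psi> \<one>\<^bsub>G\<^esub> \<noteq> \<zero>" "\<And>g. g \<in> carrier G \<Longrightarrow> g \<noteq> \<one>\<^bsub>G\<^esub> \<Longrightarrow> \<psi> g = \<zero>"
    using inertia_separator[OF zeroprimeideal] unfolding inertia_zero_ideal by blast
  define d where "d = \<psi> \<one>\<^bsub>G\<^esub>"
  have d: "d \<in> carrier A" "d \<noteq> \<zero>" using \<psi>(2) orbit_span_closed[OF \<psi>(1)] by (auto simp: d_def)
  obtain e where e: "e \<in> coeffs B (carrier A)" "\<And>g. g \<in> carrier G \<Longrightarrow> (\<Oplus>h\<in>H. \<psi> (g \<bullet> h)) = lincomb B e g"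
    using span[OF \<psi>(1)] by blast
  have ind: "lincomb B e g = (if g \<in> H then d else \<zero>)" if g: "g \<in> carrier G" for g
  proof -
    have "(\<Oplus>h\<in>H. \<psi> (g \<bullet> h)) = (\<Oplus>h\<in>H. if inv_G g = h then d else \<zero>)"
    proof (rule finsum_cong')
      fix h assume h: "h \<in> H"
      then have hG: "h \<in> carrier G" using HG by blast
      have "g \<bullet> h = \<one>\<^bsub>G\<^esub> \<longleftrightarrow> inv_G g = h"
      proof
        assume "g \<bullet> h = \<one>\<^bsub>G\<^esub>"
        then show "inv_G g = h" using G.inv_solve_left'[of h g "\<one>\<^bsub>G\<^esub>"] g hG by simp
      qed (use g in auto)
      then show "\<psi> (g \<bullet> h) = (if inv_G g = h then d else \<zero>)" using \<psi>(3)[of "g \<bullet> h"] g hG by (auto simp: d_def)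
    qed (use d in auto)
    also have "\<dots> = (if g \<in> H then d else \<zero>)"
    proof (cases "g \<in> H")
      case True
      then have "inv_G g \<in> H" by (rule subgroup.m_inv_closed[OF H])
      then show ?thesis using finsum_singleton[of "inv_G g" H "\<lambda>_. d"] fH d True by simp
    next
      case False
      then have "inv_G g \<notin> H" using subgroup.m_inv_closed[OF H, of "inv_G g"] g by auto
      then have "(\<Oplus>h\<in>H. if inv_G g = h then d else \<zero>) = (\<Oplus>h\<in>H. \<zero>)" by (intro finsum_cong') auto
      then show ?thesis using False by simp
    qed
    finally show ?thesis using e(2)[OF g] by simp
  qed
  \<comment> \<open>the norm of \<open>d\<close> is invariant and divisible by all \<open>g d\<close>, the values of the translated indicator
    functions\<close>
  define \<delta> where "\<delta> = (\<Otimes>g\<in>carrier G. g d)"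
  have \<delta>c: "\<delta> \<in> carrier A" unfolding \<delta>_def using d by (intro finprod_closed) auto
  have gd: "g d \<noteq> \<zero>" if g: "g \<in> carrier G" for g using act_inj[OF g d(1), of \<zero>] g d by auto
  have "\<delta> \<notin> {\<zero>}" unfolding \<delta>_def using d gd
    by (intro primeideal.finprod_not_mem[OF zeroprimeideal finite_group]) auto
  then have \<delta>0: "\<delta> \<noteq> \<zero>" by simp
  have "k \<delta> = \<delta>" if kG: "k \<in> carrier G" for k
  proof -
    have "k \<delta> = (\<Otimes>h\<in>carrier G. k (h d))" unfolding \<delta>_def using d kG by (intro act_finprod) auto
    also have "\<dots> = (\<Otimes>h\<in>carrier G. (k \<bullet> h) d)" using d kG act_mult[OF kG] by (intro finprod_cong') auto
    also have "\<dots> = (\<Otimes>h\<in>(\<lambda>h. k \<bullet> h) ` carrier G. h d)"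
      using d kG by (intro finprod_reindex[symmetric]) (auto simp: inj_on_def)
    also have "(\<lambda>h. k \<bullet> h) ` carrier G = carrier G" by (rule left_translation_image[OF G.subgroup_self kG])
    finally show ?thesis unfolding \<delta>_def .
  qed
  then have \<delta>I: "\<delta> \<in> Inv (carrier G)" using \<delta>c by (auto simp: Inv_def)
  have "\<exists>c\<in>coeffs B (carrier A). \<forall>g\<in>carrier G. \<delta> \<otimes> f g = lincomb B c g"
    if f: "f \<in> carrier G \<rightarrow> carrier A" "\<forall>g\<in>carrier G. \<forall>h\<in>H. f (g \<bullet> h) = f g" for f
  proof -
    define \<eta> where "\<eta> g = (\<Otimes>x\<in>carrier G - {g}. x d)" for g
    have \<eta>c: "\<eta> g \<in> carrier A" for g unfolding \<eta>_def using d by (intro finprod_closed) auto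
    have \<eta>: "\<eta> g \<otimes> g d = \<delta>" if g: "g \<in> carrier G" for g
    proof -
      have "(\<Otimes>x\<in>insert g (carrier G - {g}). x d) = g d \<otimes> \<eta> g"
        unfolding \<eta>_def using d g finite_group by (intro finprod_insert) auto
      moreover have "insert g (carrier G - {g}) = carrier G" using g by blast
      ultimately show ?thesis using \<eta>c g d by (simp add: \<delta>_def m_comm)
    qed
    define C where "C = (\<lambda>g. g <#\<^bsub>G\<^esub> H) ` carrier G"
    define rep where "rep C = (SOME g :: 'a \<Rightarrow> 'a. g \<in> C)" for C
    have rep: "rep x \<in> carrier G" if "x \<in> C" for x
      using coset_rep_closed[OF H] that unfolding C_def rep_def by blast
    have rep_coset: "rep x <#\<^bsub>G\<^esub> H = x" if "x \<in> C" for x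
      using coset_rep_coset[OF H] that unfolding C_def rep_def by blast
    have finC: "finite C" using finite_group by (simp add: C_def)
    define c where "c x = (\<lambda>b. (\<eta> (rep x) \<otimes> f (rep x)) \<otimes> rep x (e b))" for x
    have ef: "\<eta> (rep x) \<otimes> f (rep x) \<in> carrier A" if "x \<in> C" for x using \<eta>c f(1) rep[OF that] by auto
    have cco: "c x \<in> coeffs B (carrier A)" if x: "x \<in> C" for x
      unfolding c_def using ef[OF x] coeffs_mem[OF e(1)] rep[OF x]
      by (intro coeffs_map[OF e(1)]) auto
    have lc: "lincomb B (c x) g = (if g <#\<^bsub>G\<^esub> H = x then \<delta> \<otimes> f g else \<zero>)"
      if x: "x \<in> C" and g: "g \<in> carrier G" for x g
    proof -
      define \<gamma> where "\<gamma> = rep x"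
      have \<gamma>: "\<gamma> \<in> carrier G" "\<gamma> <#\<^bsub>G\<^esub> H = x" using rep[OF x] rep_coset[OF x] by (simp_all add: \<gamma>_def)
      define h where "h = inv_G \<gamma> \<bullet> g"
      have h: "h \<in> carrier G" "\<gamma> \<bullet> h = g" using \<gamma> g by (simp_all add: h_def G.m_assoc[symmetric])
      have "lincomb B (\<lambda>b. \<gamma> (e b)) g = lincomb B (\<lambda>b. \<gamma> (e b)) (\<lambda>b. \<gamma> (h b))"
        using act_mult[OF \<gamma>(1) h(1)] h B_closed \<gamma>(1) coeffs_mem[OF e(1)] by (intro lincomb_cong) auto
      also have "\<dots> = \<gamma> (lincomb B e h)" by (rule act_lincomb[OF \<gamma>(1) e(1) act_B[OF h(1)], symmetric])
      also have "\<dots> = (if h \<in> H then \<gamma> d else \<zero>)" using ind[OF h(1)] \<gamma>(1) by simp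
      finally have 1: "lincomb B (\<lambda>b. \<gamma> (e b)) g = (if h \<in> H then \<gamma> d else \<zero>)" .
      have "lincomb B (c x) g = (\<eta> \<gamma> \<otimes> f \<gamma>) \<otimes> lincomb B (\<lambda>b. \<gamma> (e b)) g"
        unfolding c_def \<gamma>_def[symmetric] using ef[OF x] unfolding \<gamma>_def[symmetric]
        by (rule lincomb_smult[OF coeffs_act[OF \<gamma>(1) e(1)] _ act_B[OF g]])
      also have "\<dots> = (if h \<in> H then \<delta> \<otimes> f g else \<zero>)"
      proof (cases "h \<in> H")
        case True
        have fg: "f g = f \<gamma>" using f(2) \<gamma>(1) True h(2) by auto
        have "(\<eta> \<gamma> \<otimes> f \<gamma>) \<otimes> \<gamma> d = (\<eta> \<gamma> \<otimes> \<gamma> d) \<otimes> f \<gamma>"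
          using \<eta>c f(1) \<gamma>(1) d by (auto simp: m_ac Pi_iff)
        then show ?thesis using \<eta>[OF \<gamma>(1)] 1 True fg by simp
      next
        case False
        then show ?thesis using 1 ef[OF x] by (simp add: \<gamma>_def)
      qed
      also have "h \<in> H \<longleftrightarrow> g <#\<^bsub>G\<^esub> H = x"
        using coset_eq_iff[OF H \<gamma>(1) g] \<gamma>(2) by (auto simp: h_def)
      finally show ?thesis .
    qed
    have "\<delta> \<otimes> f g = lincomb B (\<lambda>b. \<Oplus>x\<in>C. c x b) g" if g: "g \<in> carrier G" for g
    proof -
      have \<delta>f: "\<delta> \<otimes> f g \<in> carrier A" using \<delta>c f(1) g by auto
      have "lincomb B (\<lambda>b. \<Oplus>x\<in>C. c x b) g = (\<Oplus>x\<in>C. lincomb B (c x) g)"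
        using lincomb_finsum[OF finC cco act_B[OF g]] by simp
      also have "\<dots> = (\<Oplus>x\<in>C. if g <#\<^bsub>G\<^esub> H = x then \<delta> \<otimes> f g else \<zero>)"
        using lc[OF _ g] \<delta>f by (intro finsum_cong') auto
      also have "\<dots> = \<delta> \<otimes> f g"
        using finsum_singleton[of "g <#\<^bsub>G\<^esub> H" C "\<lambda>_. \<delta> \<otimes> f g"] g finC \<delta>f by (auto simp: C_def)
      finally show ?thesis by simp
    qed
    moreover have "(\<lambda>b. \<Oplus>x\<in>C. c x b) \<in> coeffs B (carrier A)"
      using lincomb_finsum[OF finC cco id_B] by simp
    ultimately show ?thesis by blast
  qed
  then show ?thesis using \<delta>I \<delta>0 by blast
qed

end

context free_invariants
begin

text \<open>After multiplication by a common denominator \<open>\<delta>\<close> the expansion exists, with coefficients \<open>c b\<close>; it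
  remains to divide these by \<open>\<delta>\<close>. By normality this can be tested at a prime \<open>P\<close> of height one. The
  inertia group of \<open>P\<close> consists of reflections and therefore lies in \<open>K\<close>. So \<open>f\<close> is equivariant
  and the coefficients are invariant for it, which puts \<open>c b / \<delta>\<close> into the inverse different, and this is
  trivial at \<open>P\<close>.\<close>

theorem equivariant_expansion:
  assumes noeth: "noetherian_ring A" and ic: "integrally_closed A"
    and K: "K \<subseteq> carrier G" and refl: "reflections A (carrier G) \<subseteq> K"
    and f: "f \<in> carrier G \<rightarrow> carrier A"
      "\<And>i g. i \<in> K \<Longrightarrow> g \<in> carrier G \<Longrightarrow> f (i \<bullet> g) = i (f g)"
      "\<And>g h. g \<in> carrier G \<Longrightarrow> h \<in> H \<Longrightarrow> f (g \<bullet> h) = f g"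
  shows "\<exists>c\<in>coeffs B (Inv K). \<forall>g\<in>carrier G. f g = lincomb B c g"
proof -
  interpret N: noetherian_domain A using noeth by (intro noetherian_domain.intro domain_axioms)
  obtain \<delta> where \<delta>: "\<delta> \<in> Inv (carrier G)" "\<delta> \<noteq> \<zero>"
    and span: "\<And>f. f \<in> carrier G \<rightarrow> carrier A \<Longrightarrow> \<forall>g\<in>carrier G. \<forall>h\<in>H. f (g \<bullet> h) = f g \<Longrightarrow>
      \<exists>c\<in>coeffs B (carrier A). \<forall>g\<in>carrier G. \<delta> \<otimes> f g = lincomb B c g"
    using common_denominator by blast
  obtain c where c: "c \<in> coeffs B (carrier A)" "\<And>g. g \<in> carrier G \<Longrightarrow> \<delta> \<otimes> f g = lincomb B c g"
    using span[OF f(1)] f(3) by blast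
  have \<delta>c: "\<delta> \<in> carrier A" using \<delta> Inv_closed by blast
  have cK: "c \<in> coeffs B (Inv K)" by (rule equivariant_coefficients[OF K f(1,2) \<delta>(1) c])
  have dvd: "\<exists>r\<in>carrier A. c b = \<delta> \<otimes> r" if b: "b \<in> B" for b
  proof (rule ccontr)
    assume "\<not> ?thesis"
    then obtain P where P: "primeideal P A" "height A P = 1"
      "\<forall>d\<in>carrier A. (\<exists>r\<in>carrier A. d \<otimes> c b = \<delta> \<otimes> r) \<longrightarrow> d \<in> P"
      using N.denominators_in_height_one_prime[OF ic \<delta>c \<delta>(2) coeffs_mem[OF c(1) b]] by blast
    let ?I = "inertia_group A (carrier G) P"
    have IK: "?I \<subseteq> K"
    proof
      fix \<rho> assume r: "\<rho> \<in> ?I"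
      then have "\<rho> \<in> carrier G" by (simp add: inertia_group_def)
      then have "\<rho> \<in> reflections A (carrier G)" using r P(1,2) unfolding reflections_def by blast
      then show "\<rho> \<in> K" using refl by blast
    qed
    have I: "subgroup ?I G" by (rule inertia_subgroup[OF primeideal.axioms(1)[OF P(1)]])
    have cI: "c \<in> coeffs B (Inv ?I)" using coeffs_mono[OF Inv_antimono[OF IK] cK] .
    have "\<exists>d\<in>carrier A - P. \<exists>r\<in>carrier A. d \<otimes> c b = \<delta> \<otimes> r"
    proof (rule separator_dvd[OF P(1) coeffs_mem[OF cI b] \<delta>c])
      fix s assume s: "s \<in> Inv ?I"
      show "\<exists>r\<in>carrier A. coset_sum ?I (\<lambda>\<gamma>. \<gamma> (s \<otimes> c b)) = \<delta> \<otimes> r"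
        by (rule coset_sum_coefficients[OF I f(1) _ f(3) \<delta>(1) cI c(2) s b]) (use f(2) IK in blast)+
    qed
    then show False using P(3) by blast
  qed
  then obtain d where d: "\<And>b. b \<in> B \<Longrightarrow> d b \<in> carrier A" "\<And>b. b \<in> B \<Longrightarrow> c b = \<delta> \<otimes> d b" by metis
  have dK: "d \<in> coeffs B (Inv K)"
  proof (rule coeffs_map[OF c(1)])
    fix b assume b: "b \<in> B"
    have "k (d b) = d b" if k: "k \<in> K" for k
    proof -
      have kG: "k \<in> carrier G" using k K by blast
      have "\<delta> \<otimes> k (d b) = k (c b)" using d[OF b] Inv_fixed[OF \<delta>(1) kG] kG \<delta>c by simp
      also have "\<dots> = \<delta> \<otimes> d b" using Inv_fixed[OF coeffs_mem[OF cK b] k] d(2)[OF b] by simp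
      finally show ?thesis using m_lcancel[OF \<delta>(2) \<delta>c] d(1)[OF b] kG by simp
    qed
    then show "d b \<in> Inv K" using d(1)[OF b] by (simp add: Inv_def)
    show "d b = \<zero>" if "c b = \<zero>" using d[OF b] that \<delta> \<delta>c integral_iff by auto
  qed
  have dA: "d \<in> coeffs B (carrier A)" by (rule Inv_coeffs[OF dK])
  have "f g = lincomb B d g" if g: "g \<in> carrier G" for g
  proof -
    have "\<delta> \<otimes> f g = lincomb B (\<lambda>b. \<delta> \<otimes> d b) g"
      unfolding c(2)[OF g] using d act_B[OF g] \<delta>c by (intro lincomb_cong) auto
    also have "\<dots> = \<delta> \<otimes> lincomb B d g" by (rule lincomb_smult[OF dA \<delta>c act_B[OF g]])
    finally show ?thesis
      using m_lcancel[OF \<delta>(2) \<delta>c] f(1) g lincomb_closed[OF _ act_B[OF g], of d] d(1) by auto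
  qed
  then show ?thesis using dK by blast
qed

text \<open>An element \<open>x\<close> of \<open>A\<^sup>K\<^sup>\<inter>\<^sup>H\<close> extends to the equivariant function \<open>k h \<mapsto> k x\<close> on \<open>G = K H\<close>, whose value at
  the identity is \<open>x\<close>. Independence is inherited from the independence of the functions \<open>g \<mapsto> g b\<close>.\<close>

lemma free_basis_intersection:
  assumes noeth: "noetherian_ring A" and ic: "integrally_closed A"
    and K: "subgroup K G" and refl: "reflections A (carrier G) \<subseteq> K"
    and KH: "\<And>g. g \<in> carrier G \<Longrightarrow> \<exists>k\<in>K. \<exists>h\<in>H. g = k \<bullet> h"
  shows "free_basis (Inv K) (Inv (K \<inter> H)) B"
  unfolding free_basis_def
proof (intro conjI ballI impI)
  have KG: "K \<subseteq> carrier G" by (rule subgroup.subset[OF K])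
  show "B \<subseteq> Inv (K \<inter> H)" using B_Inv Inv_antimono[of "K \<inter> H" H] by blast
  fix x assume x: "x \<in> Inv (K \<inter> H)"
  have xc: "x \<in> carrier A" using x Inv_closed by blast
  \<comment> \<open>the factor \<open>k\<close> of \<open>g = k h\<close> is determined up to \<open>K \<inter> H\<close>, which fixes \<open>x\<close>\<close>
  define f where "f g = (SOME k. k \<in> K \<and> (\<exists>h\<in>H. g = k \<bullet> h)) x" for g
  have f: "f (k \<bullet> h) = k x" if k: "k \<in> K" and h: "h \<in> H" for k h
  proof -
    define k' where "k' = (SOME k'. k' \<in> K \<and> (\<exists>h'\<in>H. k \<bullet> h = k' \<bullet> h'))"
    have "k' \<in> K \<and> (\<exists>h'\<in>H. k \<bullet> h = k' \<bullet> h')"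
      unfolding k'_def by (rule someI[of _ k]) (use k h in blast)
    then obtain h' where k': "k' \<in> K" "h' \<in> H" "k \<bullet> h = k' \<bullet> h'" by blast
    have G: "k \<in> carrier G" "h \<in> carrier G" "k' \<in> carrier G" "h' \<in> carrier G"
      using k h k' KG HG by auto
    define u where "u = inv_G k \<bullet> k'"
    have "u = inv_G k \<bullet> (k' \<bullet> h') \<bullet> inv_G h'" using G by (simp add: u_def G.m_assoc)
    also have "\<dots> = h \<bullet> inv_G h'" unfolding k'(3)[symmetric] using G by (simp add: G.m_assoc[symmetric])
    finally have "u \<in> H" using subgroup.m_closed[OF H h subgroup.m_inv_closed[OF H k'(2)]] by simp
    moreover have "u \<in> K" unfolding u_def using subgroup.m_closed[OF K subgroup.m_inv_closed[OF K k] k'(1)] .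
    ultimately have ux: "u x = x" using Inv_fixed[OF x] by blast
    have "k' = k \<bullet> u" using G by (simp add: u_def G.m_assoc[symmetric])
    then have "k' x = k x" using act_mult[of k u x] ux G xc by (simp add: u_def)
    then show ?thesis by (simp add: f_def k'_def)
  qed
  have fc: "f \<in> carrier G \<rightarrow> carrier A"
  proof
    fix g assume "g \<in> carrier G"
    then obtain k h where "k \<in> K" "h \<in> H" "g = k \<bullet> h" using KH by blast
    then show "f g \<in> carrier A" using f KG xc by auto
  qed
  have f1: "f (i \<bullet> g) = i (f g)" if i: "i \<in> K" and g: "g \<in> carrier G" for i g
  proof -
    obtain k h where k: "k \<in> K" "h \<in> H" "g = k \<bullet> h" using KH g by blast
    have G: "i \<in> carrier G" "k \<in> carrier G" "h \<in> carrier G" using i k KG HG by auto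
    have "f (i \<bullet> g) = f ((i \<bullet> k) \<bullet> h)" using G k(3) by (simp add: G.m_assoc)
    also have "\<dots> = (i \<bullet> k) x" by (rule f[OF subgroup.m_closed[OF K i k(1)] k(2)])
    also have "\<dots> = i (f g)" using act_mult[OF G(1,2) xc] f[OF k(1,2)] k(3) by simp
    finally show ?thesis .
  qed
  have f2: "f (g \<bullet> h) = f g" if g: "g \<in> carrier G" and h: "h \<in> H" for g h
  proof -
    obtain k h' where k: "k \<in> K" "h' \<in> H" "g = k \<bullet> h'" using KH g by blast
    have G: "h \<in> carrier G" "k \<in> carrier G" "h' \<in> carrier G" using h k KG HG by auto
    have "f (g \<bullet> h) = f (k \<bullet> (h' \<bullet> h))" using G k(3) by (simp add: G.m_assoc)
    also have "\<dots> = f g" using f[OF k(1) subgroup.m_closed[OF H k(2) h]] f[OF k(1,2)] k(3) by simp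
    finally show ?thesis .
  qed
  obtain c where c: "c \<in> coeffs B (Inv K)" "\<And>g. g \<in> carrier G \<Longrightarrow> f g = lincomb B c g"
    using equivariant_expansion[OF noeth ic KG refl fc f1 f2] by blast
  have "x = f \<one>\<^bsub>G\<^esub>"
    using f[OF subgroup.one_closed[OF K] subgroup.one_closed[OF H]] xc by (simp add: act_one)
  also have "\<dots> = lincomb B c \<one>\<^bsub>G\<^esub>" by (rule c(2)) simp
  also have "\<dots> = lincomb B c (\<lambda>b. b)"
    using B_closed act_one coeffs_mem[OF Inv_coeffs[OF c(1)]] by (intro lincomb_cong) auto
  finally show "\<exists>c\<in>coeffs B (Inv K). x = lincomb B c (\<lambda>b. b)" using c(1) by blast
next
  have KG: "K \<subseteq> carrier G" by (rule subgroup.subset[OF K])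
  fix c b assume c: "c \<in> coeffs B (Inv K)" "lincomb B c (\<lambda>b. b) = \<zero>" and b: "b \<in> B"
  have cc: "c \<in> coeffs B (carrier A)" by (rule Inv_coeffs[OF c(1)])
  have "lincomb B c g = \<zero>" if g: "g \<in> carrier G" for g
  proof -
    obtain k h where k: "k \<in> K" "h \<in> H" "g = k \<bullet> h" using KH g by blast
    have G: "k \<in> carrier G" "h \<in> carrier G" using k KG HG by auto
    have gb: "g b = k b" if b: "b \<in> B" for b
    proof -
      have "h b = b" using Inv_fixed[OF _ k(2)] B_Inv b by blast
      then show ?thesis using act_mult[OF G B_closed[OF b]] k(3) by simp
    qed
    have "\<zero> = k (lincomb B c (\<lambda>b. b))" using c(2) G by simp
    also have "\<dots> = lincomb B (\<lambda>b. k (c b)) (\<lambda>b. k b)" by (rule act_lincomb[OF G(1) cc id_B])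
    also have "\<dots> = lincomb B c g"
      using gb Inv_fixed[OF coeffs_mem[OF c(1)] k(1)] act_B[OF g] coeffs_mem[OF cc] by (intro lincomb_cong) auto
    finally show ?thesis by simp
  qed
  then show "c b = \<zero>" using basis_independent[OF cc] b by blast
qed

end

section \<open>Homogeneous components\<close>

context graded_algebra
begin

definition component :: "'a \<Rightarrow> nat \<Rightarrow> 'a" where
  "component a = (THE c. (\<forall>i. c i \<in> gr i) \<and> finite {i. c i \<noteq> \<zero>} \<and> a = (\<Oplus>i\<in>{i. c i \<noteq> \<zero>}. c i))"

lemma gr_closed: "a \<in> gr i \<Longrightarrow> a \<in> carrier A"
  using subgroup.subset[OF gr_subgroup[of i]] by auto

lemma gr_zero_mem: "\<zero> \<in> gr i"
  using subgroup.one_closed[OF gr_subgroup[of i]] by simp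

lemma gr_add: "a \<in> gr i \<Longrightarrow> b \<in> gr i \<Longrightarrow> a \<oplus> b \<in> gr i"
  using subgroup.m_closed[OF gr_subgroup[of i]] by simp

lemma one_gr: "\<one> \<in> gr 0"
  using subringE(3)[OF subfieldE(1)[OF base_field]] by (simp add: gr_zero)

lemma component_props:
  assumes "a \<in> carrier A"
  shows "component a i \<in> gr i" "finite {i. component a i \<noteq> \<zero>}"
    "a = (\<Oplus>i\<in>{i. component a i \<noteq> \<zero>}. component a i)"
  using theI'[OF gr_direct_sum[OF assms]] unfolding component_def by blast+

lemma component_closed: "a \<in> carrier A \<Longrightarrow> component a i \<in> carrier A"
  using component_props gr_closed by blast

lemma component_eqI:
  assumes c: "\<And>i. c i \<in> gr i" and F: "finite F" "{i. c i \<noteq> \<zero>} \<subseteq> F" and a: "a = (\<Oplus>i\<in>F. c i)"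
  shows "component a = c"
proof -
  have cc: "c \<in> F \<rightarrow> carrier A" using c gr_closed by blast
  have "(\<Oplus>i\<in>{i. c i \<noteq> \<zero>}. c i) = (\<Oplus>i\<in>F. c i)"
    using F cc by (intro add.finprod_mono_neutral_cong_left) auto
  then have *: "(\<forall>i. c i \<in> gr i) \<and> finite {i. c i \<noteq> \<zero>} \<and> a = (\<Oplus>i\<in>{i. c i \<noteq> \<zero>}. c i)"
    using a c F finite_subset by auto
  have ac: "a \<in> carrier A" unfolding a using cc by (rule finsum_closed)
  let ?P = "\<lambda>c. (\<forall>i. c i \<in> gr i) \<and> finite {i. c i \<noteq> \<zero>} \<and> a = (\<Oplus>i\<in>{i. c i \<noteq> \<zero>}. c i)"
  show ?thesis unfolding component_def by (rule the1_equality[of ?P, OF gr_direct_sum[OF ac] *])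
qed

lemma component_sum:
  assumes "a \<in> carrier A" "finite F" "{i. component a i \<noteq> \<zero>} \<subseteq> F"
  shows "a = (\<Oplus>i\<in>F. component a i)"
proof -
  have "(\<Oplus>i\<in>{i. component a i \<noteq> \<zero>}. component a i) = (\<Oplus>i\<in>F. component a i)"
    using assms component_closed by (intro add.finprod_mono_neutral_cong_left) auto
  then show ?thesis using component_props(3)[OF assms(1)] by simp
qed

lemma component_add:
  assumes "a \<in> carrier A" "b \<in> carrier A"
  shows "component (a \<oplus> b) i = component a i \<oplus> component b i"
proof -
  let ?F = "{i. component a i \<noteq> \<zero>} \<union> {i. component b i \<noteq> \<zero>}"
  have "a \<oplus> b = (\<Oplus>i\<in>?F. component a i) \<oplus> (\<Oplus>i\<in>?F. component b i)"
    using component_sum[OF assms(1), of ?F] component_sum[OF assms(2), of ?F]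
      component_props(2)[OF assms(1)] component_props(2)[OF assms(2)] by simp
  also have "\<dots> = (\<Oplus>i\<in>?F. component a i \<oplus> component b i)"
    using assms component_closed by (intro finsum_addf[symmetric]) auto
  finally have "component (a \<oplus> b) = (\<lambda>i. component a i \<oplus> component b i)"
    using component_props[OF assms(1)] component_props[OF assms(2)] gr_add
    by (intro component_eqI[of _ ?F]) auto
  then show ?thesis by simp
qed

lemma component_homogeneous:
  assumes "a \<in> gr i" shows "component a j = (if j = i then a else \<zero>)"
proof -
  have "component a = (\<lambda>j. if j = i then a else \<zero>)"
    using assms gr_zero_mem gr_closed[OF assms] by (intro component_eqI[of _ "{i}"]) auto
  then show ?thesis by simp
qed

lemma component_zero: "component \<zero> j = \<zero>"
  using component_homogeneous[OF gr_zero_mem[of j], of j] by simp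

lemma component_finsum:
  assumes "finite S" "f \<in> S \<rightarrow> carrier A"
  shows "component (\<Oplus>s\<in>S. f s) j = (\<Oplus>s\<in>S. component (f s) j)"
  using assms
proof (induction S rule: finite_induct)
  case empty
  then show ?case by (simp add: component_zero)
next
  case (insert x S)
  then have "(\<lambda>s. component (f s) j) \<in> insert x S \<rightarrow> carrier A" using component_closed by auto
  then show ?case using insert by (simp add: component_add finsum_closed)
qed

lemma component_mult:
  assumes a: "a \<in> carrier A" and b: "b \<in> gr n"
  shows "component (a \<otimes> b) j = (if n \<le> j then component a (j - n) \<otimes> b else \<zero>)"
proof -
  let ?c = "\<lambda>j. if n \<le> j then component a (j - n) \<otimes> b else \<zero>"
  let ?S = "{i. component a i \<noteq> \<zero>}"
  have bc: "b \<in> carrier A" using gr_closed[OF b] .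
  have fin: "finite ?S" using component_props(2)[OF a] .
  have "a \<otimes> b = (\<Oplus>i\<in>?S. component a i) \<otimes> b" using component_props(3)[OF a] by simp
  also have "\<dots> = (\<Oplus>i\<in>?S. component a i \<otimes> b)"
    using fin bc component_closed[OF a] by (intro finsum_ldistr) auto
  also have "\<dots> = (\<Oplus>i\<in>?S. ?c (i + n))" by simp
  also have "\<dots> = (\<Oplus>j\<in>(\<lambda>i. i + n) ` ?S. ?c j)"
    using bc component_closed[OF a] by (intro finsum_reindex[symmetric]) (auto simp: inj_on_def)
  finally have eq: "a \<otimes> b = (\<Oplus>j\<in>(\<lambda>i. i + n) ` ?S. ?c j)" .
  have "component (a \<otimes> b) = ?c"
  proof (rule component_eqI[OF _ _ _ eq])
    show "finite ((\<lambda>i. i + n) ` ?S)" using fin by simp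
    show "{i. ?c i \<noteq> \<zero>} \<subseteq> (\<lambda>i. i + n) ` ?S"
    proof
      fix i assume "i \<in> {i. ?c i \<noteq> \<zero>}"
      then have i: "?c i \<noteq> \<zero>" by simp
      then have n: "n \<le> i" by (rule contrapos_np) simp
      then have "component a (i - n) \<noteq> \<zero>" using i bc by auto
      then show "i \<in> (\<lambda>i. i + n) ` ?S" using n by (intro image_eqI[of _ _ "i - n"]) auto
    qed
    show "?c i \<in> gr i" for i
      using gr_mult[OF component_props(1)[OF a] b, of "i - n"] gr_zero_mem by auto
  qed
  then show ?thesis by simp
qed

end

locale graded_action = graded_algebra + faithful_ring_action +
  assumes act_gr: "\<rho> \<in> carrier G \<Longrightarrow> a \<in> gr i \<Longrightarrow> \<rho> a \<in> gr i"
    and act_base: "\<rho> \<in> carrier G \<Longrightarrow> a \<in> k \<Longrightarrow> \<rho> a = a"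
begin

lemma component_act:
  assumes r: "\<rho> \<in> carrier G" and a: "a \<in> carrier A"
  shows "component (\<rho> a) i = \<rho> (component a i)"
proof -
  have "\<rho> a = \<rho> (\<Oplus>i\<in>{i. component a i \<noteq> \<zero>}. component a i)"
    by (rule arg_cong[where f = \<rho>, OF component_props(3)[OF a]])
  also have "\<dots> = (\<Oplus>i\<in>{i. component a i \<noteq> \<zero>}. \<rho> (component a i))"
    using component_closed[OF a] by (intro act_finsum[OF r]) auto
  finally have "\<rho> a = (\<Oplus>i\<in>{i. component a i \<noteq> \<zero>}. \<rho> (component a i))" .
  then have "component (\<rho> a) = (\<lambda>i. \<rho> (component a i))"
    using component_props[OF a] act_gr[OF r] r by (intro component_eqI) auto
  then show ?thesis by simp
qed

lemma component_Inv:
  assumes I: "I \<subseteq> carrier G" and a: "a \<in> Inv I" shows "component a i \<in> Inv I"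
proof -
  have "\<rho> (component a i) = component a i" if "\<rho> \<in> I" for \<rho>
    using component_act[of \<rho> a i] that I Inv_fixed[OF a that] Inv_closed[OF a] by auto
  then show ?thesis using component_closed[OF Inv_closed[OF a]] by (simp add: Inv_def)
qed

lemma base_Inv: "I \<subseteq> carrier G \<Longrightarrow> k \<subseteq> Inv I"
  using act_base subfieldE(3)[OF base_field] by (auto simp: Inv_def)

end

locale graded_free_invariants = graded_action + free_invariants +
  assumes homogeneous: "b \<in> B \<Longrightarrow> \<exists>i. b \<in> gr i"
begin

text \<open>Basis elements of positive degree contribute nothing to the component of degree zero, and those of
  degree zero lie in \<open>k\<close> and are fixed by the group.\<close>

lemma component_zero_constant:
  assumes c: "c \<in> coeffs B (carrier A)" and g: "g \<in> carrier G" "g' \<in> carrier G"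
  shows "component (lincomb B c g) 0 = component (lincomb B c g') 0"
proof -
  let ?F = "{b \<in> B. c b \<noteq> \<zero>}"
  have fin: "finite ?F" using c by (simp add: coeffs_def)
  have c0: "component (c b \<otimes> x b) 0 = (if b \<in> gr 0 then component (c b) 0 \<otimes> b else \<zero>)"
    if b: "b \<in> B" and x: "x \<in> carrier G" for b x
  proof -
    obtain n where n: "b \<in> gr n" using homogeneous[OF b] by blast
    have *: "component (c b \<otimes> x b) 0 = (if n = 0 then component (c b) 0 \<otimes> x b else \<zero>)"
      using component_mult[OF coeffs_mem[OF c b] act_gr[OF x n], of 0] by simp
    show ?thesis
    proof (cases "b \<in> gr 0")
      case True
      then have "x b = b" using act_base[OF x] gr_zero by simp
      moreover have "component (c b \<otimes> x b) 0 = component (c b) 0 \<otimes> x b"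
        using component_mult[OF coeffs_mem[OF c b] act_gr[OF x True], of 0] by simp
      ultimately show ?thesis using True by simp
    next
      case False
      then have "n \<noteq> 0" using n by (intro notI) simp
      then show ?thesis using * False by simp
    qed
  qed
  have "component (lincomb B c x) 0 = (\<Oplus>b\<in>?F. if b \<in> gr 0 then component (c b) 0 \<otimes> b else \<zero>)"
    if x: "x \<in> carrier G" for x
  proof -
    have cl: "(\<lambda>b. c b \<otimes> x b) \<in> ?F \<rightarrow> carrier A" using coeffs_mem[OF c] act_B[OF x] by auto
    have "component (lincomb B c x) 0 = (\<Oplus>b\<in>?F. component (c b \<otimes> x b) 0)"
      unfolding lincomb_def by (rule component_finsum[OF fin cl])
    also have "\<dots> = (\<Oplus>b\<in>?F. if b \<in> gr 0 then component (c b) 0 \<otimes> b else \<zero>)"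
      using c0[OF _ x] component_closed coeffs_mem[OF c] B_closed by (intro finsum_cong') auto
    finally show ?thesis .
  qed
  then show ?thesis using g by simp
qed

text \<open>The indicator function of \<open>K H\<close> takes values in degree zero, but there every combination of the
  functions \<open>g \<mapsto> g b\<close> is constant.\<close>

theorem product_decomposition:
  assumes noeth: "noetherian_ring A" and ic: "integrally_closed A"
    and K: "subgroup K G" and refl: "reflections A (carrier G) \<subseteq> K" and g: "g \<in> carrier G"
  shows "\<exists>k\<in>K. \<exists>h\<in>H. g = k \<bullet> h"
proof (rule ccontr)
  assume no: "\<not> ?thesis"
  have KG: "K \<subseteq> carrier G" by (rule subgroup.subset[OF K])
  let ?D = "\<lambda>g. \<exists>k\<in>K. \<exists>h\<in>H. g = k \<bullet> h"
  define f where "f g = (if ?D g then \<one> else \<zero>)" for g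
  have D_mult: "?D (i \<bullet> g \<bullet> j)" if D: "?D g" and i: "i \<in> K" and j: "j \<in> H" for g i j
  proof -
    obtain k h where k: "k \<in> K" "h \<in> H" "g = k \<bullet> h" using D by blast
    have "i \<bullet> g \<bullet> j = (i \<bullet> k) \<bullet> (h \<bullet> j)"
      unfolding k(3) using i j k(1,2) KG HG by (simp add: G.m_assoc subset_iff)
    then show ?thesis using subgroup.m_closed[OF K i k(1)] subgroup.m_closed[OF H k(2) j] by blast
  qed
  have D_iff: "?D (i \<bullet> g \<bullet> j) \<longleftrightarrow> ?D g" if i: "i \<in> K" and j: "j \<in> H" and g: "g \<in> carrier G" for g i j
  proof
    assume "?D (i \<bullet> g \<bullet> j)"
    then have "?D (inv_G i \<bullet> (i \<bullet> g \<bullet> j) \<bullet> inv_G j)"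
      by (rule D_mult[OF _ subgroup.m_inv_closed[OF K i] subgroup.m_inv_closed[OF H j]])
    moreover have ij: "i \<in> carrier G" "j \<in> carrier G" using i j KG HG by auto
    then have "inv_G i \<bullet> (i \<bullet> g \<bullet> j) = g \<bullet> j" using g by (simp add: G.m_assoc[symmetric])
    then have "inv_G i \<bullet> (i \<bullet> g \<bullet> j) \<bullet> inv_G j = g" using ij g by (simp add: G.m_assoc)
    ultimately show "?D g" by simp
  qed (rule D_mult[OF _ i j])
  have f1: "f (i \<bullet> g) = i (f g)" if i: "i \<in> K" and g: "g \<in> carrier G" for i g
  proof -
    have iG: "i \<in> carrier G" using i KG by blast
    then have "i \<bullet> g \<bullet> \<one>\<^bsub>G\<^esub> = i \<bullet> g" using g by simp
    then show ?thesis using D_iff[OF i subgroup.one_closed[OF H] g] iG by (simp add: f_def)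
  qed
  have f2: "f (g \<bullet> i) = f g" if g: "g \<in> carrier G" and i: "i \<in> H" for g i
  proof -
    have "\<one>\<^bsub>G\<^esub> \<bullet> g \<bullet> i = g \<bullet> i" using g by simp
    then show ?thesis using D_iff[OF subgroup.one_closed[OF K] i g] by (simp add: f_def)
  qed
  have "f \<in> carrier G \<rightarrow> carrier A" by (auto simp: f_def)
  then obtain c where c: "c \<in> coeffs B (Inv K)" "\<And>g. g \<in> carrier G \<Longrightarrow> f g = lincomb B c g"
    using equivariant_expansion[OF noeth ic KG refl _ f1 f2] by blast
  have "component (f \<one>\<^bsub>G\<^esub>) 0 = component (f g) 0"
    using component_zero_constant[OF Inv_coeffs[OF c(1)], of "\<one>\<^bsub>G\<^esub>" g] c(2) g by simp
  moreover have "f g = \<zero>" using no by (simp add: f_def)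
  moreover have "\<exists>k\<in>K. \<exists>h\<in>H. \<one>\<^bsub>G\<^esub> = k \<bullet> h"
    using subgroup.one_closed[OF K] subgroup.one_closed[OF H] G.l_one[OF G.one_closed] by metis
  then have "f \<one>\<^bsub>G\<^esub> = \<one>" by (simp add: f_def)
  ultimately show False using component_homogeneous[OF one_gr, of 0] component_zero[of 0] by simp
qed

end

section \<open>The ring of formal sums of pairs\<close>

lemma frag_extend_fun_add: "frag_extend (\<lambda>x. f x + g x) p = frag_extend f p + frag_extend g p"
  by (simp add: frag_extend_def frag_cmul_distrib2 sum.distrib)

lemma frag_extend_fun_minus: "frag_extend (\<lambda>x. - f x) p = - frag_extend f p"
proof -
  have "frag_extend (\<lambda>x. - f x) p + frag_extend f p = frag_extend (\<lambda>x. 0) p"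
    using frag_extend_fun_add[of "\<lambda>x. - f x" f p] by simp
  then show ?thesis by (simp add: frag_extend_eq_0 eq_neg_iff_add_eq_0)
qed

text \<open>The bilinear extension of an operation on the index set, as it occurs in \<^const>\<open>pair_ring\<close>. Its
  algebraic laws follow from those of the operation by induction over formal sums.\<close>

definition frag_mult :: "('c \<Rightarrow> 'c \<Rightarrow> 'c) \<Rightarrow> ('c \<Rightarrow>\<^sub>0 int) \<Rightarrow> ('c \<Rightarrow>\<^sub>0 int) \<Rightarrow> ('c \<Rightarrow>\<^sub>0 int)" where
  "frag_mult m p q = frag_extend (\<lambda>x. frag_extend (\<lambda>y. frag_of (m x y)) q) p"

lemma frag_mult_simps:
  "frag_mult m 0 q = 0" "frag_mult m p 0 = 0"
  "frag_mult m (p + p') q = frag_mult m p q + frag_mult m p' q"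
  "frag_mult m p (q + q') = frag_mult m p q + frag_mult m p q'"
  "frag_mult m (p - p') q = frag_mult m p q - frag_mult m p' q"
  "frag_mult m p (q - q') = frag_mult m p q - frag_mult m p q'"
  "frag_mult m (frag_of x) (frag_of y) = frag_of (m x y)"
proof -
  show 4: "frag_mult m p (q + q') = frag_mult m p q + frag_mult m p q'" for q q'
    by (simp add: frag_mult_def frag_extend_add frag_extend_fun_add)
  have "frag_mult m p (- q') = - frag_mult m p q'"
    by (simp add: frag_mult_def frag_extend_minus frag_extend_fun_minus)
  then show "frag_mult m p (q - q') = frag_mult m p q - frag_mult m p q'"
    using 4[of q "- q'"] by simp
qed (simp_all add: frag_mult_def frag_extend_add frag_extend_diff frag_extend_eq_0)

lemma frag_mult_keys:
  assumes "Poly_Mapping.keys p \<subseteq> S" "Poly_Mapping.keys q \<subseteq> S" "\<And>x y. x \<in> S \<Longrightarrow> y \<in> S \<Longrightarrow> m x y \<in> S"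
  shows "Poly_Mapping.keys (frag_mult m p q) \<subseteq> S"
proof -
  have "Poly_Mapping.keys (frag_extend (\<lambda>y. frag_of (m x y)) q) \<subseteq> S" if "x \<in> S" for x
  proof (rule order_trans[OF keys_frag_extend], rule UN_least)
    fix y assume "y \<in> Poly_Mapping.keys q"
    then show "Poly_Mapping.keys (frag_of (m x y)) \<subseteq> S" using assms(2,3) that by auto
  qed
  then have "(\<Union>x\<in>Poly_Mapping.keys p. Poly_Mapping.keys (frag_extend (\<lambda>y. frag_of (m x y)) q)) \<subseteq> S"
    using assms(1) by blast
  then show ?thesis unfolding frag_mult_def by (rule order_trans[OF keys_frag_extend])
qed

lemma frag_mult_comm:
  assumes "Poly_Mapping.keys p \<subseteq> S" "Poly_Mapping.keys q \<subseteq> S"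
    and comm: "\<And>x y. x \<in> S \<Longrightarrow> y \<in> S \<Longrightarrow> m x y = m y x"
  shows "frag_mult m p q = frag_mult m q p"
  using assms(1)
proof (induction p rule: free_Abelian_group_induct[where S = S, consumes 1, case_names zero diff of])
  case (of a)
  show ?case using assms(2)
    by (induction q rule: free_Abelian_group_induct[where S = S, consumes 1, case_names zero diff of]) (use of comm in \<open>auto simp: frag_mult_simps\<close>)
qed (simp_all add: frag_mult_simps)

lemma frag_mult_assoc:
  assumes "Poly_Mapping.keys p \<subseteq> S" "Poly_Mapping.keys q \<subseteq> S" "Poly_Mapping.keys r \<subseteq> S"
    and assoc: "\<And>x y z. x \<in> S \<Longrightarrow> y \<in> S \<Longrightarrow> z \<in> S \<Longrightarrow> m (m x y) z = m x (m y z)"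
  shows "frag_mult m (frag_mult m p q) r = frag_mult m p (frag_mult m q r)"
  using assms(1)
proof (induction p rule: free_Abelian_group_induct[where S = S, consumes 1, case_names zero diff of])
  case (of a)
  note a = of
  show ?case using assms(2)
  proof (induction q rule: free_Abelian_group_induct[where S = S, consumes 1, case_names zero diff of])
    case (of b)
    note b = of
    show ?case using assms(3)
      by (induction r rule: free_Abelian_group_induct[where S = S, consumes 1, case_names zero diff of]) (use a b assoc in \<open>auto simp: frag_mult_simps\<close>)
  qed (simp_all add: frag_mult_simps)
qed (simp_all add: frag_mult_simps)

lemma frag_mult_one:
  assumes "Poly_Mapping.keys p \<subseteq> S" "\<And>x. x \<in> S \<Longrightarrow> m e x = x"
  shows "frag_mult m (frag_of e) p = p"
  using assms(1)
  by (induction p rule: free_Abelian_group_induct[where S = S, consumes 1, case_names zero diff of]) (use assms(2) in \<open>auto simp: frag_mult_simps\<close>)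

definition pair_mult :: "('a, 'm) ring_scheme \<Rightarrow> ('a, 'm) ring_scheme \<Rightarrow> 'a \<times> 'a \<Rightarrow> 'a \<times> 'a \<Rightarrow> 'a \<times> 'a" where
  "pair_mult S T x y = (fst x \<otimes>\<^bsub>S\<^esub> fst y, snd x \<otimes>\<^bsub>T\<^esub> snd y)"

lemma pair_ring_simps:
  "carrier (pair_ring S T) = {p. Poly_Mapping.keys p \<subseteq> carrier S \<times> carrier T}"
  "p \<otimes>\<^bsub>pair_ring S T\<^esub> q = frag_mult (pair_mult S T) p q"
  "\<one>\<^bsub>pair_ring S T\<^esub> = frag_of (\<one>\<^bsub>S\<^esub>, \<one>\<^bsub>T\<^esub>)" "\<zero>\<^bsub>pair_ring S T\<^esub> = 0"
  "p \<oplus>\<^bsub>pair_ring S T\<^esub> q = p + q"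
  by (auto simp: pair_ring_def frag_mult_def pair_mult_def split_beta' free_Abelian_group_def)

lemma pair_ring_cring:
  assumes "cring S" "cring T" shows "cring (pair_ring S T)"
proof -
  interpret S: cring S by fact
  interpret T: cring T by fact
  let ?P = "carrier S \<times> carrier T"
  show ?thesis
  proof (rule cringI)
    show "abelian_group (pair_ring S T)"
    proof (rule abelian_groupI)
      fix x y assume "x \<in> carrier (pair_ring S T)" "y \<in> carrier (pair_ring S T)"
      then show "x \<oplus>\<^bsub>pair_ring S T\<^esub> y \<in> carrier (pair_ring S T)"
        using keys_add[of x y] by (auto simp: pair_ring_simps)
    next
      fix x assume "x \<in> carrier (pair_ring S T)"
      then show "\<exists>y\<in>carrier (pair_ring S T). y \<oplus>\<^bsub>pair_ring S T\<^esub> x = \<zero>\<^bsub>pair_ring S T\<^esub>"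
        by (intro bexI[of _ "- x"]) (auto simp: pair_ring_simps keys_minus)
    qed (auto simp: pair_ring_simps)
    show "comm_monoid (pair_ring S T)"
    proof (rule comm_monoidI)
      fix x y z assume "x \<in> carrier (pair_ring S T)" "y \<in> carrier (pair_ring S T)" "z \<in> carrier (pair_ring S T)"
      then show "x \<otimes>\<^bsub>pair_ring S T\<^esub> y \<otimes>\<^bsub>pair_ring S T\<^esub> z = x \<otimes>\<^bsub>pair_ring S T\<^esub> (y \<otimes>\<^bsub>pair_ring S T\<^esub> z)"
        unfolding pair_ring_simps
        by (intro frag_mult_assoc[of _ ?P]) (auto simp: pair_mult_def S.m_assoc T.m_assoc)
    next
      fix x y assume xy: "x \<in> carrier (pair_ring S T)" "y \<in> carrier (pair_ring S T)"
      then show "x \<otimes>\<^bsub>pair_ring S T\<^esub> y = y \<otimes>\<^bsub>pair_ring S T\<^esub> x"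
        unfolding pair_ring_simps
        by (intro frag_mult_comm[of _ ?P]) (auto simp: pair_mult_def S.m_comm T.m_comm)
      show "x \<otimes>\<^bsub>pair_ring S T\<^esub> y \<in> carrier (pair_ring S T)"
        using xy frag_mult_keys[of x ?P y "pair_mult S T"] by (auto simp: pair_ring_simps pair_mult_def)
    next
      fix x assume "x \<in> carrier (pair_ring S T)"
      then show "\<one>\<^bsub>pair_ring S T\<^esub> \<otimes>\<^bsub>pair_ring S T\<^esub> x = x"
        unfolding pair_ring_simps by (intro frag_mult_one[of _ ?P]) (auto simp: pair_mult_def)
    qed (simp add: pair_ring_simps)
  qed (simp add: pair_ring_simps frag_mult_simps)
qed


section \<open>The tensor product with a free module\<close>

context cring
begin

context
  fixes M N L U B :: "'a set"
  assumes M: "subring M R" and N: "subring N R" and L: "subring L R" and U: "subring U R"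
    and MsubN: "M \<subseteq> N" and MsubL: "M \<subseteq> L" and NU: "N \<subseteq> U" and LU: "L \<subseteq> U"
    and BL: "free_basis M L B" and BU: "free_basis N U B"
begin

abbreviation (input) "RM \<equiv> R\<lparr>carrier := M\<rparr>"
abbreviation (input) "RN \<equiv> R\<lparr>carrier := N\<rparr>"
abbreviation (input) "RL \<equiv> R\<lparr>carrier := L\<rparr>"
abbreviation (input) "RU \<equiv> R\<lparr>carrier := U\<rparr>"
abbreviation (input) "pairs \<equiv> pair_ring RN RL"
abbreviation (input) "rels \<equiv> tensor_relations RM RN RL"

lemma subrings_closed: "M \<subseteq> carrier R" "N \<subseteq> carrier R" "L \<subseteq> carrier R" "U \<subseteq> carrier R" "B \<subseteq> L"
  using subringE(1)[OF M] subringE(1)[OF N] subringE(1)[OF L] subringE(1)[OF U] BL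
  by (auto simp: free_basis_def)

lemma tensor_generators:
  "{frag_of (s \<oplus>\<^bsub>RN\<^esub> s', t) - frag_of (s, t) - frag_of (s', t) | s s' t.
         s \<in> carrier RN \<and> s' \<in> carrier RN \<and> t \<in> carrier RL} \<union>
      {frag_of (s, t \<oplus>\<^bsub>RL\<^esub> t') - frag_of (s, t) - frag_of (s, t') | s t t'.
         s \<in> carrier RN \<and> t \<in> carrier RL \<and> t' \<in> carrier RL} \<union>
      {frag_of (s \<otimes>\<^bsub>RN\<^esub> r, t) - frag_of (s, r \<otimes>\<^bsub>RL\<^esub> t) | r s t.
         r \<in> carrier RM \<and> s \<in> carrier RN \<and> t \<in> carrier RL} \<subseteq> {p. Poly_Mapping.keys p \<subseteq> N \<times> L}"
  (is "?g1 \<union> ?g2 \<union> ?g3 \<subseteq> _")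
proof -
  have k: "Poly_Mapping.keys (frag_of x - frag_of y) \<subseteq> N \<times> L" if "x \<in> N \<times> L" "y \<in> N \<times> L" for x y :: "'a \<times> 'a"
    using keys_diff[of "frag_of x" "frag_of y"] that by auto
  have k3: "Poly_Mapping.keys (frag_of x - frag_of y - frag_of z) \<subseteq> N \<times> L"
    if "x \<in> N \<times> L" "y \<in> N \<times> L" "z \<in> N \<times> L" for x y z :: "'a \<times> 'a"
    using keys_diff[of "frag_of x - frag_of y" "frag_of z"] k[OF that(1,2)] that by auto
  have "?g1 \<subseteq> {p. Poly_Mapping.keys p \<subseteq> N \<times> L}" "?g2 \<subseteq> {p. Poly_Mapping.keys p \<subseteq> N \<times> L}"
    by (rule subsetI, elim CollectE exE conjE, hypsubst, rule CollectI, rule k3;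
        use subringE(7)[OF N] subringE(7)[OF L] in simp)+
  moreover have "?g3 \<subseteq> {p. Poly_Mapping.keys p \<subseteq> N \<times> L}"
    by (rule subsetI, elim CollectE exE conjE, hypsubst, rule CollectI, rule k;
        use subringE(6)[OF N] subringE(6)[OF L] MsubN MsubL in \<open>simp add: subset_iff\<close>)
  ultimately show ?thesis by blast
qed

lemma rels_subgroup: "subgroup rels (free_Abelian_group (N \<times> L))"
  unfolding tensor_relations_def
  using group.generate_is_subgroup[OF group_free_Abelian_group[of "N \<times> L"], OF order_trans[OF tensor_generators]]
  by (simp add: free_Abelian_group_def)

lemma rels_add: "p \<in> rels \<Longrightarrow> q \<in> rels \<Longrightarrow> p + q \<in> rels"
  using subgroup.m_closed[OF rels_subgroup] by simp

lemma rels_zero: "0 \<in> rels"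
  using subgroup.one_closed[OF rels_subgroup] by simp

lemma rels_uminus: "p \<in> rels \<Longrightarrow> - p \<in> rels"
  using subgroup.m_inv_closed[OF rels_subgroup, of p] subgroup.subset[OF rels_subgroup] by auto

lemma rels_diff: "p \<in> rels \<Longrightarrow> q \<in> rels \<Longrightarrow> p - q \<in> rels"
  using rels_add[OF _ rels_uminus, of p q] by simp

lemma rels_sum: "finite S \<Longrightarrow> (\<And>i. i \<in> S \<Longrightarrow> f i \<in> rels) \<Longrightarrow> sum f S \<in> rels"
  by (induction S rule: finite_induct) (auto simp: rels_zero rels_add)

lemma rels_left: "s \<in> N \<Longrightarrow> s' \<in> N \<Longrightarrow> t \<in> L \<Longrightarrow> frag_of (s \<oplus> s', t) - frag_of (s, t) - frag_of (s', t) \<in> rels"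
  and rels_right: "s \<in> N \<Longrightarrow> t \<in> L \<Longrightarrow> t' \<in> L \<Longrightarrow> frag_of (s, t \<oplus> t') - frag_of (s, t) - frag_of (s, t') \<in> rels"
  and rels_middle: "r \<in> M \<Longrightarrow> s \<in> N \<Longrightarrow> t \<in> L \<Longrightarrow> frag_of (s \<otimes> r, t) - frag_of (s, r \<otimes> t) \<in> rels"
  unfolding tensor_relations_def by (rule generate.incl; force)+

text \<open>The second entries are restricted to the basis. This leaves no choice for the first entries once
  the value \<open>\<Sum> c b \<cdot> b\<close> is given.\<close>

definition normal_form :: "('a \<Rightarrow> 'a) \<Rightarrow> ('a \<times> 'a) \<Rightarrow>\<^sub>0 int" where
  "normal_form c = (\<Sum>b\<in>{b \<in> B. c b \<noteq> \<zero>}. frag_of (c b, b))"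

lemma normal_form_superset:
  assumes "c \<in> coeffs B N" "finite F" "{b \<in> B. c b \<noteq> \<zero>} \<subseteq> F" "F \<subseteq> B"
  shows "(\<Sum>b\<in>F. frag_of (c b, b)) - normal_form c \<in> rels"
proof -
  let ?S = "{b \<in> B. c b \<noteq> \<zero>}"
  have "(\<Sum>b\<in>F. frag_of (c b, b)) = (\<Sum>b\<in>F - ?S. frag_of (c b, b)) + normal_form c"
    using sum.subset_diff[OF assms(3,2), of "\<lambda>b. frag_of (c b, b)"] by (simp add: normal_form_def)
  moreover have "frag_of (c b, b) \<in> rels" if b: "b \<in> F - ?S" for b
  proof -
    have "c b = \<zero>" "b \<in> L" using b assms(4) subrings_closed(5) by auto
    moreover have "frag_of (\<zero> \<oplus> \<zero>, b) - frag_of (\<zero>, b) - frag_of (\<zero>, b) \<in> rels" if "b \<in> L" for b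
      using rels_left[OF subringE(2)[OF N] subringE(2)[OF N] that] .
    then have "- frag_of (\<zero>, b) \<in> rels" if "b \<in> L" for b using that by fastforce
    ultimately show ?thesis using rels_uminus by fastforce
  qed
  ultimately show ?thesis using assms(2) by (auto intro!: rels_sum)
qed

text \<open>Modulo the relations, the second entry of a pair is expanded in the basis, and its coefficients are
  moved to the first entry.\<close>

lemma normal_form_exists:
  assumes "Poly_Mapping.keys p \<subseteq> N \<times> L" shows "\<exists>c\<in>coeffs B N. p - normal_form c \<in> rels"
  using assms
proof (induction p rule: free_Abelian_group_induct[where S = "N \<times> L", consumes 1, case_names zero diff of])
  case zero
  have "normal_form (\<lambda>_. \<zero>) = 0" by (simp add: normal_form_def)
  then show ?case using rels_zero subringE(2)[OF N] by (intro bexI[of _ "\<lambda>_. \<zero>"]) (auto simp: coeffs_def)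
next
  case (diff p q)
  then obtain c d where c: "c \<in> coeffs B N" "p - normal_form c \<in> rels" and d: "d \<in> coeffs B N" "q - normal_form d \<in> rels"
    by blast
  have cd: "c b \<in> N" "d b \<in> N" "c b \<in> carrier R" "d b \<in> carrier R" if "b \<in> B" for b
    using coeffs_mem[OF c(1) that] coeffs_mem[OF d(1) that] subrings_closed by auto
  define e where "e b = c b \<oplus> \<ominus> d b" for b
  have eN: "e b \<in> N" if "b \<in> B" for b
    using cd[OF that] subringE(5,7)[OF N] by (auto simp: e_def)
  let ?F = "{b \<in> B. c b \<noteq> \<zero>} \<union> {b \<in> B. d b \<noteq> \<zero>}"
  have F: "finite ?F" "?F \<subseteq> B" using c d by (auto simp: coeffs_def)
  have Fe: "{b \<in> B. e b \<noteq> \<zero>} \<subseteq> ?F" by (auto simp: e_def)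
  then have e: "e \<in> coeffs B N" using eN F finite_subset by (auto simp: coeffs_def)
  have "frag_of (c b, b) - frag_of (e b, b) - frag_of (d b, b) \<in> rels" if b: "b \<in> ?F" for b
  proof -
    have bB: "b \<in> B" using b F by blast
    have "e b \<oplus> d b = c b" using cd[OF bB] by (simp add: e_def a_assoc l_neg)
    then show ?thesis using rels_left[OF eN[OF bB] cd(2)[OF bB], of b] bB subrings_closed(5) by auto
  qed
  then have "(\<Sum>b\<in>?F. frag_of (c b, b) - frag_of (e b, b) - frag_of (d b, b)) \<in> rels" using F by (intro rels_sum) auto
  then have 1: "(\<Sum>b\<in>?F. frag_of (c b, b)) - (\<Sum>b\<in>?F. frag_of (e b, b)) - (\<Sum>b\<in>?F. frag_of (d b, b)) \<in> rels"
    by (simp add: sum_subtractf)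
  note nc = normal_form_superset[OF c(1) F(1) _ F(2)] and nd = normal_form_superset[OF d(1) F(1) _ F(2)]
    and ne = normal_form_superset[OF e F(1) Fe F(2)]
  have "p - q - normal_form e = (p - normal_form c) - (q - normal_form d)
      - ((\<Sum>b\<in>?F. frag_of (c b, b)) - normal_form c) + ((\<Sum>b\<in>?F. frag_of (d b, b)) - normal_form d)
      + ((\<Sum>b\<in>?F. frag_of (c b, b)) - (\<Sum>b\<in>?F. frag_of (e b, b)) - (\<Sum>b\<in>?F. frag_of (d b, b)))
      + ((\<Sum>b\<in>?F. frag_of (e b, b)) - normal_form e)" by (simp add: algebra_simps)
  moreover have "\<dots> \<in> rels"
    by (rule rels_add[OF rels_add[OF rels_add[OF rels_diff[OF rels_diff[OF c(2) d(2)] nc[OF Un_upper1]]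
          nd[OF Un_upper2]] 1] ne])
  ultimately have "p - q - normal_form e \<in> rels" by (simp only:)
  then show ?case using e by blast
next
  case (of x)
  then obtain s t where x: "x = (s, t)" "s \<in> N" "t \<in> L" by blast
  obtain r where r: "r \<in> coeffs B M" "t = lincomb B r (\<lambda>b. b)" using BL x by (auto simp: free_basis_def)
  have sum: "frag_of (s, \<Oplus>b\<in>F. r b \<otimes> b) - (\<Sum>b\<in>F. frag_of (s \<otimes> r b, b)) \<in> rels \<and> (\<Oplus>b\<in>F. r b \<otimes> b) \<in> L"
    if "finite F" "F \<subseteq> B" for F
    using that
  proof (induction F rule: finite_induct)
    case empty
    have "frag_of (s, \<zero> \<oplus> \<zero>) - frag_of (s, \<zero>) - frag_of (s, \<zero>) \<in> rels"
      using rels_right[OF x(2) subringE(2)[OF L] subringE(2)[OF L]] .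
    then have "- frag_of (s, \<zero>) \<in> rels" by simp
    then have "frag_of (s, \<zero>) \<in> rels" using rels_uminus by fastforce
    then show ?case using subringE(2)[OF L] by simp
  next
    case (insert b F)
    have b: "b \<in> B" "b \<in> L" "r b \<in> M" using insert coeffs_mem[OF r(1)] subrings_closed by auto
    have rb: "r b' \<otimes> b' \<in> L" if "b' \<in> B" for b'
      using subringE(6)[OF L, of "r b'" b'] coeffs_mem[OF r(1) that] that MsubL subrings_closed(5) by blast
    let ?t = "\<Oplus>b\<in>F. r b \<otimes> b"
    have IH: "frag_of (s, ?t) - (\<Sum>b\<in>F. frag_of (s \<otimes> r b, b)) \<in> rels" "?t \<in> L" using insert by auto
    have eq: "(\<Oplus>b\<in>insert b F. r b \<otimes> b) = r b \<otimes> b \<oplus> ?t"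
      using insert.hyps insert.prems rb subrings_closed(3) by (intro finsum_insert) auto
    have "frag_of (s, r b \<otimes> b \<oplus> ?t) - (frag_of (s \<otimes> r b, b) + (\<Sum>b\<in>F. frag_of (s \<otimes> r b, b)))
        = (frag_of (s, r b \<otimes> b \<oplus> ?t) - frag_of (s, r b \<otimes> b) - frag_of (s, ?t))
          - (frag_of (s \<otimes> r b, b) - frag_of (s, r b \<otimes> b))
          + (frag_of (s, ?t) - (\<Sum>b\<in>F. frag_of (s \<otimes> r b, b)))" by (simp add: algebra_simps)
    also have "\<dots> \<in> rels"
      by (rule rels_add[OF rels_diff[OF rels_right[OF x(2) rb[OF b(1)] IH(2)] rels_middle[OF b(3) x(2) b(2)]] IH(1)])
    finally show ?case using insert.hyps IH(2) rb[OF b(1)] subringE(7)[OF L] by (simp add: eq)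
  qed
  let ?F = "{b \<in> B. r b \<noteq> \<zero>}"
  have F: "finite ?F" "?F \<subseteq> B" using r by (auto simp: coeffs_def)
  define c where "c b = s \<otimes> r b" for b
  have sc: "s \<in> carrier R" using x subrings_closed by blast
  have cN: "c b \<in> N" if "b \<in> B" for b
    using subringE(6)[OF N x(2)] coeffs_mem[OF r(1) that] MsubN by (auto simp: c_def)
  have Fc: "{b \<in> B. c b \<noteq> \<zero>} \<subseteq> ?F" using sc by (auto simp: c_def)
  then have c: "c \<in> coeffs B N" using cN F finite_subset by (auto simp: coeffs_def)
  have "frag_of x - normal_form c = (frag_of (s, t) - (\<Sum>b\<in>?F. frag_of (s \<otimes> r b, b)))
      + ((\<Sum>b\<in>?F. frag_of (c b, b)) - normal_form c)" by (simp add: x(1) c_def)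
  moreover have "\<dots> \<in> rels"
    unfolding r(2) lincomb_def
    by (rule rels_add[OF conjunct1[OF sum[OF F]] normal_form_superset[OF c F(1) Fc F(2)]])
  ultimately have "frag_of x - normal_form c \<in> rels" by (simp only:)
  then show ?case using c by blast
qed

text \<open>The multiplication of pairs extends to a ring homomorphism on the formal sums that kills the tensor
  relations. A formal sum in its kernel is equivalent to some \<open>\<Sum> (c b, b)\<close> with \<open>\<Sum> c b \<cdot> b = 0\<close>, so all
  \<open>c b\<close> vanish. Hence the kernel consists of the relations only.\<close>

theorem tensor_product_iso:
  "\<exists>\<mu>\<in>ring_iso (tensor_product RM RN RL) RU. \<forall>a\<in>N. \<forall>b\<in>L. \<mu> (pure_tensor RM RN RL a b) = a \<otimes> b"
proof -
  have cN: "cring RN" and cL: "cring RL" and cU: "cring RU"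
    using subcring_iff subcringI' N L U subrings_closed by auto
  interpret P: cring pairs by (rule pair_ring_cring[OF cN cL])
  interpret RU: cring RU by (rule cU)
  obtain \<theta> where \<theta>: "\<theta> \<in> hom (free_Abelian_group (N \<times> L)) (add_monoid RU)"
    "\<And>x. x \<in> N \<times> L \<Longrightarrow> \<theta> (frag_of x) = fst x \<otimes> snd x"
  proof (rule comm_group.free_Abelian_group_universal[of "add_monoid RU" "\<lambda>x. fst x \<otimes> snd x" "N \<times> L"])
    show "comm_group (add_monoid RU)" by (rule RU.a_comm_group)
    show "(\<lambda>x. fst x \<otimes> snd x) ` (N \<times> L) \<subseteq> carrier (add_monoid RU)"
      using subringE(6)[OF U] NU LU by (auto simp: subset_iff)
    fix h assume "h \<in> hom (free_Abelian_group (N \<times> L)) (add_monoid RU)"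
      "\<And>x. x \<in> N \<times> L \<Longrightarrow> h (frag_of x) = fst x \<otimes> snd x"
    then show thesis by (rule that)
  qed
  have \<theta>U: "\<theta> p \<in> U" if "Poly_Mapping.keys p \<subseteq> N \<times> L" for p
    using hom_in_carrier[OF \<theta>(1), of p] that by simp
  have \<theta>c: "\<theta> p \<in> carrier R" if "Poly_Mapping.keys p \<subseteq> N \<times> L" for p
    using \<theta>U[OF that] subrings_closed by blast
  have \<theta>add: "\<theta> (p + q) = \<theta> p \<oplus> \<theta> q"
    if "Poly_Mapping.keys p \<subseteq> N \<times> L" "Poly_Mapping.keys q \<subseteq> N \<times> L" for p q
    using hom_mult[OF \<theta>(1), of p q] that by simp
  have keys0: "Poly_Mapping.keys (p - q) \<subseteq> N \<times> L"
    if "Poly_Mapping.keys p \<subseteq> N \<times> L" "Poly_Mapping.keys q \<subseteq> N \<times> L" for p q :: "('a \<times> 'a) \<Rightarrow>\<^sub>0 int"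
    using keys_diff[of p q] that by blast
  have \<theta>diff: "\<theta> (p - q) = \<theta> p \<ominus> \<theta> q"
    if "Poly_Mapping.keys p \<subseteq> N \<times> L" "Poly_Mapping.keys q \<subseteq> N \<times> L" for p q
  proof -
    have "\<theta> p = \<theta> (p - q) \<oplus> \<theta> q" using \<theta>add[OF keys0[OF that] that(2)] by simp
    moreover have "\<theta> (p - q) \<in> carrier R" "\<theta> q \<in> carrier R" using \<theta>c[OF keys0[OF that]] \<theta>c[OF that(2)] by auto
    moreover have "x = (x \<oplus> y) \<ominus> y" if "x \<in> carrier R" "y \<in> carrier R" for x y using that by algebra
    ultimately show ?thesis by simp
  qed
  have \<theta>0: "\<theta> 0 = \<zero>"
    using \<theta>diff[of 0 0] \<theta>c[of 0] by (simp add: a_minus_def r_neg)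
  have pm: "frag_mult (pair_mult RN RL) p q \<in> carrier pairs \<and> \<theta> (frag_mult (pair_mult RN RL) p q) = \<theta> p \<otimes> \<theta> q"
    if "Poly_Mapping.keys p \<subseteq> N \<times> L" "Poly_Mapping.keys q \<subseteq> N \<times> L" for p q
  proof
    have cl: "Poly_Mapping.keys (frag_mult (pair_mult RN RL) p q) \<subseteq> N \<times> L"
      if "Poly_Mapping.keys p \<subseteq> N \<times> L" "Poly_Mapping.keys q \<subseteq> N \<times> L" for p q
      using frag_mult_keys[OF that, of "pair_mult RN RL"] subringE(6)[OF N] subringE(6)[OF L] by (auto simp: pair_mult_def)
    then show "frag_mult (pair_mult RN RL) p q \<in> carrier pairs" using that by (simp add: pair_ring_simps)
    have distr: "(x \<ominus> y) \<otimes> z = x \<otimes> z \<ominus> y \<otimes> z" "z \<otimes> (x \<ominus> y) = z \<otimes> x \<ominus> z \<otimes> y"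
      if "x \<in> carrier R" "y \<in> carrier R" "z \<in> carrier R" for x y z
      using that by algebra+
    show "\<theta> (frag_mult (pair_mult RN RL) p q) = \<theta> p \<otimes> \<theta> q"
      using that(1)
    proof (induction p rule: free_Abelian_group_induct[where S = "N \<times> L", consumes 1, case_names zero diff of])
      case zero
      then show ?case using \<theta>c[OF that(2)] by (simp add: frag_mult_simps \<theta>0)
    next
      case (diff x y)
      then show ?case using that(2) cl[OF diff(1) that(2)] cl[OF diff(2) that(2)] \<theta>c[OF that(2)] \<theta>c[OF diff(1)] \<theta>c[OF diff(2)]
        by (simp add: frag_mult_simps \<theta>diff distr)
    next
      case (of x)
      note x = of
      have fx: "Poly_Mapping.keys (frag_of x) \<subseteq> N \<times> L" using x by simp
      show ?case using that(2)
      proof (induction q rule: free_Abelian_group_induct[where S = "N \<times> L", consumes 1, case_names zero diff of])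
        case zero
        then show ?case using \<theta>c[OF fx] by (simp add: frag_mult_simps \<theta>0)
      next
        case (diff y z)
        then show ?case using cl[OF fx diff(1)] cl[OF fx diff(2)] \<theta>c[OF fx] \<theta>c[OF diff(1)] \<theta>c[OF diff(2)]
          by (simp add: frag_mult_simps \<theta>diff distr)
      next
        case (of y)
        have "fst x \<in> carrier R" "snd x \<in> carrier R" "fst y \<in> carrier R" "snd y \<in> carrier R"
          using x of subrings_closed by auto
        moreover have "pair_mult RN RL x y \<in> N \<times> L"
          using x of subringE(6)[OF N] subringE(6)[OF L] by (auto simp: pair_mult_def)
        ultimately show ?case using x of \<theta>(2) by (simp add: frag_mult_simps pair_mult_def m_ac)
      qed
    qed
  qed
  have hom: "\<theta> \<in> ring_hom pairs RU"
  proof (rule ring_hom_memI)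
    show "\<theta> \<one>\<^bsub>pairs\<^esub> = \<one>\<^bsub>RU\<^esub>"
      using \<theta>(2)[of "(\<one>, \<one>)"] subringE(3)[OF N] subringE(3)[OF L] by (simp add: pair_ring_simps)
  qed (use \<theta>U \<theta>add pm in \<open>auto simp: pair_ring_simps\<close>)
  interpret \<theta>: ring_hom_ring pairs RU \<theta>
    by (rule ring_hom_ringI2[OF P.ring_axioms RU.ring_axioms hom])
  have lin: "\<theta> (normal_form c) = lincomb B c (\<lambda>b. b)" "Poly_Mapping.keys (normal_form c) \<subseteq> N \<times> L"
    if c: "c \<in> coeffs B N" for c
  proof -
    have *: "\<theta> (\<Sum>b\<in>F. frag_of (c b, b)) = (\<Oplus>b\<in>F. c b \<otimes> b) \<and> Poly_Mapping.keys (\<Sum>b\<in>F. frag_of (c b, b)) \<subseteq> N \<times> L"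
      if "finite F" "F \<subseteq> B" for F
      using that
    proof (induction F rule: finite_induct)
      case empty
      then show ?case by (simp add: \<theta>0)
    next
      case (insert b F)
      have m: "c b' \<in> N" "b' \<in> L" "c b' \<in> carrier R" "b' \<in> carrier R" if "b' \<in> B" for b'
        using coeffs_mem[OF c that] subrings_closed that by auto
      let ?q = "\<Sum>b\<in>F. frag_of (c b, b)"
      have k: "Poly_Mapping.keys (frag_of (c b, b)) \<subseteq> N \<times> L" "Poly_Mapping.keys ?q \<subseteq> N \<times> L"
        using m insert by auto
      have "Poly_Mapping.keys (frag_of (c b, b) + ?q) \<subseteq> N \<times> L"
        by (rule order_trans[OF keys_add Un_least[OF k]])
      moreover have "\<theta> (frag_of (c b, b) + ?q) = c b \<otimes> b \<oplus> (\<Oplus>b\<in>F. c b \<otimes> b)"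
        using \<theta>add[OF k] insert \<theta>(2)[of "(c b, b)"] m by auto
      moreover have "(\<Oplus>b\<in>insert b F. c b \<otimes> b) = c b \<otimes> b \<oplus> (\<Oplus>b\<in>F. c b \<otimes> b)"
        using insert.hyps insert.prems m by (intro finsum_insert) auto
      ultimately show ?case using insert.hyps by simp
    qed
    have "finite {b \<in> B. c b \<noteq> \<zero>}" using c by (simp add: coeffs_def)
    then show "\<theta> (normal_form c) = lincomb B c (\<lambda>b. b)" "Poly_Mapping.keys (normal_form c) \<subseteq> N \<times> L"
      using *[of "{b \<in> B. c b \<noteq> \<zero>}"] by (auto simp: normal_form_def lincomb_def)
  qed
  have relsk: "rels \<subseteq> {p. Poly_Mapping.keys p \<subseteq> N \<times> L}" 
    using subgroup.subset[OF rels_subgroup] by (simp add: free_Abelian_group_def)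
  have rels0: "\<theta> p = \<zero>" if "p \<in> rels" for p
  proof -
    have f: "\<theta> (frag_of x) = fst x \<otimes> snd x" "Poly_Mapping.keys (frag_of x) \<subseteq> N \<times> L" if "x \<in> N \<times> L" for x
      using \<theta>(2)[OF that] that by auto
    have ker: "subgroup (kernel (free_Abelian_group (N \<times> L)) (add_monoid RU) \<theta>) (free_Abelian_group (N \<times> L))"
      by (rule group_hom.subgroup_kernel) (use \<theta>(1) RU.a_group in \<open>simp add: group_hom_def group_hom_axioms_def\<close>)
    have cs: "carrier RM = M" "carrier RN = N" "carrier RL = L" by simp_all
    have "rels \<subseteq> kernel (free_Abelian_group (N \<times> L)) (add_monoid RU) \<theta>"
      unfolding tensor_relations_def cs
    proof (rule group.generate_subgroup_incl[OF group_free_Abelian_group _ ker], safe)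
      fix s s' t assume st: "s \<in> N" "s' \<in> N" "t \<in> L"
      then have c: "s \<in> carrier R" "s' \<in> carrier R" "t \<in> carrier R" using subrings_closed by auto
      have "(s \<oplus> s') \<otimes> t \<ominus> s \<otimes> t \<ominus> s' \<otimes> t = \<zero>" using c by algebra
      then show "frag_of (s \<oplus>\<^bsub>RN\<^esub> s', t) - frag_of (s, t) - frag_of (s', t) \<in> kernel (free_Abelian_group (N \<times> L)) (add_monoid RU) \<theta>"
        using st f[of "(s \<oplus> s', t)"] f[of "(s, t)"] f[of "(s', t)"] subringE(7)[OF N] keys0
        by (simp add: kernel_def \<theta>diff)
    next
      fix s t t' assume st: "s \<in> N" "t \<in> L" "t' \<in> L"
      then have c: "s \<in> carrier R" "t' \<in> carrier R" "t \<in> carrier R" using subrings_closed by auto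
      have "s \<otimes> (t \<oplus> t') \<ominus> s \<otimes> t \<ominus> s \<otimes> t' = \<zero>" using c by algebra
      then show "frag_of (s, t \<oplus>\<^bsub>RL\<^esub> t') - frag_of (s, t) - frag_of (s, t') \<in> kernel (free_Abelian_group (N \<times> L)) (add_monoid RU) \<theta>"
        using st f[of "(s, t \<oplus> t')"] f[of "(s, t)"] f[of "(s, t')"] subringE(7)[OF L] keys0
        by (simp add: kernel_def \<theta>diff)
    next
      fix r s t assume st: "r \<in> M" "s \<in> N" "t \<in> L"
      then have c: "s \<in> carrier R" "r \<in> carrier R" "t \<in> carrier R" using subrings_closed by auto
      have rNL: "r \<in> N" "r \<in> L" using st MsubN MsubL by auto
      have "(s \<otimes> r) \<otimes> t \<ominus> s \<otimes> (r \<otimes> t) = \<zero>" using c by algebra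
      then show "frag_of (s \<otimes>\<^bsub>RN\<^esub> r, t) - frag_of (s, r \<otimes>\<^bsub>RL\<^esub> t) \<in> kernel (free_Abelian_group (N \<times> L)) (add_monoid RU) \<theta>"
        using st rNL f[of "(s \<otimes> r, t)"] f[of "(s, r \<otimes> t)"] subringE(6)[OF N] subringE(6)[OF L] keys0
        by (simp add: kernel_def \<theta>diff)
    qed
    then have "p \<in> kernel (free_Abelian_group (N \<times> L)) (add_monoid RU) \<theta>" using that by (rule subsetD)
    then show ?thesis by (simp add: kernel_def)
  qed
  have ak: "a_kernel pairs RU \<theta> = {p. Poly_Mapping.keys p \<subseteq> N \<times> L \<and> \<theta> p = \<zero>}"
    unfolding a_kernel_def' pair_ring_simps by auto
  have kernel: "a_kernel pairs RU \<theta> = rels"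
  proof
    show "rels \<subseteq> a_kernel pairs RU \<theta>"
    proof
      fix p assume p: "p \<in> rels"
      show "p \<in> a_kernel pairs RU \<theta>" unfolding ak using rels0[OF p] subsetD[OF relsk p] by simp
    qed
    show "a_kernel pairs RU \<theta> \<subseteq> rels"
    proof
      fix p assume "p \<in> a_kernel pairs RU \<theta>"
      then have p: "Poly_Mapping.keys p \<subseteq> N \<times> L" "\<theta> p = \<zero>" unfolding ak by blast+
      obtain c where c: "c \<in> coeffs B N" "p - normal_form c \<in> rels" using normal_form_exists[OF p(1)] by blast
      have "\<theta> p \<ominus> \<theta> (normal_form c) = \<zero>" using rels0[OF c(2)] \<theta>diff[OF p(1) lin(2)[OF c(1)]] by simp
      then have "lincomb B c (\<lambda>b. b) = \<zero>" using p(2) lin(1)[OF c(1)] \<theta>c[OF lin(2)[OF c(1)]]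
        by (metis r_right_minus_eq zero_closed)
      then have "\<forall>b\<in>B. c b = \<zero>" using BU c(1) by (auto simp: free_basis_def)
      then have "{b \<in> B. c b \<noteq> \<zero>} = {}" by blast
      then have "normal_form c = 0" by (simp only: normal_form_def sum.empty)
      then show "p \<in> rels" using c(2) by simp
    qed
  qed
  have surj: "\<theta> ` carrier pairs = carrier RU"
  proof
    show "\<theta> ` carrier pairs \<subseteq> carrier RU" using \<theta>U by (auto simp: pair_ring_simps)
    show "carrier RU \<subseteq> \<theta> ` carrier pairs"
    proof
      fix u assume "u \<in> carrier RU"
      then obtain c where c: "c \<in> coeffs B N" "u = lincomb B c (\<lambda>b. b)" using BU by (auto simp: free_basis_def)
      then show "u \<in> \<theta> ` carrier pairs" using lin[OF c(1)] by (auto simp: pair_ring_simps intro!: image_eqI[of _ _ "normal_form c"])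
    qed
  qed
  define \<mu> where "\<mu> = (\<lambda>Y. the_elem (\<theta> ` Y))"
  have "\<mu> \<in> ring_iso (tensor_product RM RN RL) RU"
    using \<theta>.FactRing_iso_set[OF surj] unfolding kernel tensor_product_def \<mu>_def .
  moreover have "\<mu> (pure_tensor RM RN RL a b) = a \<otimes> b" if ab: "a \<in> N" "b \<in> L" for a b
  proof -
    have "\<theta> ` (rels +>\<^bsub>pairs\<^esub> frag_of (a, b)) = {a \<otimes> b}"
    proof
      have abk: "Poly_Mapping.keys (frag_of (a, b)) \<subseteq> N \<times> L" using ab by simp
      have abc: "a \<in> carrier R" "b \<in> carrier R" using ab subrings_closed by auto
      have eq: "\<theta> (p + frag_of (a, b)) = a \<otimes> b" if p: "p \<in> rels" for p
      proof -
        have "Poly_Mapping.keys p \<subseteq> N \<times> L" using subsetD[OF relsk p] by simp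
        then show ?thesis using \<theta>add[OF _ abk, of p] rels0[OF p] \<theta>(2)[of "(a, b)"] ab abc by simp
      qed
      have coset: "rels +>\<^bsub>pairs\<^esub> frag_of (a, b) = (\<lambda>p. p + frag_of (a, b)) ` rels"
        unfolding a_r_coset_def' pair_ring_simps by auto
      show "\<theta> ` (rels +>\<^bsub>pairs\<^esub> frag_of (a, b)) \<subseteq> {a \<otimes> b}"
        unfolding coset using eq by blast
      show "{a \<otimes> b} \<subseteq> \<theta> ` (rels +>\<^bsub>pairs\<^esub> frag_of (a, b))"
        unfolding coset image_image using eq[OF rels_zero] rels_zero by (metis empty_subsetI image_eqI insert_subset)
    qed
    then show ?thesis by (simp add: \<mu>_def pure_tensor_def)
  qed
  ultimately show ?thesis by blast
qed

end

end

section \<open>Transport along ring isomorphisms\<close>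

lemma ring_isoD:
  assumes "\<phi> \<in> ring_iso R S"
  shows "\<phi> \<in> ring_hom R S" "bij_betw \<phi> (carrier R) (carrier S)" "inj_on \<phi> (carrier R)" "\<phi> ` carrier R = carrier S"
    "\<And>x. x \<in> carrier R \<Longrightarrow> \<phi> x \<in> carrier S"
    "\<And>x y. x \<in> carrier R \<Longrightarrow> y \<in> carrier R \<Longrightarrow> \<phi> (x \<oplus>\<^bsub>R\<^esub> y) = \<phi> x \<oplus>\<^bsub>S\<^esub> \<phi> y"
    "\<And>x y. x \<in> carrier R \<Longrightarrow> y \<in> carrier R \<Longrightarrow> \<phi> (x \<otimes>\<^bsub>R\<^esub> y) = \<phi> x \<otimes>\<^bsub>S\<^esub> \<phi> y"
    "\<phi> \<one>\<^bsub>R\<^esub> = \<one>\<^bsub>S\<^esub>"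
  using assms by (auto simp: ring_iso_def ring_hom_def bij_betw_def)

lemma ring_iso_ideal_image:
  assumes "\<phi> \<in> ring_iso R S" "cring R" "cring S" and I: "ideal I R"
  shows "ideal (\<phi> ` I) S"
proof -
  interpret R: cring R by fact
  interpret S: cring S by fact
  interpret I: ideal I R by fact
  note iso = ring_isoD[OF assms(1)]
  interpret h: ring_hom_ring R S \<phi> by (rule ring_hom_ringI2[OF R.ring_axioms S.ring_axioms iso(1)])
  show ?thesis
  proof (rule S.ideal_if_ideal_in, unfold S.ideal_in_def, intro conjI ballI)
    show "\<phi> ` I \<subseteq> carrier S" using iso(5) I.Icarr by auto
    show "\<zero>\<^bsub>S\<^esub> \<in> \<phi> ` I" using I.zero_closed h.hom_zero by (metis image_eqI)
  next
    fix a b assume "a \<in> \<phi> ` I" "b \<in> \<phi> ` I"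
    then obtain x y where x: "x \<in> I" "a = \<phi> x" "y \<in> I" "b = \<phi> y" by blast
    then have "a \<oplus>\<^bsub>S\<^esub> b = \<phi> (x \<oplus>\<^bsub>R\<^esub> y)" using I.Icarr by simp
    then show "a \<oplus>\<^bsub>S\<^esub> b \<in> \<phi> ` I" using x I.a_closed by (metis image_eqI)
  next
    fix s a assume "s \<in> carrier S" "a \<in> \<phi> ` I"
    then obtain x r where x: "x \<in> I" "a = \<phi> x" "r \<in> carrier R" "s = \<phi> r" using iso(4) by blast
    then have "s \<otimes>\<^bsub>S\<^esub> a = \<phi> (r \<otimes>\<^bsub>R\<^esub> x)" using I.Icarr by simp
    then show "s \<otimes>\<^bsub>S\<^esub> a \<in> \<phi> ` I" using x I.I_l_closed by (metis image_eqI)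
  qed
qed

context
  fixes R :: "('r, 'm) ring_scheme" and S :: "('s, 'n) ring_scheme" and \<phi> :: "'r \<Rightarrow> 's"
  assumes iso: "\<phi> \<in> ring_iso R S" and R: "cring R" and S: "cring S"
begin

lemma iso_inv: "inv_into (carrier R) \<phi> \<in> ring_iso S R"
  using ring_iso_set_sym[OF _ iso] R cring.axioms(1) by blast

lemma iso_image_mem: "I \<subseteq> carrier R \<Longrightarrow> x \<in> carrier R \<Longrightarrow> \<phi> x \<in> \<phi> ` I \<longleftrightarrow> x \<in> I"
  using inj_on_image_mem_iff[OF ring_isoD(3)[OF iso]] by blast

lemma iso_inv_image:
  assumes "J \<subseteq> carrier S" shows "\<phi> ` inv_into (carrier R) \<phi> ` J = J" "inv_into (carrier R) \<phi> ` J \<subseteq> carrier R"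
proof -
  have "\<phi> (inv_into (carrier R) \<phi> x) = x" if "x \<in> J" for x
    using f_inv_into_f[of x \<phi> "carrier R"] that assms ring_isoD(4)[OF iso] by blast
  then show "\<phi> ` inv_into (carrier R) \<phi> ` J = J" by (force simp: image_image)
  show "inv_into (carrier R) \<phi> ` J \<subseteq> carrier R"
    using assms unfolding ring_isoD(4)[OF iso, symmetric] by (auto intro!: inv_into_into)
qed

lemma primeideal_image:
  assumes P: "primeideal P R" shows "primeideal (\<phi> ` P) S"
proof (rule primeidealI)
  interpret R: cring R by (rule R)
  interpret P: primeideal P R by fact
  note i = ring_isoD[OF iso]
  show "ideal (\<phi> ` P) S" by (rule ring_iso_ideal_image[OF iso R S P.is_ideal])
  show "cring S" by (rule S)
  have Pc: "P \<subseteq> carrier R" using P.Icarr by blast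
  show "carrier S \<noteq> \<phi> ` P"
  proof
    assume "carrier S = \<phi> ` P"
    then have "\<phi> ` carrier R = \<phi> ` P" using i(4) by simp
    then have "carrier R = P" using inj_on_image_eq_iff[OF i(3) subset_refl Pc] by simp
    then show False using P.I_notcarr by simp
  qed
  fix a b assume "a \<in> carrier S" "b \<in> carrier S" "a \<otimes>\<^bsub>S\<^esub> b \<in> \<phi> ` P"
  then obtain x y where x: "x \<in> carrier R" "a = \<phi> x" "y \<in> carrier R" "b = \<phi> y" using i(4) by blast
  then have "\<phi> (x \<otimes>\<^bsub>R\<^esub> y) \<in> \<phi> ` P" using \<open>a \<otimes>\<^bsub>S\<^esub> b \<in> \<phi> ` P\<close> i(7) by simp
  then have "x \<otimes>\<^bsub>R\<^esub> y \<in> P" using iso_image_mem[OF Pc] x R.m_closed by blast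
  then show "a \<in> \<phi> ` P \<or> b \<in> \<phi> ` P" using P.I_prime x by blast
qed

lemma maximalideal_image:
  assumes M: "maximalideal M R" shows "maximalideal (\<phi> ` M) S"
proof (rule maximalidealI)
  interpret M: maximalideal M R by fact
  note i = ring_isoD[OF iso]
  have Mc: "M \<subseteq> carrier R" using M.Icarr by blast
  show "ideal (\<phi> ` M) S" by (rule ring_iso_ideal_image[OF iso R S M.is_ideal])
  show "carrier S \<noteq> \<phi> ` M"
  proof
    assume "carrier S = \<phi> ` M"
    then have "\<phi> ` carrier R = \<phi> ` M" using i(4) by simp
    then have "carrier R = M" using inj_on_image_eq_iff[OF i(3) subset_refl Mc] by simp
    then show False using M.I_notcarr by simp
  qed
  fix J assume J: "ideal J S" "\<phi> ` M \<subseteq> J" "J \<subseteq> carrier S"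
  let ?I = "inv_into (carrier R) \<phi> ` J"
  note I = iso_inv_image[OF J(3)]
  have "M \<subseteq> ?I"
  proof
    fix x assume x: "x \<in> M"
    then have "\<phi> x \<in> \<phi> ` ?I" using J(2) I(1) by blast
    then show "x \<in> ?I" using iso_image_mem[OF I(2)] x Mc by blast
  qed
  then have "?I = M \<or> ?I = carrier R"
    using M.I_maximal[OF ring_iso_ideal_image[OF iso_inv S R J(1)]] I(2) by blast
  then have "\<phi> ` ?I = \<phi> ` M \<or> \<phi> ` ?I = \<phi> ` carrier R" by auto
  then show "J = \<phi> ` M \<or> J = carrier S" using I(1) i(4) by simp
qed

lemma krull_dim_le: "krull_dim R \<le> krull_dim S"
  unfolding krull_dim_def
proof (rule Sup_least)
  fix l assume "l \<in> {height R P | P. primeideal P R}"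
  then obtain P where P: "primeideal P R" "l = height R P" by blast
  have "height R P \<le> height S (\<phi> ` P)"
    unfolding height_def
  proof (rule Sup_subset_mono, rule subsetI)
    fix l assume "l \<in> {enat n | n. \<exists>Q. (\<forall>i\<le>n. primeideal (Q i) R) \<and> (\<forall>i<n. Q i \<subset> Q (Suc i)) \<and> Q n = P}"
    then obtain n Q where Q: "l = enat n" "\<forall>i\<le>n. primeideal (Q i) R" "\<forall>i<n. Q i \<subset> Q (Suc i)" "Q n = P" by blast
    have Qc: "Q i \<subseteq> carrier R" if "i \<le> n" for i
      using Q(2) that additive_subgroup.a_subset[OF ideal.axioms(1)[OF primeideal.axioms(1)]] by blast
    have "\<phi> ` Q i \<subset> \<phi> ` Q (Suc i)" if "i < n" for i
      using Q(3) that inj_on_image_eq_iff[OF ring_isoD(3)[OF iso] Qc Qc, of i "Suc i"] by auto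
    then have "(\<forall>i\<le>n. primeideal (\<phi> ` Q i) S) \<and> (\<forall>i<n. \<phi> ` Q i \<subset> \<phi> ` Q (Suc i)) \<and> \<phi> ` Q n = \<phi> ` P"
      using Q primeideal_image by blast
    then have "\<exists>Q. (\<forall>i\<le>n. primeideal (Q i) S) \<and> (\<forall>i<n. Q i \<subset> Q (Suc i)) \<and> Q n = \<phi> ` P"
      by (intro exI[of _ "\<lambda>i. \<phi> ` Q i"])
    then show "l \<in> {enat n | n. \<exists>Q. (\<forall>i\<le>n. primeideal (Q i) S) \<and> (\<forall>i<n. Q i \<subset> Q (Suc i)) \<and> Q n = \<phi> ` P}"
      using Q(1) by blast
  qed
  also have "\<dots> \<le> Sup {height S P | P. primeideal P S}"
    using primeideal_image[OF P(1)] by (intro Sup_upper) blast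
  finally show "l \<le> Sup {height S P | P. primeideal P S}" using P(2) by simp
qed

lemma noetherian_iso:
  assumes "noetherian_ring R" shows "noetherian_ring S"
proof (rule ring.noetherian_ringI)
  interpret R: noetherian_ring R by fact
  interpret S: cring S by (rule S)
  show "ring S" by (rule S.ring_axioms)
  fix J assume J: "ideal J S"
  have Jc: "J \<subseteq> carrier S" using additive_subgroup.a_subset[OF ideal.axioms(1)[OF J]] .
  let ?I = "inv_into (carrier R) \<phi> ` J"
  note I = iso_inv_image[OF Jc]
  obtain F where F: "F \<subseteq> carrier R" "finite F" "?I = Idl\<^bsub>R\<^esub> F"
    using R.finetely_gen[OF ring_iso_ideal_image[OF iso_inv S R J]] by blast
  have Fc: "\<phi> ` F \<subseteq> carrier S" using F ring_isoD(5)[OF iso] by blast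
  have "J = Idl\<^bsub>S\<^esub> (\<phi> ` F)"
  proof
    show "Idl\<^bsub>S\<^esub> (\<phi> ` F) \<subseteq> J"
    proof (rule S.genideal_minimal[OF J])
      have "\<phi> ` F \<subseteq> \<phi> ` ?I" using R.genideal_self[OF F(1)] F(3) by blast
      then show "\<phi> ` F \<subseteq> J" using I(1) by simp
    qed
    have K: "ideal (Idl\<^bsub>S\<^esub> (\<phi> ` F)) S" by (rule S.genideal_ideal[OF Fc])
    have coefficients_closed: "Idl\<^bsub>S\<^esub> (\<phi> ` F) \<subseteq> carrier S" using additive_subgroup.a_subset[OF ideal.axioms(1)[OF K]] .
    note K' = iso_inv_image[OF coefficients_closed]
    have "F \<subseteq> inv_into (carrier R) \<phi> ` (Idl\<^bsub>S\<^esub> (\<phi> ` F))"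
    proof
      fix x assume x: "x \<in> F"
      then have "\<phi> x \<in> Idl\<^bsub>S\<^esub> (\<phi> ` F)" using S.genideal_self[OF Fc] by blast
      moreover have "inv_into (carrier R) \<phi> (\<phi> x) = x"
        using x F(1) ring_isoD(3)[OF iso] by (intro inv_into_f_f) auto
      ultimately show "x \<in> inv_into (carrier R) \<phi> ` (Idl\<^bsub>S\<^esub> (\<phi> ` F))" by (metis image_eqI)
    qed
    then have "?I \<subseteq> inv_into (carrier R) \<phi> ` (Idl\<^bsub>S\<^esub> (\<phi> ` F))"
      unfolding F(3) by (rule R.genideal_minimal[OF ring_iso_ideal_image[OF iso_inv S R K]])
    then have "\<phi> ` ?I \<subseteq> \<phi> ` inv_into (carrier R) \<phi> ` (Idl\<^bsub>S\<^esub> (\<phi> ` F))" by (rule image_mono)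
    then show "J \<subseteq> Idl\<^bsub>S\<^esub> (\<phi> ` F)" using I(1) K'(1) by simp
  qed
  then show "\<exists>A\<subseteq>carrier S. finite A \<and> J = Idl\<^bsub>S\<^esub> A" using Fc F(2) by blast
qed

lemma local_iso:
  assumes "\<exists>!M. maximalideal M R" shows "\<exists>!M. maximalideal M S"
proof -
  obtain M where M: "maximalideal M R" "\<And>M'. maximalideal M' R \<Longrightarrow> M' = M" using assms by blast
  have "maximalideal (\<phi> ` M) S" by (rule maximalideal_image[OF M(1)])
  moreover have "M' = \<phi> ` M" if M': "maximalideal M' S" for M'
  proof -
    interpret M': maximalideal M' S by fact
    have "M' \<subseteq> carrier S" using M'.Icarr by blast
    note I = iso_inv_image[OF this]
    interpret Si: cring S by (rule S)
    have "maximalideal (inv_into (carrier R) \<phi> ` M') R"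
    proof (rule maximalidealI)
      show "ideal (inv_into (carrier R) \<phi> ` M') R" by (rule ring_iso_ideal_image[OF iso_inv S R M'.is_ideal])
      show "carrier R \<noteq> inv_into (carrier R) \<phi> ` M'"
      proof
        assume "carrier R = inv_into (carrier R) \<phi> ` M'"
        then have "\<phi> ` carrier R = M'" using I(1) by simp
        then show False using M'.I_notcarr ring_isoD(4)[OF iso] by simp
      qed
      fix J assume J: "ideal J R" "inv_into (carrier R) \<phi> ` M' \<subseteq> J" "J \<subseteq> carrier R"
      have "M' \<subseteq> \<phi> ` J" using image_mono[OF J(2), of \<phi>] I(1) by simp
      moreover have "\<phi> ` J \<subseteq> carrier S" using J(3) ring_isoD(5)[OF iso] by blast
      ultimately have "\<phi> ` J = M' \<or> \<phi> ` J = carrier S"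
        using M'.I_maximal[OF ring_iso_ideal_image[OF iso R S J(1)]] by blast
      then have "\<phi> ` J = \<phi> ` inv_into (carrier R) \<phi> ` M' \<or> \<phi> ` J = \<phi> ` carrier R"
        using I(1) ring_isoD(4)[OF iso] by simp
      then show "J = inv_into (carrier R) \<phi> ` M' \<or> J = carrier R"
        unfolding inj_on_image_eq_iff[OF ring_isoD(3)[OF iso] J(3) I(2)]
          inj_on_image_eq_iff[OF ring_isoD(3)[OF iso] J(3) subset_refl] .
    qed
    then have "inv_into (carrier R) \<phi> ` M' = M" by (rule M(2))
    then show ?thesis using I(1) by simp
  qed
  ultimately show ?thesis by blast
qed

end

lemma krull_dim_iso:
  assumes "\<phi> \<in> ring_iso R S" "cring R" "cring S" shows "krull_dim R = krull_dim S"
  using krull_dim_le[OF assms] krull_dim_le[OF iso_inv[OF assms] assms(3,2)] by (rule antisym)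

text \<open>The underlying set is unchanged, so that modules over one ring become modules over the other on the
  same type, as the definition of injective modules requires.\<close>

definition restrict_scalars :: "('s \<Rightarrow> 'r) \<Rightarrow> ('r, 'x) module \<Rightarrow> ('s, 'x) module" where
  "restrict_scalars f M = \<lparr>carrier = carrier M, monoid.mult = monoid.mult M, one = one M,
     ring.zero = ring.zero M, add = add M, smult = (\<lambda>s. smult M (f s))\<rparr>"

lemma restrict_scalars_simps [simp]:
  "carrier (restrict_scalars f M) = carrier M" "add (restrict_scalars f M) = add M"
  "ring.zero (restrict_scalars f M) = ring.zero M"
  "smult (restrict_scalars f M) s x = smult M (f s) x"
  by (simp_all add: restrict_scalars_def)

lemma module_restrict_scalars:
  assumes "module R M" "f \<in> ring_hom S R" "cring S"
  shows "module S (restrict_scalars f M)"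
proof -
  interpret M: module R M by fact
  interpret S: cring S by fact
  show ?thesis
  proof (rule moduleI)
    show "cring S" by fact
    show "abelian_group (restrict_scalars f M)"
      by (rule abelian_groupI) (auto simp: M.M.a_ac M.M.l_zero intro: M.M.l_neg bexI[of _ "\<ominus>\<^bsub>M\<^esub> _"])
  qed (use assms(2) M.smult_l_distr M.smult_r_distr M.smult_assoc1 in \<open>auto simp: ring_hom_def Pi_def\<close>)
qed

lemma injective_module_iso:
  fixes R S :: "('r, 'm) ring_scheme" and E :: "('r, 'r) module"
  assumes iso: "\<phi> \<in> ring_iso R S" and R: "cring R" and S: "cring S" and E: "injective_module R E"
  shows "injective_module S (restrict_scalars (inv_into (carrier R) \<phi>) E)"
  unfolding injective_module_def
proof (intro conjI allI impI)
  let ?\<psi> = "inv_into (carrier R) \<phi>"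
  have inv: "?\<psi> \<in> ring_iso S R" by (rule iso_inv[OF iso R S])
  have \<psi>\<phi>: "?\<psi> (\<phi> r) = r" if "r \<in> carrier R" for r
    using that ring_isoD(3)[OF iso] by (rule inv_into_f_f[rotated])
  have \<phi>\<psi>: "\<phi> (?\<psi> s) = s" if "s \<in> carrier S" for s
    using f_inv_into_f[of s \<phi> "carrier R"] that ring_isoD(4)[OF iso] by blast
  have ER: "module R E" using E by (simp add: injective_module_def)
  show "module S (restrict_scalars ?\<psi> E)"
    by (rule module_restrict_scalars[OF ER ring_isoD(1)[OF inv] S])
  fix M N :: "('r, 'r) module" and i g
  assume *: "module S M \<and> module S N \<and> i \<in> module_hom S M N \<and> inj_on i (carrier M) \<and>
    g \<in> module_hom S M (restrict_scalars ?\<psi> E)"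
  have "module R (restrict_scalars \<phi> M)" "module R (restrict_scalars \<phi> N)"
    using module_restrict_scalars[OF _ ring_isoD(1)[OF iso] R] * by auto
  moreover have "i \<in> module_hom R (restrict_scalars \<phi> M) (restrict_scalars \<phi> N)"
    using * ring_isoD(5)[OF iso] by (auto simp: module_hom_def)
  moreover have "g \<in> module_hom R (restrict_scalars \<phi> M) E"
    using * ring_isoD(5)[OF iso] \<psi>\<phi> by (auto simp: module_hom_def)
  ultimately obtain h where h: "h \<in> module_hom R (restrict_scalars \<phi> N) E" "\<forall>x\<in>carrier M. h (i x) = g x"
    using E * unfolding injective_module_def by (metis restrict_scalars_simps(1))
  have "h \<in> module_hom S N (restrict_scalars ?\<psi> E)"
    using h(1) ring_isoD(5)[OF inv] \<phi>\<psi> by (force simp: module_hom_def)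
  then show "\<exists>h\<in>module_hom S N (restrict_scalars ?\<psi> E). \<forall>x\<in>carrier M. h (i x) = g x"
    using h(2) by blast
qed

text \<open>An injective resolution is restricted along the inverse isomorphism. Only the augmentation changes,
  because its source is the ring itself.\<close>

lemma finite_injective_dim_iso:
  fixes R S :: "('r, 'm) ring_scheme"
  assumes iso: "\<phi> \<in> ring_iso R S" and R: "cring R" and S: "cring S"
    and fin: "finite_injective_dim R (regular_module R)"
  shows "finite_injective_dim S (regular_module S)"
proof -
  let ?\<psi> = "inv_into (carrier R) \<phi>"
  have inv: "?\<psi> \<in> ring_iso S R" by (rule iso_inv[OF iso R S])
  note i = ring_isoD[OF inv]
  obtain n E \<epsilon> \<delta> where res: "injective_resolution R (regular_module R) E \<epsilon> \<delta>"
    and n: "\<forall>i>n. carrier (E i) = {\<zero>\<^bsub>E i\<^esub>}" using fin by (auto simp: finite_injective_dim_def)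
  have reg: "carrier (regular_module T) = carrier T" "x \<oplus>\<^bsub>regular_module T\<^esub> y = x \<oplus>\<^bsub>T\<^esub> y"
    "x \<odot>\<^bsub>regular_module T\<^esub> y = x \<otimes>\<^bsub>T\<^esub> y" for T :: "('r, 'm) ring_scheme" and x y
    by (simp_all add: regular_module_def)
  let ?E = "\<lambda>i. restrict_scalars ?\<psi> (E i)"
  have "injective_resolution S (regular_module S) ?E (\<epsilon> \<circ> ?\<psi>) \<delta>"
    unfolding injective_resolution_def
  proof (intro conjI allI)
    show "injective_module S (?E i)" for i
      using injective_module_iso[OF iso R S] res by (simp add: injective_resolution_def)
    have \<epsilon>: "\<epsilon> \<in> module_hom R (regular_module R) (E 0)" "inj_on \<epsilon> (carrier R)"
      using res by (simp_all add: injective_resolution_def reg)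
    show "\<epsilon> \<circ> ?\<psi> \<in> module_hom S (regular_module S) (?E 0)"
      using \<epsilon>(1) i(5-7) by (auto simp: module_hom_def reg)
    show "inj_on (\<epsilon> \<circ> ?\<psi>) (carrier (regular_module S))"
      using \<epsilon>(2) i(3,4) by (simp add: reg comp_inj_on)
    show "\<delta> i \<in> module_hom S (?E i) (?E (Suc i))" for i
    proof -
      have "\<delta> i \<in> module_hom R (E i) (E (Suc i))" using res by (simp add: injective_resolution_def)
      then show ?thesis using i(5) by (auto simp: module_hom_def)
    qed
    have "(\<epsilon> \<circ> ?\<psi>) ` carrier S = \<epsilon> ` ?\<psi> ` carrier S" by (rule image_comp[symmetric])
    then have "(\<epsilon> \<circ> ?\<psi>) ` carrier S = \<epsilon> ` carrier R" unfolding i(4) .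
    then show "(\<epsilon> \<circ> ?\<psi>) ` carrier (regular_module S) = {x \<in> carrier (?E 0). \<delta> 0 x = \<zero>\<^bsub>?E 1\<^esub>}"
      using res by (simp add: injective_resolution_def reg)
    show "\<delta> i ` carrier (?E i) = {x \<in> carrier (?E (Suc i)). \<delta> (Suc i) x = \<zero>\<^bsub>?E (Suc (Suc i))\<^esub>}" for i
      using res by (simp add: injective_resolution_def)
  qed
  moreover have "\<forall>i>n. carrier (?E i) = {\<zero>\<^bsub>?E i\<^esub>}" using n by simp
  ultimately show ?thesis unfolding finite_injective_dim_def by blast
qed

lemma gorenstein_local_ring_iso:
  fixes R S :: "('r, 'm) ring_scheme"
  assumes "\<phi> \<in> ring_iso R S" "cring S" "gorenstein_local_ring R"
  shows "gorenstein_local_ring S"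
proof -
  have R: "cring R" using assms(3) by (simp add: gorenstein_local_ring_def)
  show ?thesis
    using assms noetherian_iso[OF assms(1) R assms(2)] local_iso[OF assms(1) R assms(2)]
      finite_injective_dim_iso[OF assms(1) R assms(2)]
    by (simp add: gorenstein_local_ring_def)
qed

lemma graded_complete_intersection_iso:
  assumes "\<psi> \<in> ring_iso B B'" "\<And>c. c \<in> carrier F \<Longrightarrow> \<psi> (\<eta> c) = \<eta>' c" "\<And>j. \<psi> ` gr j = gr' j"
    and ci: "graded_complete_intersection F B gr \<eta>"
  shows "graded_complete_intersection F B' gr' \<eta>'"
proof -
  obtain n :: nat and d fs \<phi> where *: "\<forall>i<n. d i > 0"
    "\<forall>f\<in>set fs. \<exists>j. f \<in> mpoly_homogeneous F {..<n} d j"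
    "regular_sequence (mpoly_ring F {..<n}) fs"
    and \<phi>: "\<phi> \<in> ring_iso (mpoly_ring F {..<n} Quot Idl\<^bsub>mpoly_ring F {..<n}\<^esub> (set fs)) B"
    "\<forall>c\<in>carrier F. \<phi> (Idl\<^bsub>mpoly_ring F {..<n}\<^esub> (set fs) +>\<^bsub>mpoly_ring F {..<n}\<^esub> ring.indexed_const F c) = \<eta> c"
    "\<forall>j. (\<lambda>f. \<phi> (Idl\<^bsub>mpoly_ring F {..<n}\<^esub> (set fs) +>\<^bsub>mpoly_ring F {..<n}\<^esub> f)) ` mpoly_homogeneous F {..<n} d j = gr j"
    using ci unfolding graded_complete_intersection_def Let_def by blast
  have 1: "\<psi> \<circ> \<phi> \<in> ring_iso (mpoly_ring F {..<n} Quot Idl\<^bsub>mpoly_ring F {..<n}\<^esub> (set fs)) B'"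
    by (rule ring_iso_set_trans[OF \<phi>(1) assms(1)])
  have 2: "\<forall>c\<in>carrier F. (\<psi> \<circ> \<phi>) (Idl\<^bsub>mpoly_ring F {..<n}\<^esub> (set fs) +>\<^bsub>mpoly_ring F {..<n}\<^esub> ring.indexed_const F c) = \<eta>' c"
    using \<phi>(2) assms(2) by simp
  have "(\<lambda>f. (\<psi> \<circ> \<phi>) (Idl\<^bsub>mpoly_ring F {..<n}\<^esub> (set fs) +>\<^bsub>mpoly_ring F {..<n}\<^esub> f)) ` mpoly_homogeneous F {..<n} d j
      = \<psi> ` (\<lambda>f. \<phi> (Idl\<^bsub>mpoly_ring F {..<n}\<^esub> (set fs) +>\<^bsub>mpoly_ring F {..<n}\<^esub> f)) ` mpoly_homogeneous F {..<n} d j" for j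
    by (simp add: image_image)
  then have 3: "\<forall>j. (\<lambda>f. (\<psi> \<circ> \<phi>) (Idl\<^bsub>mpoly_ring F {..<n}\<^esub> (set fs) +>\<^bsub>mpoly_ring F {..<n}\<^esub> f)) ` mpoly_homogeneous F {..<n} d j = gr' j"
    using \<phi>(3) assms(3) by simp
  show ?thesis
    unfolding graded_complete_intersection_def Let_def using * 1 2 3 by blast
qed

section \<open>Fibre algebras\<close>

context graded_algebra
begin

lemma component_zero_mult:
  assumes "a \<in> carrier A" "b \<in> carrier A"
  shows "component (a \<otimes> b) 0 = component a 0 \<otimes> component b 0"
proof -
  let ?S = "insert 0 {i. component b i \<noteq> \<zero>}"
  have fin: "finite ?S" using component_props(2)[OF assms(2)] by simp
  have "a \<otimes> b = a \<otimes> (\<Oplus>i\<in>?S. component b i)"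
    by (rule arg_cong[where f = "\<lambda>x. a \<otimes> x", OF component_sum[OF assms(2) fin]]) blast
  also have "\<dots> = (\<Oplus>i\<in>?S. a \<otimes> component b i)"
    using fin assms component_closed by (intro finsum_rdistr) auto
  finally have "component (a \<otimes> b) 0 = component (\<Oplus>i\<in>?S. a \<otimes> component b i) 0" by simp
  also have "\<dots> = (\<Oplus>i\<in>?S. component (a \<otimes> component b i) 0)"
    using fin assms component_closed by (intro component_finsum) auto
  also have "\<dots> = (\<Oplus>i\<in>?S. if 0 = i then component a 0 \<otimes> component b i else \<zero>)"
    using component_mult[OF assms(1) component_props(1)[OF assms(2)]] assms component_closed
    by (intro finsum_cong') auto
  also have "\<dots> = component a 0 \<otimes> component b 0"
    using fin assms component_closed by (intro finsum_singleton) auto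
  finally show ?thesis .
qed

lemma component_base: "a \<in> carrier A \<Longrightarrow> component a 0 \<in> k"
  using component_props(1)[of a 0] by (simp add: gr_zero)

definition graded_subring :: "'a set \<Rightarrow> bool" where
  "graded_subring M \<longleftrightarrow> subring M A \<and> k \<subseteq> M \<and> (\<forall>a\<in>M. \<forall>i. component a i \<in> M)"

lemma positive_part_eq:
  assumes M: "graded_subring M"
  shows "positive_part gr (A\<lparr>carrier := M\<rparr>) = {r \<in> M. component r 0 = \<zero>}"
proof
  have sub: "subring M A" and comp: "\<And>a i. a \<in> M \<Longrightarrow> component a i \<in> M" using M by (auto simp: graded_subring_def)
  have Mc: "M \<subseteq> carrier A" by (rule subringE(1)[OF sub])
  have "cring (A\<lparr>carrier := M\<rparr>)" using subcring_iff[OF Mc] subcringI'[OF sub] by blast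
  then interpret RM: cring "A\<lparr>carrier := M\<rparr>" .
  let ?G = "add_monoid (A\<lparr>carrier := M\<rparr>)"
  have "ideal {r \<in> M. component r 0 = \<zero>} (A\<lparr>carrier := M\<rparr>)"
    using component_zero component_add component_zero_mult component_closed subringE(2,6,7)[OF sub] Mc
    by (intro RM.ideal_if_ideal_in) (auto simp: RM.ideal_in_def subset_iff)
  then have sg: "subgroup {r \<in> M. component r 0 = \<zero>} ?G"
    by (rule additive_subgroup.a_subgroup[OF ideal.axioms(1)])
  have "(\<Union>i\<in>{0<..}. gr i \<inter> carrier (A\<lparr>carrier := M\<rparr>)) \<subseteq> {r \<in> M. component r 0 = \<zero>}"
    using component_homogeneous by auto
  then show "positive_part gr (A\<lparr>carrier := M\<rparr>) \<subseteq> {r \<in> M. component r 0 = \<zero>}"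
    unfolding positive_part_def
    by (intro group.generate_subgroup_incl[OF RM.add.group_axioms _ sg])
  show "{r \<in> M. component r 0 = \<zero>} \<subseteq> positive_part gr (A\<lparr>carrier := M\<rparr>)"
  proof
    fix r assume r: "r \<in> {r \<in> M. component r 0 = \<zero>}"
    then have rc: "r \<in> carrier A" "r \<in> M" using Mc by auto
    have "(\<Oplus>i\<in>F. component r i) \<in> positive_part gr (A\<lparr>carrier := M\<rparr>)"
      if "finite F" "0 \<notin> F" for F
      using that
    proof (induction F rule: finite_induct)
      case empty
      then show ?case using generate.one[of ?G] by (simp add: positive_part_def)
    next
      case (insert i F)
      have "component r i \<in> positive_part gr (A\<lparr>carrier := M\<rparr>)"
        unfolding positive_part_def
        by (rule generate.incl) (use insert component_props(1)[OF rc(1)] comp[OF rc(2)] in auto)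
      moreover have "(\<Oplus>i\<in>F. component r i) \<in> positive_part gr (A\<lparr>carrier := M\<rparr>)" using insert by simp
      ultimately have "component r i \<oplus> (\<Oplus>i\<in>F. component r i) \<in> positive_part gr (A\<lparr>carrier := M\<rparr>)"
        unfolding positive_part_def using generate.eng[of _ ?G] by auto
      then show ?case using insert component_closed[OF rc(1)] by simp
    qed
    then have "(\<Oplus>i\<in>{i. component r i \<noteq> \<zero>}. component r i) \<in> positive_part gr (A\<lparr>carrier := M\<rparr>)"
      using component_props(2)[OF rc(1)] r by simp
    then show "r \<in> positive_part gr (A\<lparr>carrier := M\<rparr>)" using component_props(3)[OF rc(1)] by simp
  qed
qed

text \<open>The fibre ideal in terms of a basis: the combinations whose coefficients have no constant term.\<close>

definition positive_combinations :: "'a set \<Rightarrow> 'a set \<Rightarrow> 'a set" where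
  "positive_combinations M B = {lincomb B c (\<lambda>b. b) | c. c \<in> coeffs B M \<and> (\<forall>b\<in>B. component (c b) 0 = \<zero>)}"

context
  fixes M N B :: "'a set"
  assumes M: "graded_subring M" and N: "graded_subring N" and MsubN: "M \<subseteq> N"
    and B: "free_basis M N B"
begin

lemma M_sub: "subring M A" and N_sub: "subring N A" and M_closed: "M \<subseteq> carrier A" and N_closed: "N \<subseteq> carrier A"
  using M N subringE(1) by (auto simp: graded_subring_def)

lemma B_sub: "B \<subseteq> N" using B by (simp add: free_basis_def)

lemma id_coeff: "(\<lambda>b. b) \<in> B \<rightarrow> carrier A" using B_sub N_closed by auto

lemma coeffs_closed: "c \<in> coeffs B M \<Longrightarrow> c \<in> coeffs B (carrier A)"
  using coeffs_mono[OF M_closed] .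

lemma lincomb_in: "c \<in> coeffs B M \<Longrightarrow> lincomb B c (\<lambda>b. b) \<in> N"
  by (rule lincomb_in_subring[OF N_sub coeffs_mono[OF MsubN] B_sub])

lemma positive_combinations_add:
  assumes "x \<in> positive_combinations M B" "y \<in> positive_combinations M B"
  shows "x \<oplus> y \<in> positive_combinations M B"
proof -
  obtain c d where c: "c \<in> coeffs B M" "\<forall>b\<in>B. component (c b) 0 = \<zero>" "x = lincomb B c (\<lambda>b. b)"
    and d: "d \<in> coeffs B M" "\<forall>b\<in>B. component (d b) 0 = \<zero>" "y = lincomb B d (\<lambda>b. b)"
    using assms by (auto simp: positive_combinations_def)
  have cc: "c \<in> coeffs B (carrier A)" "d \<in> coeffs B (carrier A)" using c d coeffs_closed by auto
  have "x \<oplus> y = lincomb B (\<lambda>b. c b \<oplus> d b) (\<lambda>b. b)"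
    using lincomb_add[OF cc id_coeff] c d by simp
  moreover have "(\<lambda>b. c b \<oplus> d b) \<in> coeffs B M"
    using coeffs_mem[OF c(1)] coeffs_mem[OF d(1)] subringE(7)[OF M_sub] by (intro coeffs_add[OF cc]) auto
  moreover have "\<forall>b\<in>B. component (c b \<oplus> d b) 0 = \<zero>"
    using c d component_add coeffs_mem[OF cc(1)] coeffs_mem[OF cc(2)] by simp
  ultimately show ?thesis unfolding positive_combinations_def by blast
qed

lemma positive_combinations_scale:
  assumes p: "p \<in> M" "component p 0 = \<zero>" and x: "x \<in> N"
  shows "p \<otimes> x \<in> positive_combinations M B"
proof -
  obtain c where c: "c \<in> coeffs B M" "x = lincomb B c (\<lambda>b. b)" using B x by (auto simp: free_basis_def)
  have pc: "p \<in> carrier A" using p M_closed by blast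
  have cc: "c \<in> coeffs B (carrier A)" using c coeffs_closed by blast
  have "p \<otimes> x = lincomb B (\<lambda>b. p \<otimes> c b) (\<lambda>b. b)" using lincomb_smult[OF cc pc id_coeff] c by simp
  moreover have "(\<lambda>b. p \<otimes> c b) \<in> coeffs B M"
    using coeffs_mem[OF c(1)] subringE(6)[OF M_sub p(1)] pc by (intro coeffs_map[OF c(1)]) auto
  moreover have "\<forall>b\<in>B. component (p \<otimes> c b) 0 = \<zero>"
    using component_zero_mult[OF pc coeffs_mem[OF cc]] p(2) component_closed coeffs_mem[OF cc] by simp
  ultimately show ?thesis unfolding positive_combinations_def by blast
qed

lemma positive_combinations_zero: "\<zero> \<in> positive_combinations M B"
  using positive_combinations_scale[of \<zero> \<zero>] subringE(2)[OF M_sub] subringE(2)[OF N_sub] component_zero by simp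

lemma positive_combinations_mult:
  assumes "x \<in> positive_combinations M B" and y: "y \<in> N"
  shows "x \<otimes> y \<in> positive_combinations M B"
proof -
  obtain c where c: "c \<in> coeffs B M" "\<forall>b\<in>B. component (c b) 0 = \<zero>" "x = lincomb B c (\<lambda>b. b)"
    using assms by (auto simp: positive_combinations_def)
  have yc: "y \<in> carrier A" using y N_closed by blast
  have cb: "c b \<in> M" "c b \<in> carrier A" "b \<in> N" "b \<in> carrier A" if "b \<in> B" for b
    using coeffs_mem[OF c(1) that] M_closed N_closed B_sub that by auto
  have *: "(\<Oplus>b\<in>F. c b \<otimes> b) \<otimes> y \<in> positive_combinations M B" if "finite F" "F \<subseteq> B" for F
    using that
  proof (induction F rule: finite_induct)
    case empty
    then show ?case using positive_combinations_zero yc by simp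
  next
    case (insert b F)
    have b: "b \<in> B" using insert by simp
    have eq: "(\<Oplus>b\<in>insert b F. c b \<otimes> b) = c b \<otimes> b \<oplus> (\<Oplus>b\<in>F. c b \<otimes> b)"
      using insert cb by (intro finsum_insert) auto
    have s: "(\<Oplus>b\<in>F. c b \<otimes> b) \<in> carrier A" using insert cb by (intro finsum_closed) auto
    have "(c b \<otimes> b \<oplus> (\<Oplus>b\<in>F. c b \<otimes> b)) \<otimes> y = c b \<otimes> (b \<otimes> y) \<oplus> (\<Oplus>b\<in>F. c b \<otimes> b) \<otimes> y"
      using cb[OF b] yc s by (simp add: l_distr m_assoc)
    moreover have "c b \<otimes> (b \<otimes> y) \<in> positive_combinations M B"
      using cb[OF b] c(2) b y subringE(6)[OF N_sub] by (intro positive_combinations_scale) auto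
    ultimately show ?case using positive_combinations_add insert unfolding eq by simp
  qed
  then show ?thesis using c(1) unfolding c(3) lincomb_def coeffs_def by simp
qed

lemma positive_combinations_sub: "positive_combinations M B \<subseteq> N"
  using lincomb_in by (auto simp: positive_combinations_def)

lemma positive_combinations_ideal: "ideal (positive_combinations M B) (A\<lparr>carrier := N\<rparr>)"
proof -
  have "cring (A\<lparr>carrier := N\<rparr>)" using subcring_iff[OF N_closed] subcringI'[OF N_sub] by blast
  then interpret RN: cring "A\<lparr>carrier := N\<rparr>" .
  show ?thesis
  proof (rule RN.ideal_if_ideal_in, unfold RN.ideal_in_def, intro conjI ballI)
    fix x a assume x: "x \<in> carrier (A\<lparr>carrier := N\<rparr>)" and a: "a \<in> positive_combinations M B"
    have "a \<in> carrier A" "x \<in> carrier A" using x a positive_combinations_sub N_closed by auto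
    then show "x \<otimes>\<^bsub>A\<lparr>carrier := N\<rparr>\<^esub> a \<in> positive_combinations M B"
      using positive_combinations_mult[OF a, of x] x by (simp add: m_comm)
  qed (use positive_combinations_sub positive_combinations_zero positive_combinations_add in auto)
qed

lemma fibre_ideal_eq: "fibre_ideal gr (A\<lparr>carrier := M\<rparr>) (A\<lparr>carrier := N\<rparr>) = positive_combinations M B"
proof
  have rN: "ring (A\<lparr>carrier := N\<rparr>)" by (rule subring_is_ring[OF N_sub])
  interpret RN: ring "A\<lparr>carrier := N\<rparr>" by (rule rN)
  let ?P = "{r \<in> M. component r 0 = \<zero>}"
  have PN: "?P \<subseteq> carrier (A\<lparr>carrier := N\<rparr>)" using MsubN by auto
  have fi: "fibre_ideal gr (A\<lparr>carrier := M\<rparr>) (A\<lparr>carrier := N\<rparr>) = Idl\<^bsub>A\<lparr>carrier := N\<rparr>\<^esub> ?P"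
    unfolding fibre_ideal_def positive_part_eq[OF M] ..
  have "?P \<subseteq> positive_combinations M B"
  proof
    fix p assume p: "p \<in> ?P"
    then have "p \<otimes> \<one> \<in> positive_combinations M B"
      using subringE(3)[OF N_sub] by (intro positive_combinations_scale) auto
    then show "p \<in> positive_combinations M B" using p M_closed by auto
  qed
  then show "fibre_ideal gr (A\<lparr>carrier := M\<rparr>) (A\<lparr>carrier := N\<rparr>) \<subseteq> positive_combinations M B"
    unfolding fi by (rule RN.genideal_minimal[OF positive_combinations_ideal])
  let ?I = "Idl\<^bsub>A\<lparr>carrier := N\<rparr>\<^esub> ?P"
  interpret I: ideal ?I "A\<lparr>carrier := N\<rparr>" by (rule RN.genideal_ideal[OF PN])
  have PI: "?P \<subseteq> ?I" by (rule RN.genideal_self[OF PN])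
  show "positive_combinations M B \<subseteq> fibre_ideal gr (A\<lparr>carrier := M\<rparr>) (A\<lparr>carrier := N\<rparr>)"
  proof
    fix x assume "x \<in> positive_combinations M B"
    then obtain c where c: "c \<in> coeffs B M" "\<forall>b\<in>B. component (c b) 0 = \<zero>" "x = lincomb B c (\<lambda>b. b)"
      by (auto simp: positive_combinations_def)
    have *: "(\<Oplus>b\<in>F. c b \<otimes> b) \<in> ?I" if "finite F" "F \<subseteq> B" for F
      using that
    proof (induction F rule: finite_induct)
      case empty
      then show ?case using I.zero_closed by simp
    next
      case (insert b F)
      have cb: "c b \<in> M" "c b \<in> carrier A" "b \<in> N" "b \<in> carrier A" if "b \<in> B" for b
        using coeffs_mem[OF c(1) that] M_closed N_closed B_sub that by auto
      have "(\<Oplus>b\<in>insert b F. c b \<otimes> b) = c b \<otimes> b \<oplus> (\<Oplus>b\<in>F. c b \<otimes> b)"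
        using insert cb by (intro finsum_insert) auto
      moreover have "c b \<in> ?P" using cb c(2) insert by auto
      then have "c b \<otimes> b \<in> ?I" using I.I_r_closed[of "c b" b] PI cb insert by auto
      ultimately show ?case using insert I.a_closed by simp
    qed
    then show "x \<in> fibre_ideal gr (A\<lparr>carrier := M\<rparr>) (A\<lparr>carrier := N\<rparr>)"
      using c(1) unfolding fi c(3) lincomb_def coeffs_def by simp
  qed
qed

lemma component_lincomb:
  assumes c: "c \<in> coeffs B M" and deg: "\<And>b. b \<in> B \<Longrightarrow> b \<in> gr (e b)"
  shows "(\<lambda>b. if e b \<le> i then component (c b) (i - e b) else \<zero>) \<in> coeffs B M"
    "component (lincomb B c (\<lambda>b. b)) i = lincomb B (\<lambda>b. if e b \<le> i then component (c b) (i - e b) else \<zero>) (\<lambda>b. b)"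
proof -
  let ?d = "\<lambda>b. if e b \<le> i then component (c b) (i - e b) else \<zero>"
  let ?F = "{b \<in> B. c b \<noteq> \<zero>}"
  have fin: "finite ?F" using c by (simp add: coeffs_def)
  have cb: "c b \<in> M" "c b \<in> carrier A" "b \<in> carrier A" if "b \<in> B" for b
    using coeffs_mem[OF c that] M_closed N_closed B_sub that by auto
  show d: "?d \<in> coeffs B M"
  proof (rule coeffs_map[OF c])
    show "?d b \<in> M" if "b \<in> B" for b
      using cb(1)[OF that] M subringE(2)[OF M_sub] by (auto simp: graded_subring_def)
    show "?d b = \<zero>" if "c b = \<zero>" for b using that by (simp add: component_zero)
  qed
  have "component (lincomb B c (\<lambda>b. b)) i = (\<Oplus>b\<in>?F. component (c b \<otimes> b) i)"
    unfolding lincomb_def using fin cb by (intro component_finsum) auto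
  also have "\<dots> = (\<Oplus>b\<in>?F. ?d b \<otimes> b)"
    using component_mult[OF cb(2) deg] component_closed cb by (intro finsum_cong') auto
  also have "\<dots> = lincomb B ?d (\<lambda>b. b)"
    using fin coeffs_mem[OF coeffs_closed[OF d]] id_coeff by (intro lincomb_eq[symmetric]) (auto simp: component_zero)
  finally show "component (lincomb B c (\<lambda>b. b)) i = lincomb B ?d (\<lambda>b. b)" .
qed

text \<open>The fibre ideal is homogeneous because the basis is.\<close>

lemma positive_combinations_component:
  assumes x: "x \<in> positive_combinations M B" and deg: "\<forall>b\<in>B. \<exists>i. b \<in> gr i"
  shows "component x i \<in> positive_combinations M B"
proof -
  obtain e where e: "\<And>b. b \<in> B \<Longrightarrow> b \<in> gr (e b)" using deg by metis
  obtain c where c: "c \<in> coeffs B M" "\<forall>b\<in>B. component (c b) 0 = \<zero>" "x = lincomb B c (\<lambda>b. b)"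
    using x by (auto simp: positive_combinations_def)
  have "component (if e b \<le> i then component (c b) (i - e b) else \<zero>) 0 = \<zero>" if b: "b \<in> B" for b
    using component_homogeneous[OF component_props(1), of "c b" "i - e b" 0] c(2) b
      coeffs_mem[OF coeffs_closed[OF c(1)] b] by (auto simp: component_zero)
  then show ?thesis
    using component_lincomb[OF c(1) e, of i] unfolding c(3) positive_combinations_def by blast
qed

text \<open>The coefficients of the difference have no constant term. So every class modulo the fibre ideal is
  represented by a combination of the basis with coefficients in \<open>k\<close>.\<close>

lemma degree_zero_coefficients:
  assumes c: "c \<in> coeffs B M"
  shows "(\<lambda>b. component (c b) 0) \<in> coeffs B k"
    "lincomb B c (\<lambda>b. b) \<ominus> lincomb B (\<lambda>b. component (c b) 0) (\<lambda>b. b) \<in> positive_combinations M B"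
proof -
  have cc: "c \<in> coeffs B (carrier A)" by (rule coeffs_closed[OF c])
  have kM: "k \<subseteq> M" using M by (simp add: graded_subring_def)
  let ?p = "\<lambda>b. component (c b) 0"
  show p: "?p \<in> coeffs B k"
    using component_base coeffs_mem[OF cc] by (intro coeffs_map[OF c]) (auto simp: component_zero)
  have pM: "?p \<in> coeffs B M" using coeffs_mono[OF kM p] .
  have pA: "?p \<in> coeffs B (carrier A)" by (rule coeffs_closed[OF pM])
  have n1: "\<ominus> \<one> \<in> M" using subringE(3,5)[OF M_sub] by auto
  then have n1c: "\<ominus> \<one> \<in> carrier A" by simp
  let ?d = "\<lambda>b. c b \<oplus> \<ominus> \<one> \<otimes> ?p b"
  have np: "(\<lambda>b. \<ominus> \<one> \<otimes> ?p b) \<in> coeffs B (carrier A)"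
    using coeffs_mem[OF pA] by (intro coeffs_map[OF pA]) auto
  have d: "?d \<in> coeffs B M"
    using coeffs_mem[OF c] coeffs_mem[OF pM] subringE(6,7)[OF M_sub] n1
    by (intro coeffs_add[OF cc np]) auto
  have "component (?d b) 0 = \<zero>" if b: "b \<in> B" for b
  proof -
    have x: "c b \<in> carrier A" "?p b \<in> carrier A" using coeffs_mem[OF cc b] coeffs_mem[OF pA b] by auto
    have "component (\<ominus> \<one> \<otimes> ?p b) 0 = component (\<ominus> \<one>) 0 \<otimes> ?p b"
      using component_zero_mult[OF n1c x(2)] component_homogeneous[OF component_props(1)[OF x(1)], of 0 0] by simp
    also have "component (\<ominus> \<one>) 0 = \<ominus> \<one>"
      using component_homogeneous[of "\<ominus> \<one>" 0 0] one_gr subringE(5)[OF subfieldE(1)[OF base_field]] by (simp add: gr_zero)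
    finally show ?thesis
      using component_add[of "c b" "\<ominus> \<one> \<otimes> ?p b" 0] x by (simp add: l_minus r_neg)
  qed
  then have "lincomb B ?d (\<lambda>b. b) \<in> positive_combinations M B"
    using d unfolding positive_combinations_def by blast
  moreover have "lincomb B ?d (\<lambda>b. b) = lincomb B c (\<lambda>b. b) \<ominus> lincomb B ?p (\<lambda>b. b)"
  proof -
    have "lincomb B ?p (\<lambda>b. b) \<in> carrier A"
      using pA id_coeff by (intro lincomb_closed) (auto simp: coeffs_def)
    then show ?thesis
      using lincomb_add[OF cc np id_coeff] lincomb_smult[OF pA n1c id_coeff] by (simp add: l_minus a_minus_def)
  qed
  ultimately show "lincomb B c (\<lambda>b. b) \<ominus> lincomb B ?p (\<lambda>b. b) \<in> positive_combinations M B" by simp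
qed

end

text \<open>The isomorphism is induced by the inclusion of \<open>N\<close> in \<open>N'\<close>. It is injective on the quotient since the
  coefficients of an element of \<open>N\<close> are the same over \<open>M\<close> and over \<open>M'\<close>. It is surjective since every
  class is represented by a combination of the basis with coefficients in \<open>k\<close>, and such a combination
  lies in \<open>N\<close>.\<close>

theorem fibre_algebra_iso:
  assumes M: "graded_subring M" and N: "graded_subring N" and MsubN: "M \<subseteq> N" and B: "free_basis M N B"
    and M': "graded_subring M'" and N': "graded_subring N'" and MsubN': "M' \<subseteq> N'" and B': "free_basis M' N' B"
    and MM: "M \<subseteq> M'" and NN: "N \<subseteq> N'" and deg: "\<forall>b\<in>B. \<exists>i. b \<in> gr i"
  defines "R \<equiv> A\<lparr>carrier := M\<rparr>" and "S \<equiv> A\<lparr>carrier := N\<rparr>"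
    and "R' \<equiv> A\<lparr>carrier := M'\<rparr>" and "S' \<equiv> A\<lparr>carrier := N'\<rparr>"
  shows "\<exists>\<psi>\<in>ring_iso (fibre_algebra gr R S) (fibre_algebra gr R' S').
    (\<forall>a\<in>N. \<psi> (fibre_ideal gr R S +>\<^bsub>S\<^esub> a) = fibre_ideal gr R' S' +>\<^bsub>S'\<^esub> a) \<and>
    (\<forall>i. \<psi> ` fibre_grading gr R S i = fibre_grading gr R' S' i)"
proof -
  note ctx = M N MsubN B and ctx' = M' N' MsubN' B'
  let ?I = "positive_combinations M B" and ?I' = "positive_combinations M' B"
  have fi: "fibre_ideal gr R S = ?I" "fibre_ideal gr R' S' = ?I'"
    unfolding R_def S_def R'_def S'_def using fibre_ideal_eq[OF ctx] fibre_ideal_eq[OF ctx'] by auto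
  have Mc: "M \<subseteq> carrier A" "N \<subseteq> carrier A" "M' \<subseteq> carrier A" "N' \<subseteq> carrier A"
    using M_closed[OF ctx] N_closed[OF ctx] M_closed[OF ctx'] N_closed[OF ctx'] by auto
  interpret S: ring S unfolding S_def by (rule subring_is_ring[OF N_sub[OF ctx]])
  interpret S': ring S' unfolding S'_def by (rule subring_is_ring[OF N_sub[OF ctx']])
  interpret I': ideal ?I' S' unfolding S'_def by (rule positive_combinations_ideal[OF ctx'])
  interpret I: ideal ?I S unfolding S_def by (rule positive_combinations_ideal[OF ctx])
  define h where "h = (\<lambda>a. ?I' +>\<^bsub>S'\<^esub> a)"
  have hq: "h \<in> ring_hom S' (S' Quot ?I')" unfolding h_def by (rule I'.rcos_ring_hom)
  have hom: "h \<in> ring_hom S (S' Quot ?I')"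
  proof (rule ring_hom_memI)
    fix x y assume "x \<in> carrier S" "y \<in> carrier S"
    then have xy: "x \<in> carrier S'" "y \<in> carrier S'" using NN by (auto simp: S_def S'_def)
    show "h x \<in> carrier (S' Quot ?I')" by (rule ring_hom_closed[OF hq xy(1)])
    show "h (x \<otimes>\<^bsub>S\<^esub> y) = h x \<otimes>\<^bsub>S' Quot ?I'\<^esub> h y" using ring_hom_mult[OF hq xy] by (simp add: S_def S'_def)
    show "h (x \<oplus>\<^bsub>S\<^esub> y) = h x \<oplus>\<^bsub>S' Quot ?I'\<^esub> h y" using ring_hom_add[OF hq xy] by (simp add: S_def S'_def)
  next
    show "h \<one>\<^bsub>S\<^esub> = \<one>\<^bsub>S' Quot ?I'\<^esub>" using ring_hom_one[OF hq] by (simp add: S_def S'_def)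
  qed
  interpret h: ring_hom_ring S "S' Quot ?I'" h
    by (rule ring_hom_ringI2[OF S.ring_axioms I'.quotient_is_ring hom])
  have h_eq: "h a = h b \<longleftrightarrow> a \<ominus> b \<in> ?I'" if ab: "a \<in> N'" "b \<in> N'" for a b
  proof -
    have "a \<ominus>\<^bsub>S'\<^esub> b = a \<ominus> b"
    proof -
      have bc: "b \<in> carrier A" "\<ominus> b \<in> N'" using ab Mc subringE(5)[OF N_sub[OF ctx']] by auto
      have "\<ominus>\<^bsub>S'\<^esub> b = \<ominus> b"
        using S'.minus_equality[of "\<ominus> b" b] bc ab unfolding S'_def by (simp add: l_neg)
      then show ?thesis by (simp add: a_minus_def S'_def)
    qed
    then show ?thesis
      using S'.quotient_eq_iff_same_a_r_cos[OF I'.is_ideal, of a b] ab unfolding h_def S'_def by simp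
  qed
  have zero: "\<zero>\<^bsub>S' Quot ?I'\<^esub> = h \<zero>"
    using h.hom_zero by (simp add: S_def)
  have inter: "a \<in> ?I" if a: "a \<in> N" "a \<in> ?I'" for a
  proof -
    obtain c where c: "c \<in> coeffs B M" "a = lincomb B c (\<lambda>b. b)" using B a by (auto simp: free_basis_def)
    obtain d where d: "d \<in> coeffs B M'" "\<forall>b\<in>B. component (d b) 0 = \<zero>" "a = lincomb B d (\<lambda>b. b)"
      using a by (auto simp: positive_combinations_def)
    have "c b = d b" if "b \<in> B" for b
      using free_basis_unique[OF B' M_sub[OF ctx'] Mc(4) coeffs_mono[OF MM c(1)] d(1) _ that] c d by simp
    then show ?thesis using c d(2) unfolding positive_combinations_def by auto
  qed
  have II: "?I \<subseteq> ?I'" using coeffs_mono[OF MM] unfolding positive_combinations_def by blast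
  have "a_kernel S (S' Quot ?I') h = {a \<in> N. h a = h \<zero>}"
    unfolding a_kernel_def' zero by (simp add: S_def)
  also have "\<dots> = ?I"
  proof
    have 0: "\<zero> \<in> N'" using subringE(2)[OF N_sub[OF ctx']] .
    have m: "a \<ominus> \<zero> = a" if "a \<in> carrier A" for a using that by (simp add: a_minus_def)
    show "{a \<in> N. h a = h \<zero>} \<subseteq> ?I" using h_eq[OF _ 0] m inter NN Mc by (auto simp: subset_iff)
    show "?I \<subseteq> {a \<in> N. h a = h \<zero>}"
      using h_eq[OF _ 0] m II positive_combinations_sub[OF ctx] NN Mc by (auto simp: subset_iff)
  qed
  finally have ker: "a_kernel S (S' Quot ?I') h = ?I" .
  \<comment> \<open>a homogeneous representative is replaced by the component of the same degree\<close>
  have lift: "\<exists>a\<in>N. h a = h x \<and> (\<forall>i. x \<in> gr i \<longrightarrow> (\<exists>a'\<in>N \<inter> gr i. h a' = h x))" if x: "x \<in> N'" for x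
  proof -
    obtain c where c: "c \<in> coeffs B M'" "x = lincomb B c (\<lambda>b. b)" using B' x by (auto simp: free_basis_def)
    note z = degree_zero_coefficients[OF ctx' c(1)]
    define y where "y = lincomb B (\<lambda>b. component (c b) 0) (\<lambda>b. b)"
    have kM: "k \<subseteq> M" using M by (simp add: graded_subring_def)
    have y: "y \<in> N" unfolding y_def by (rule lincomb_in[OF ctx coeffs_mono[OF kM z(1)]])
    have yN: "y \<in> N'" "y \<in> carrier A" "x \<in> carrier A" using y NN Mc x by auto
    have xy: "x \<ominus> y \<in> ?I'" using z(2) c(2) by (simp add: y_def)
    have "\<exists>a'\<in>N \<inter> gr i. h a' = h x" if xi: "x \<in> gr i" for i
    proof -
      have yi: "component y i \<in> N" using N y by (simp add: graded_subring_def)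
      have yic: "component y i \<in> carrier A" using yi Mc by blast
      have d: "x \<ominus> y \<in> carrier A" using yN by simp
      have "x = (x \<ominus> y) \<oplus> y" using yN by algebra
      then have "component x i = component (x \<ominus> y) i \<oplus> component y i"
        using component_add[OF d yN(2)] by metis
      then have "x = component (x \<ominus> y) i \<oplus> component y i" using component_homogeneous[OF xi, of i] by simp
      moreover have "(u \<oplus> v) \<ominus> v = u" if "u \<in> carrier A" "v \<in> carrier A" for u v using that by algebra
      ultimately have "x \<ominus> component y i = component (x \<ominus> y) i"
        using component_closed[OF d] yic by metis
      then have "x \<ominus> component y i \<in> ?I'" using positive_combinations_component[OF ctx' xy deg] by simp
      then have "h x = h (component y i)" using h_eq x yi NN by blast
      then show ?thesis using yi component_props(1)[OF yN(2)] by auto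
    qed
    moreover have "h y = h x" using xy h_eq[OF x yN(1)] by simp
    ultimately show ?thesis using y by blast
  qed
  have carr: "carrier (S' Quot ?I') = h ` N'"
    unfolding FactRing_def A_RCOSETS_def' h_def S'_def by auto
  have surj: "h ` carrier S = carrier (S' Quot ?I')"
  proof
    show "h ` carrier S \<subseteq> carrier (S' Quot ?I')" unfolding carr using NN by (auto simp: S_def)
    show "carrier (S' Quot ?I') \<subseteq> h ` carrier S"
    proof
      fix z assume "z \<in> carrier (S' Quot ?I')"
      then obtain x where x: "x \<in> N'" "z = h x" unfolding carr by blast
      then obtain a where "a \<in> N" "h a = h x" using lift[OF x(1)] by blast
      then show "z \<in> h ` carrier S" using x(2) by (auto simp: S_def)
    qed
  qed
  define \<psi> where "\<psi> = (\<lambda>Y. the_elem (h ` Y))"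
  have iso: "\<psi> \<in> ring_iso (S Quot ?I) (S' Quot ?I')"
    using h.FactRing_iso_set[OF surj] unfolding ker \<psi>_def .
  have \<psi>: "\<psi> (?I +>\<^bsub>S\<^esub> a) = h a" if a: "a \<in> N" for a
  proof -
    have ac: "a \<in> carrier A" "a \<in> N'" using a Mc NN by auto
    have "h b = h a" if b: "b \<in> ?I +>\<^bsub>S\<^esub> a" for b
    proof -
      obtain p where p: "p \<in> ?I" "b = p \<oplus> a" using b by (auto simp: a_r_coset_def' S_def)
      have pc: "p \<in> carrier A" "p \<in> N" using p positive_combinations_sub[OF ctx] Mc by auto
      have "b \<ominus> a = p" unfolding p(2) using pc(1) ac(1) by algebra
      moreover have "b \<in> N'" using p(2) pc(2) a NN subringE(7)[OF N_sub[OF ctx]] by auto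
      ultimately show ?thesis using h_eq[of b a] ac II p(1) by auto
    qed
    moreover have "a \<in> ?I +>\<^bsub>S\<^esub> a"
      using I.zero_closed ac by (auto simp: a_r_coset_def' S_def intro!: bexI[of _ \<zero>])
    ultimately have "h ` (?I +>\<^bsub>S\<^esub> a) = {h a}" by blast
    then show ?thesis by (simp add: \<psi>_def)
  qed
  have "\<psi> ` fibre_grading gr R S i = fibre_grading gr R' S' i" for i
  proof -
    have "\<psi> ` fibre_grading gr R S i = h ` (gr i \<inter> N)"
      unfolding fibre_grading_def fi image_image using \<psi> by (auto simp: S_def)
    also have "\<dots> = h ` (gr i \<inter> N')"
    proof
      show "h ` (gr i \<inter> N) \<subseteq> h ` (gr i \<inter> N')" using NN by auto
      show "h ` (gr i \<inter> N') \<subseteq> h ` (gr i \<inter> N)"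
      proof
        fix z assume "z \<in> h ` (gr i \<inter> N')"
        then obtain x where x: "x \<in> gr i" "x \<in> N'" "z = h x" by blast
        then obtain a' where "a' \<in> N \<inter> gr i" "h a' = h x" using lift[OF x(2)] by blast
        then show "z \<in> h ` (gr i \<inter> N)" using x(3) by auto
      qed
    qed
    also have "\<dots> = fibre_grading gr R' S' i" unfolding fibre_grading_def fi h_def by (simp add: S'_def)
    finally show ?thesis .
  qed
  then show ?thesis
    using iso \<psi> unfolding fibre_algebra_def fi h_def by blast
qed

end

section \<open>Free graded extensions of subrings\<close>

context cring
begin

lemma finsum_subring:
  assumes N: "subring N R" and f: "finite F" "f \<in> F \<rightarrow> N"
  shows "finsum (R\<lparr>carrier := N\<rparr>) f F = finsum R f F"
proof -
  interpret N: ring "R\<lparr>carrier := N\<rparr>" by (rule subring_is_ring[OF N])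
  have Nc: "N \<subseteq> carrier R" by (rule subringE(1)[OF N])
  show ?thesis using f
  proof (induction F rule: finite_induct)
    case empty
    then show ?case by simp
  next
    case (insert x F)
    then show ?case using Nc N.finsum_insert[of F x f] finsum_insert[of F x f] by (auto simp: Pi_iff subset_iff)
  qed
qed

text \<open>Unique representation by extensional coefficient functions is the same as generation together with
  linear independence.\<close>

lemma free_graded_extension_iff:
  assumes M: "subring M R" and N: "subring N R" and MsubN: "M \<subseteq> N"
  shows "free_graded_extension gr (R\<lparr>carrier := M\<rparr>) (R\<lparr>carrier := N\<rparr>) \<longleftrightarrow>
    (\<exists>B. (\<forall>b\<in>B. \<exists>i. b \<in> gr i) \<and> free_basis M N B)"
proof -
  have Nc: "N \<subseteq> carrier R" by (rule subringE(1)[OF N])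
  have sum: "(\<Oplus>\<^bsub>R\<lparr>carrier := N\<rparr>\<^esub>b\<in>{b \<in> B. c b \<noteq> \<zero>}. c b \<otimes> b) = lincomb B c (\<lambda>b. b)"
    if "c \<in> coeffs B M" "B \<subseteq> N" for c B
    unfolding lincomb_def
  proof (rule finsum_subring[OF N])
    show "finite {b \<in> B. c b \<noteq> \<zero>}" using that(1) by (simp add: coeffs_def)
    show "(\<lambda>b. c b \<otimes> b) \<in> {b \<in> B. c b \<noteq> \<zero>} \<rightarrow> N"
      using coeffs_mem[OF that(1)] MsubN that(2) subringE(6)[OF N] by (auto simp: subset_iff)
  qed
  have eq: "(\<forall>x\<in>N. \<exists>!c. c \<in> B \<rightarrow>\<^sub>E M \<and> finite {b \<in> B. c b \<noteq> \<zero>} \<and>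
      x = (\<Oplus>\<^bsub>R\<lparr>carrier := N\<rparr>\<^esub>b\<in>{b \<in> B. c b \<noteq> \<zero>}. c b \<otimes> b)) \<longleftrightarrow> free_basis M N B" (is "?E \<longleftrightarrow> _")
    if B: "B \<subseteq> N" for B
  proof -
    have id: "(\<lambda>b. b) \<in> B \<rightarrow> carrier R" using B Nc by auto
    have E: "(c \<in> B \<rightarrow>\<^sub>E M \<and> finite {b \<in> B. c b \<noteq> \<zero>} \<and>
        x = (\<Oplus>\<^bsub>R\<lparr>carrier := N\<rparr>\<^esub>b\<in>{b \<in> B. c b \<noteq> \<zero>}. c b \<otimes> b))
      \<longleftrightarrow> c \<in> extensional B \<and> c \<in> coeffs B M \<and> x = lincomb B c (\<lambda>b. b)" for c x
      using sum[OF _ B, of c] by (auto simp: PiE_def coeffs_def)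
    have restr: "restrict c B \<in> extensional B \<and> restrict c B \<in> coeffs B M \<and> lincomb B (restrict c B) (\<lambda>b. b) = lincomb B c (\<lambda>b. b)"
      if c: "c \<in> coeffs B M" for c
    proof -
      have "restrict c B \<in> coeffs B M" using coeffs_mem[OF c] by (intro coeffs_map[OF c]) auto
      moreover have "lincomb B (restrict c B) (\<lambda>b. b) = lincomb B c (\<lambda>b. b)"
        using coeffs_mem[OF c] MsubN Nc id by (intro lincomb_cong) auto
      ultimately show ?thesis by simp
    qed
    show ?thesis
    proof
      assume ex: ?E
      show "free_basis M N B"
        unfolding free_basis_def
      proof (intro conjI ballI impI)
        show "B \<subseteq> N" by fact
        show "\<exists>c\<in>coeffs B M. x = lincomb B c (\<lambda>b. b)" if "x \<in> N" for x
          using ex that unfolding E by blast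
        fix c b assume c: "c \<in> coeffs B M" "lincomb B c (\<lambda>b. b) = \<zero>" and b: "b \<in> B"
        have z: "(\<lambda>_. \<zero>) \<in> coeffs B M" using subringE(2)[OF M] by (auto simp: coeffs_def)
        have "restrict c B = restrict (\<lambda>_. \<zero>) B"
          using ex subringE(2)[OF N] restr[OF c(1)] restr[OF z] c(2) lincomb_zero unfolding E by metis
        then show "c b = \<zero>" using b by (metis restrict_apply')
      qed
    next
      assume fb: "free_basis M N B"
      show ?E
        unfolding E
      proof (intro ballI ex_ex1I)
        fix x assume "x \<in> N"
        then obtain c where "c \<in> coeffs B M" "x = lincomb B c (\<lambda>b. b)" using fb by (auto simp: free_basis_def)
        then show "\<exists>c. c \<in> extensional B \<and> c \<in> coeffs B M \<and> x = lincomb B c (\<lambda>b. b)" using restr by metis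
      next
        fix x c d
        assume "c \<in> extensional B \<and> c \<in> coeffs B M \<and> x = lincomb B c (\<lambda>b. b)"
          "d \<in> extensional B \<and> d \<in> coeffs B M \<and> x = lincomb B d (\<lambda>b. b)"
        then have cd: "c \<in> extensional B" "d \<in> extensional B" "c \<in> coeffs B M" "d \<in> coeffs B M"
          "lincomb B c (\<lambda>b. b) = lincomb B d (\<lambda>b. b)" by auto
        have "c b = d b" if "b \<in> B" for b
          by (rule free_basis_unique[OF fb M Nc cd(3-5) that])
        then show "c = d" using cd(1,2) by (rule extensionalityI[rotated 2])
      qed
    qed
  qed
  have "free_graded_extension gr (R\<lparr>carrier := M\<rparr>) (R\<lparr>carrier := N\<rparr>) \<longleftrightarrow>
    (\<exists>B\<subseteq>N. (\<forall>b\<in>B. \<exists>i. b \<in> gr i) \<and>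
      (\<forall>x\<in>N. \<exists>!c. c \<in> B \<rightarrow>\<^sub>E M \<and> finite {b \<in> B. c b \<noteq> \<zero>} \<and>
        x = (\<Oplus>\<^bsub>R\<lparr>carrier := N\<rparr>\<^esub>b\<in>{b \<in> B. c b \<noteq> \<zero>}. c b \<otimes> b)))"
    by (simp add: free_graded_extension_def)
  also have "\<dots> \<longleftrightarrow> (\<exists>B\<subseteq>N. (\<forall>b\<in>B. \<exists>i. b \<in> gr i) \<and> free_basis M N B)"
  proof (rule ex_cong1, rule conj_cong[OF refl], rule conj_cong[OF refl])
    fix B assume "B \<subseteq> N"
    then show "(\<forall>x\<in>N. \<exists>!c. c \<in> B \<rightarrow>\<^sub>E M \<and> finite {b \<in> B. c b \<noteq> \<zero>} \<and>
        x = (\<Oplus>\<^bsub>R\<lparr>carrier := N\<rparr>\<^esub>b\<in>{b \<in> B. c b \<noteq> \<zero>}. c b \<otimes> b)) = free_basis M N B"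
      by (rule eq)
  qed
  also have "\<dots> \<longleftrightarrow> (\<exists>B. (\<forall>b\<in>B. \<exists>i. b \<in> gr i) \<and> free_basis M N B)"
    by (auto simp: free_basis_def)
  finally show ?thesis .
qed

end

section \<open>Groups of graded automorphisms\<close>

lemma (in ring) graded_aut_subgroup:
  "subgroup {\<rho> \<in> ring_hom R R \<inter> Bij (carrier R). (\<forall>i. \<rho> ` gr i = gr i) \<and> (\<forall>c\<in>k. \<rho> c = c)} (BijGroup (carrier R))"
  if gr: "\<And>i. gr i \<subseteq> carrier R" and k: "k \<subseteq> carrier R"
proof (rule group.subgroupI[OF group_BijGroup])
  let ?X = "{\<rho> \<in> ring_hom R R \<inter> Bij (carrier R). (\<forall>i. \<rho> ` gr i = gr i) \<and> (\<forall>c\<in>k. \<rho> c = c)}"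
  show "?X \<subseteq> carrier (BijGroup (carrier R))" by (auto simp: BijGroup_def)
  have "(\<lambda>x\<in>carrier R. x) \<in> ring_hom R R" by (rule ring_hom_memI) auto
  moreover have "(\<lambda>x\<in>carrier R. x) ` gr i = gr i" for i using gr[of i] by (auto simp: image_def subset_iff)
  ultimately have "(\<lambda>x\<in>carrier R. x) \<in> ?X" using id_Bij[of "carrier R"] k by auto
  then show "?X \<noteq> {}" by blast
  fix \<rho> assume r: "\<rho> \<in> ?X"
  then have rB: "\<rho> \<in> Bij (carrier R)" and rh: "\<rho> \<in> ring_hom R R" by auto
  let ?s = "\<lambda>x\<in>carrier R. inv_into (carrier R) \<rho> x"
  have s: "?s (\<rho> x) = x" if "x \<in> carrier R" for x
    using that rB ring_hom_closed[OF rh that] by (auto simp: Bij_def bij_betw_def)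
  have surj: "\<exists>x\<in>carrier R. y = \<rho> x" if "y \<in> carrier R" for y
    using that rB by (auto simp: Bij_def bij_betw_def)
  have "?s \<in> ring_hom R R"
  proof (rule ring_hom_memI)
    fix y assume "y \<in> carrier R"
    then show "?s y \<in> carrier R" using surj s by metis
    fix z assume z: "z \<in> carrier R"
    obtain u v where uv: "u \<in> carrier R" "y = \<rho> u" "v \<in> carrier R" "z = \<rho> v"
      using surj[OF \<open>y \<in> carrier R\<close>] surj[OF z] by blast
    have "y \<otimes> z = \<rho> (u \<otimes> v)" "y \<oplus> z = \<rho> (u \<oplus> v)"
      using ring_hom_mult[OF rh uv(1,3)] ring_hom_add[OF rh uv(1,3)] uv by auto
    then show "?s (y \<otimes> z) = ?s y \<otimes> ?s z" "?s (y \<oplus> z) = ?s y \<oplus> ?s z"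
      using s[of "u \<otimes> v"] s[of "u \<oplus> v"] s[of u] s[of v] uv by auto
  next
    show "?s \<one> = \<one>" using s[OF one_closed] ring_hom_one[OF rh] by simp
  qed
  moreover have "?s ` gr i = gr i" for i
  proof -
    have "?s ` gr i = ?s ` \<rho> ` gr i" using r by auto
    also have "\<dots> = (\<lambda>x. x) ` gr i"
      unfolding image_image by (rule image_cong[OF refl], rule s) (use gr[of i] in blast)
    finally show ?thesis by simp
  qed
  moreover have "?s c = c" if "c \<in> k" for c using s[of c] r that k by auto
  ultimately have "?s \<in> ?X" using restrict_inv_into_Bij[OF rB] by blast
  then show "inv\<^bsub>BijGroup (carrier R)\<^esub> \<rho> \<in> ?X" using inv_BijGroup[OF rB] by simp
  fix \<tau> assume t: "\<tau> \<in> ?X"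
  then have tB: "\<tau> \<in> Bij (carrier R)" and th: "\<tau> \<in> ring_hom R R" by auto
  have m: "\<rho> \<otimes>\<^bsub>BijGroup (carrier R)\<^esub> \<tau> = compose (carrier R) \<rho> \<tau>" using rB tB by (simp add: BijGroup_def)
  have "compose (carrier R) \<rho> \<tau> \<in> ring_hom R R"
    using ring_hom_closed[OF th] ring_hom_closed[OF rh] ring_hom_mult[OF th] ring_hom_mult[OF rh]
      ring_hom_add[OF th] ring_hom_add[OF rh] ring_hom_one[OF th] ring_hom_one[OF rh]
    by (intro ring_hom_memI) (auto simp: compose_def)
  moreover have "compose (carrier R) \<rho> \<tau> ` gr i = gr i" for i
  proof -
    have "compose (carrier R) \<rho> \<tau> ` gr i = \<rho> ` \<tau> ` gr i"
      unfolding image_image using gr[of i] by (intro image_cong[OF refl]) (auto simp: compose_def)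
    then show ?thesis using r t by auto
  qed
  moreover have "compose (carrier R) \<rho> \<tau> c = c" if "c \<in> k" for c using r t k that by (auto simp: compose_def)
  ultimately show "\<rho> \<otimes>\<^bsub>BijGroup (carrier R)\<^esub> \<tau> \<in> ?X" using compose_Bij[OF rB tB] unfolding m by blast
qed

context graded_algebra
begin

lemma graded_aut_group_subgroup:
  assumes "subgroup L (graded_aut_group A k gr)"
  shows "subgroup L (BijGroup (carrier A))"
    "\<And>\<rho>. \<rho> \<in> L \<Longrightarrow> \<rho> \<in> ring_hom A A \<inter> Bij (carrier A) \<and> (\<forall>i. \<rho> ` gr i = gr i) \<and> (\<forall>c\<in>k. \<rho> c = c)"
proof -
  have "\<And>i. gr i \<subseteq> carrier A" "k \<subseteq> carrier A" using gr_closed subfieldE(3)[OF base_field] by auto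
  from graded_aut_subgroup[OF this] show "subgroup L (BijGroup (carrier A))"
    by (rule group.incl_subgroup[OF group_BijGroup _ assms[unfolded graded_aut_group_def]])
  show "\<And>\<rho>. \<rho> \<in> L \<Longrightarrow> \<rho> \<in> ring_hom A A \<inter> Bij (carrier A) \<and> (\<forall>i. \<rho> ` gr i = gr i) \<and> (\<forall>c\<in>k. \<rho> c = c)"
    using subgroup.subset[OF assms] by (auto simp: graded_aut_group_def)
qed

lemma graded_action:
  assumes G: "subgroup G (graded_aut_group A k gr)" and fin: "finite G"
  shows "graded_action A k gr (BijGroup (carrier A)\<lparr>carrier := G\<rparr>)"
proof -
  note GB = graded_aut_group_subgroup[OF G]
  have GBij: "\<And>\<rho>. \<rho> \<in> G \<Longrightarrow> \<rho> \<in> Bij (carrier A)" using GB(2) by blast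
  interpret \<Gamma>: group "BijGroup (carrier A)\<lparr>carrier := G\<rparr>"
    by (rule group.subgroup_imp_group[OF group_BijGroup GB(1)])
  show ?thesis
  proof
    show "finite (carrier (BijGroup (carrier A)\<lparr>carrier := G\<rparr>))" using fin by simp
  next
    fix \<rho> assume r: "\<rho> \<in> carrier (BijGroup (carrier A)\<lparr>carrier := G\<rparr>)"
    then show "\<rho> \<in> ring_hom A A" using GB(2) by auto
    {
      fix \<tau> a assume "\<tau> \<in> carrier (BijGroup (carrier A)\<lparr>carrier := G\<rparr>)" "a \<in> carrier A"
      then show "(\<rho> \<otimes>\<^bsub>BijGroup (carrier A)\<lparr>carrier := G\<rparr>\<^esub> \<tau>) a = \<rho> (\<tau> a)"
        using r GBij by (simp add: BijGroup_def compose_def)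
    }
    {
      assume "\<And>a. a \<in> carrier A \<Longrightarrow> \<rho> a = a"
      moreover have "\<rho> \<in> extensional (carrier A)" using r GBij by (simp add: Bij_def)
      ultimately show "\<rho> = \<one>\<^bsub>BijGroup (carrier A)\<lparr>carrier := G\<rparr>\<^esub>"
        by (auto simp: BijGroup_def intro: extensionalityI)
    }
    {
      fix a i assume "a \<in> gr i"
      then show "\<rho> a \<in> gr i" using GB(2) r by auto
    }
    {
      fix a assume "a \<in> k"
      then show "\<rho> a = a" using GB(2) r by auto
    }
  next
    fix a assume "a \<in> carrier A"
    then show "\<one>\<^bsub>BijGroup (carrier A)\<lparr>carrier := G\<rparr>\<^esub> a = a" by (simp add: BijGroup_def)
  qed
qed

end

section \<open>Free extensions of rings of invariants\<close>

theorem theorem4: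
  fixes A :: "('a, 'm) ring_scheme" and k :: "'a set" and gr :: "nat \<Rightarrow> 'a set"
    and G H K :: "('a \<Rightarrow> 'a) set"
  assumes "normal_graded_algebra A k gr"
    and "subgroup G (graded_aut_group A k gr)" and "finite G"
    and "subgroup H (graded_aut_group A k gr)" and "H \<subseteq> G"
    and "subgroup K (graded_aut_group A k gr)" and "K \<subseteq> G"
    and "reflection_subgroup A G \<subseteq> K"
    and "free_graded_extension gr (ring_of_invariants A G) (ring_of_invariants A H)"
  shows
    "(G = generate (BijGroup (carrier A)) (H \<union> reflections A G) \<and>
      G = reflection_subgroup A G <#>\<^bsub>BijGroup (carrier A)\<^esub> H) \<and>
     ((\<exists>\<mu> \<in> ring_iso (tensor_product (ring_of_invariants A G) (ring_of_invariants A K) (ring_of_invariants A H))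
                     (ring_of_invariants A (K \<inter> H)).
         \<forall>a\<in>carrier (ring_of_invariants A K). \<forall>b\<in>carrier (ring_of_invariants A H).
           \<mu> (pure_tensor (ring_of_invariants A G) (ring_of_invariants A K) (ring_of_invariants A H) a b) = a \<otimes>\<^bsub>A\<^esub> b) \<and>
      free_graded_extension gr (ring_of_invariants A K) (ring_of_invariants A (K \<inter> H)) \<and>
      carrier (ring_of_invariants A (K \<inter> H)) =
        generate_ring A (carrier (ring_of_invariants A K) \<union> carrier (ring_of_invariants A H))) \<and>
     ((graded_gorenstein_extension gr (ring_of_invariants A G) (ring_of_invariants A H) \<longleftrightarrow>
         graded_gorenstein_extension gr (ring_of_invariants A K) (ring_of_invariants A (K \<inter> H))) \<and>
      (graded_ci_extension k gr (ring_of_invariants A G) (ring_of_invariants A H) \<longleftrightarrow>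
         graded_ci_extension k gr (ring_of_invariants A K) (ring_of_invariants A (K \<inter> H))))"
proof -
  interpret normal_graded_algebra A k gr by fact
  define \<Gamma> where "\<Gamma> = BijGroup (carrier A)\<lparr>carrier := G\<rparr>"
  interpret \<Gamma>: graded_action A k gr \<Gamma>
    unfolding \<Gamma>_def by (rule graded_action[OF assms(2,3)])
  have carr: "carrier \<Gamma> = G" by (simp add: \<Gamma>_def)
  have mult: "\<rho> \<otimes>\<^bsub>\<Gamma>\<^esub> \<tau> = \<rho> \<otimes>\<^bsub>BijGroup (carrier A)\<^esub> \<tau>" for \<rho> \<tau> by (simp add: \<Gamma>_def)
  interpret Bij: group "BijGroup (carrier A)" by (rule group_BijGroup)
  note GB = graded_aut_group_subgroup(1)[OF assms(2)] and HB = graded_aut_group_subgroup(1)[OF assms(4)]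
    and KB = graded_aut_group_subgroup(1)[OF assms(6)]
  have sub\<Gamma>: "subgroup L \<Gamma>" if "subgroup L (BijGroup (carrier A))" "L \<subseteq> G" for L
    unfolding \<Gamma>_def by (rule Bij.subgroup_incl[OF that(1) GB that(2)])
  note H\<Gamma> = sub\<Gamma>[OF HB assms(5)] and K\<Gamma> = sub\<Gamma>[OF KB assms(7)]
  have KH\<Gamma>: "subgroup (K \<inter> H) \<Gamma>" by (rule \<Gamma>.G.subgroups_Inter_pair[OF K\<Gamma> H\<Gamma>])
  have inv: "ring_of_invariants A L = A\<lparr>carrier := \<Gamma>.Inv L\<rparr>" for L
    by (simp add: ring_of_invariants_def \<Gamma>.Inv_def)
  have sub: "subring (\<Gamma>.Inv L) A" if "L \<subseteq> G" for L using \<Gamma>.Inv_subring that carr by simp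
  have KHG: "K \<inter> H \<subseteq> G" using assms(5) by blast
  obtain B where B: "\<forall>b\<in>B. \<exists>i. b \<in> gr i" "free_basis (\<Gamma>.Inv G) (\<Gamma>.Inv H) B"
    using assms(9) free_graded_extension_iff[OF sub sub \<Gamma>.Inv_antimono, of G H] assms(5) unfolding inv by auto
  interpret F: graded_free_invariants A k gr \<Gamma> H B
  proof (intro graded_free_invariants.intro free_invariants.intro free_invariants_axioms.intro
      graded_free_invariants_axioms.intro)
    show "graded_action A k gr \<Gamma>" "faithful_ring_action A \<Gamma>" by unfold_locales
    show "subgroup H \<Gamma>" by (rule H\<Gamma>)
    show "free_basis (\<Gamma>.Inv (carrier \<Gamma>)) (\<Gamma>.Inv H) B" unfolding carr by (rule B(2))
    show "\<exists>i. b \<in> gr i" if "b \<in> B" for b using B(1) that by blast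
  qed
  obtain S where S: "finite S" "S \<subseteq> carrier A" "carrier A = generate_ring A (k \<union> S)"
    using finitely_generated by blast
  have noeth: "noetherian_ring A" by (rule noetherian_ring_if_finitely_generated[OF base_field S])
  let ?W = "reflection_subgroup A G"
  have reflG: "reflections A G \<subseteq> G" by (auto simp: reflections_def)
  have GBij: "G \<subseteq> carrier (BijGroup (carrier A))" by (rule subgroup.subset[OF GB])
  have WB: "subgroup ?W (BijGroup (carrier A))"
    unfolding reflection_subgroup_def using reflG GBij by (intro Bij.generate_is_subgroup) auto
  have WG: "?W \<subseteq> G"
    unfolding reflection_subgroup_def by (rule Bij.generate_subgroup_incl[OF reflG GB])
  have reflW: "reflections A G \<subseteq> ?W" unfolding reflection_subgroup_def by (auto intro: generate.incl)
  \<comment> \<open>the reflection subgroup is itself an admissible choice for \<open>K\<close>\<close>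
  have WH: "\<exists>w\<in>?W. \<exists>h\<in>H. g = w \<otimes>\<^bsub>BijGroup (carrier A)\<^esub> h" if "g \<in> G" for g
    using F.product_decomposition[OF noeth normal sub\<Gamma>[OF WB WG], of g, unfolded carr mult, OF reflW that] .
  have KH: "\<exists>w\<in>K. \<exists>h\<in>H. g = w \<otimes>\<^bsub>\<Gamma>\<^esub> h" if "g \<in> carrier \<Gamma>" for g
    using WH[of g] that assms(8) unfolding carr mult by blast
  have i1: "G = generate (BijGroup (carrier A)) (H \<union> reflections A G)"
  proof
    show "generate (BijGroup (carrier A)) (H \<union> reflections A G) \<subseteq> G"
      using assms(5) reflG by (intro Bij.generate_subgroup_incl[OF _ GB]) auto
    show "G \<subseteq> generate (BijGroup (carrier A)) (H \<union> reflections A G)"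
    proof
      fix g assume "g \<in> G"
      then obtain w h where wh: "w \<in> ?W" "h \<in> H" "g = w \<otimes>\<^bsub>BijGroup (carrier A)\<^esub> h" using WH by blast
      have "w \<in> generate (BijGroup (carrier A)) (H \<union> reflections A G)"
        using wh(1) Bij.mono_generate[of "reflections A G" "H \<union> reflections A G"] unfolding reflection_subgroup_def by blast
      then show "g \<in> generate (BijGroup (carrier A)) (H \<union> reflections A G)"
        unfolding wh(3) using wh(2) by (intro generate.eng) (auto intro: generate.incl)
    qed
  qed
  have i2: "G = ?W <#>\<^bsub>BijGroup (carrier A)\<^esub> H"
  proof
    show "G \<subseteq> ?W <#>\<^bsub>BijGroup (carrier A)\<^esub> H" using WH by (auto simp: set_mult_def)
    show "?W <#>\<^bsub>BijGroup (carrier A)\<^esub> H \<subseteq> G"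
      using WG assms(5) subgroup.m_closed[OF GB] by (auto simp: set_mult_def)
  qed
  have B': "free_basis (\<Gamma>.Inv K) (\<Gamma>.Inv (K \<inter> H)) B"
    using F.free_basis_intersection[OF noeth normal K\<Gamma> _ KH] reflW assms(8) unfolding carr by blast
  have tensor: "\<exists>\<mu>\<in>ring_iso (tensor_product (A\<lparr>carrier := \<Gamma>.Inv G\<rparr>) (A\<lparr>carrier := \<Gamma>.Inv K\<rparr>) (A\<lparr>carrier := \<Gamma>.Inv H\<rparr>))
      (A\<lparr>carrier := \<Gamma>.Inv (K \<inter> H)\<rparr>). \<forall>a\<in>\<Gamma>.Inv K. \<forall>b\<in>\<Gamma>.Inv H.
      \<mu> (pure_tensor (A\<lparr>carrier := \<Gamma>.Inv G\<rparr>) (A\<lparr>carrier := \<Gamma>.Inv K\<rparr>) (A\<lparr>carrier := \<Gamma>.Inv H\<rparr>) a b) = a \<otimes>\<^bsub>A\<^esub> b"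
    by (rule tensor_product_iso[OF sub sub sub sub \<Gamma>.Inv_antimono \<Gamma>.Inv_antimono \<Gamma>.Inv_antimono \<Gamma>.Inv_antimono B(2) B'])
      (use assms(5,7) in auto)
  have free': "free_graded_extension gr (A\<lparr>carrier := \<Gamma>.Inv K\<rparr>) (A\<lparr>carrier := \<Gamma>.Inv (K \<inter> H)\<rparr>)"
    using free_graded_extension_iff[OF sub[OF assms(7)] sub[OF KHG] \<Gamma>.Inv_antimono[OF Int_lower1]] B(1) B' by blast
  have gen: "\<Gamma>.Inv (K \<inter> H) = generate_ring A (\<Gamma>.Inv K \<union> \<Gamma>.Inv H)"
  proof
    have c: "\<Gamma>.Inv K \<union> \<Gamma>.Inv H \<subseteq> carrier A" using \<Gamma>.Inv_closed by blast
    show "generate_ring A (\<Gamma>.Inv K \<union> \<Gamma>.Inv H) \<subseteq> \<Gamma>.Inv (K \<inter> H)"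
      using \<Gamma>.Inv_antimono[OF Int_lower1[of K H]] \<Gamma>.Inv_antimono[OF Int_lower2[of K H]]
      by (intro generate_ring_min_subring1[OF c sub[OF KHG]]) auto
    show "\<Gamma>.Inv (K \<inter> H) \<subseteq> generate_ring A (\<Gamma>.Inv K \<union> \<Gamma>.Inv H)"
    proof
      fix x assume "x \<in> \<Gamma>.Inv (K \<inter> H)"
      then obtain c' where c': "c' \<in> coeffs B (\<Gamma>.Inv K)" "x = lincomb B c' (\<lambda>b. b)"
        using B' unfolding free_basis_def by blast
      have incl: "\<Gamma>.Inv K \<subseteq> generate_ring A (\<Gamma>.Inv K \<union> \<Gamma>.Inv H)" "B \<subseteq> generate_ring A (\<Gamma>.Inv K \<union> \<Gamma>.Inv H)"
        using B(2) generate_ring.incl[of _ "\<Gamma>.Inv K \<union> \<Gamma>.Inv H" A] by (auto simp: free_basis_def)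
      show "x \<in> generate_ring A (\<Gamma>.Inv K \<union> \<Gamma>.Inv H)"
        unfolding c'(2) by (rule lincomb_in_subring[OF generate_ring_is_subring[OF c] coeffs_mono[OF incl(1) c'(1)] incl(2)])
    qed
  qed
  have gs: "graded_subring (\<Gamma>.Inv L)" if "L \<subseteq> G" for L
    unfolding graded_subring_def using sub[OF that] \<Gamma>.base_Inv \<Gamma>.component_Inv that carr by auto
  let ?R = "A\<lparr>carrier := \<Gamma>.Inv G\<rparr>" and ?S = "A\<lparr>carrier := \<Gamma>.Inv H\<rparr>"
    and ?R' = "A\<lparr>carrier := \<Gamma>.Inv K\<rparr>" and ?S' = "A\<lparr>carrier := \<Gamma>.Inv (K \<inter> H)\<rparr>"
  obtain \<psi> where \<psi>: "\<psi> \<in> ring_iso (fibre_algebra gr ?R ?S) (fibre_algebra gr ?R' ?S')"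
    "\<forall>a\<in>\<Gamma>.Inv H. \<psi> (fibre_ideal gr ?R ?S +>\<^bsub>?S\<^esub> a) = fibre_ideal gr ?R' ?S' +>\<^bsub>?S'\<^esub> a"
    "\<forall>i. \<psi> ` fibre_grading gr ?R ?S i = fibre_grading gr ?R' ?S' i"
    using fibre_algebra_iso[OF gs gs \<Gamma>.Inv_antimono B(2) gs gs \<Gamma>.Inv_antimono B' \<Gamma>.Inv_antimono \<Gamma>.Inv_antimono B(1)]
      assms(5,7) KHG by blast
  have fc: "cring (fibre_algebra gr (A\<lparr>carrier := M\<rparr>) (A\<lparr>carrier := N\<rparr>))"
    if M: "graded_subring M" "graded_subring N" "M \<subseteq> N" "free_basis M N B" for M N
  proof -
    have "cring (A\<lparr>carrier := N\<rparr>)" using subcring_iff[OF N_closed[OF M]] subcringI'[OF N_sub[OF M]] by blast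
    then show ?thesis
      unfolding fibre_algebra_def fibre_ideal_eq[OF M]
      by (rule ideal.quotient_is_cring[OF positive_combinations_ideal[OF M]])
  qed
  have fc1: "cring (fibre_algebra gr ?R ?S)"
    by (rule fc[OF gs gs \<Gamma>.Inv_antimono B(2)]) (use assms(5) in auto)
  have fc2: "cring (fibre_algebra gr ?R' ?S')"
    by (rule fc[OF gs gs \<Gamma>.Inv_antimono B']) (use assms(7) KHG in auto)
  define \<xi> where "\<xi> = inv_into (carrier (fibre_algebra gr ?R ?S)) \<psi>"
  have \<xi>: "\<xi> \<in> ring_iso (fibre_algebra gr ?R' ?S') (fibre_algebra gr ?R ?S)"
    unfolding \<xi>_def by (rule iso_inv[OF \<psi>(1) fc1 fc2])
  have \<xi>\<psi>: "\<xi> (\<psi> y) = y" if "y \<in> carrier (fibre_algebra gr ?R ?S)" for y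
    unfolding \<xi>_def using that ring_isoD(3)[OF \<psi>(1)] by (rule inv_into_f_f[rotated])
  have coset_in: "fibre_ideal gr ?R ?S +>\<^bsub>?S\<^esub> a \<in> carrier (fibre_algebra gr ?R ?S)" if "a \<in> \<Gamma>.Inv H" for a
    using that unfolding fibre_algebra_def FactRing_def A_RCOSETS_def' by auto
  have gor: "graded_gorenstein_extension gr ?R ?S \<longleftrightarrow> graded_gorenstein_extension gr ?R' ?S'"
    unfolding graded_gorenstein_extension_def
    using assms(9)[unfolded inv] free' krull_dim_iso[OF \<psi>(1) fc1 fc2]
      gorenstein_local_ring_iso[OF \<psi>(1) fc2] gorenstein_local_ring_iso[OF \<xi> fc1] by auto
  have kH: "k \<subseteq> \<Gamma>.Inv H" using \<Gamma>.base_Inv[of H] assms(5) carr by simp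
  have "graded_complete_intersection (A\<lparr>carrier := k\<rparr>) (fibre_algebra gr ?R ?S)
      (fibre_grading gr ?R ?S) (\<lambda>c. fibre_ideal gr ?R ?S +>\<^bsub>?S\<^esub> c) \<longleftrightarrow>
    graded_complete_intersection (A\<lparr>carrier := k\<rparr>) (fibre_algebra gr ?R' ?S')
      (fibre_grading gr ?R' ?S') (\<lambda>c. fibre_ideal gr ?R' ?S' +>\<^bsub>?S'\<^esub> c)"
  proof
    assume "graded_complete_intersection (A\<lparr>carrier := k\<rparr>) (fibre_algebra gr ?R ?S)
      (fibre_grading gr ?R ?S) (\<lambda>c. fibre_ideal gr ?R ?S +>\<^bsub>?S\<^esub> c)"
    then show "graded_complete_intersection (A\<lparr>carrier := k\<rparr>) (fibre_algebra gr ?R' ?S')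
      (fibre_grading gr ?R' ?S') (\<lambda>c. fibre_ideal gr ?R' ?S' +>\<^bsub>?S'\<^esub> c)"
      by (rule graded_complete_intersection_iso[OF \<psi>(1), rotated 2]) (use \<psi>(2,3) kH in auto)
  next
    have "\<xi> ` fibre_grading gr ?R' ?S' j = fibre_grading gr ?R ?S j" for j
    proof -
      have "fibre_grading gr ?R ?S j \<subseteq> carrier (fibre_algebra gr ?R ?S)"
        using coset_in by (auto simp: fibre_grading_def)
      then have "\<xi> ` \<psi> ` fibre_grading gr ?R ?S j = fibre_grading gr ?R ?S j"
        using \<xi>\<psi> by (force simp: image_image subset_iff)
      then show ?thesis using \<psi>(3) by simp
    qed
    moreover have "\<xi> (fibre_ideal gr ?R' ?S' +>\<^bsub>?S'\<^esub> c) = fibre_ideal gr ?R ?S +>\<^bsub>?S\<^esub> c" if "c \<in> k" for c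
    proof -
      have "c \<in> \<Gamma>.Inv H" using that kH by blast
      then show ?thesis using \<xi>\<psi>[OF coset_in] \<psi>(2) by metis
    qed
    moreover assume "graded_complete_intersection (A\<lparr>carrier := k\<rparr>) (fibre_algebra gr ?R' ?S')
      (fibre_grading gr ?R' ?S') (\<lambda>c. fibre_ideal gr ?R' ?S' +>\<^bsub>?S'\<^esub> c)"
    ultimately show "graded_complete_intersection (A\<lparr>carrier := k\<rparr>) (fibre_algebra gr ?R ?S)
      (fibre_grading gr ?R ?S) (\<lambda>c. fibre_ideal gr ?R ?S +>\<^bsub>?S\<^esub> c)"
      by (intro graded_complete_intersection_iso[OF \<xi>]) auto
  qed
  then have ci: "graded_ci_extension k gr ?R ?S \<longleftrightarrow> graded_ci_extension k gr ?R' ?S'"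
    unfolding graded_ci_extension_def using assms(9)[unfolded inv] free' by simp
  show ?thesis
    using i1 i2 tensor free' gen gor ci unfolding inv by simp
qed

end
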